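(* Let $T>0$, let $m\ge1$ be an integer and let $\{X_s,\ s\ge 0\}$ be a real-valued stochastic process with independent increments. For $\theta\in\mathbb R$ consider the conditions: (A$_\theta$) There exists a constant $K(\theta)$ such that for all $0\le s<t\le T$ and all $\varepsilon>0$, $$\varepsilon^2\int_{\frac{2s}{\varepsilon^2}}^{\frac{2t}{\varepsilon^2}}\int_{\frac{2s}{\varepsilon^2}}^{y}\|\phi_{X_y-X_x}(\theta)\|\,dx\,dy\le K(\theta)(t-s).$$ (B$_\theta$) There exists a constant $c(\theta)$ such that for all $0\le s<t\le T$, $$\lim_{\varepsilon\to0}\varepsilon^2c(\theta)^2\int_{\frac{2s}{\varepsilon^2}}^{\frac{2t}{\varepsilon^2}}\int_{\frac{2s}{\varepsilon^2}}^{x}\big[\phi_{X_x-X_y}(\theta)+\phi_{X_x-X_y}(-\theta)\big]\,dy\,dx=2(t-s).$$ (C$_\theta$) For all $0\le s<t\le T$, $$\lim_{\varepsilon\to0}\varepsilon^2\int_{\frac{2s}{\varepsilon^2}}^{\frac{2t}{\varepsilon^2}}\int_{\frac{2s}{\varepsilon^2}}^{y}\|\phi_{X_y-X_x}(\theta)\|\,\big\|\phi_{X_x-X_{2s/\varepsilon^2}}(2\theta)\big\|\,dx\,dy=0.$$ For $\theta,\theta'\in\mathbb R$ consider also the condition: (D$_{\theta,\theta'}$) For every $c_1\in\{-1,1\}$ and all $0\le s<t\le T$, $$\lim_{\varepsilon\to0}\varepsilon^2\int_{\frac{2s}{\varepsilon^2}}^{\frac{2t}{\varepsilon^2}}\int_{\frac{2s}{\varepsilon^2}}^{y}\|\phi_{X_y-X_x}(\theta)\|\,\big\|\phi_{X_x-X_{2s/\varepsilon^2}}(\theta+c_1\theta')\big\|\,dx\,dy=0.$$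 Let $C_X^m$ be the set of all $\theta=(\theta_1,\dots,\theta_m)\in\mathbb R^m$ such that (A$_{\theta_j}$), (B$_{\theta_j}$), (C$_{\theta_j}$) hold for every $j=1,\dots,m$ and (D$_{\theta_j,\theta_h}$) holds for all $j,h\in\{1,\dots,m\}$ with $h\neq j$. For $\theta\in C_X^m$, $\varepsilon>0$ and $1\le j\le m$ define $$x_\varepsilon^{\theta_j}(t)=\varepsilon\,c(\theta_j)\int_0^{\frac{2t}{\varepsilon^2}}e^{i\theta_jX_s}\,ds,\qquad t\in[0,T],$$ where $c(\theta_j)$ is the constant given by (B$_{\theta_j}$), and let $P_\varepsilon^\theta$ be the image law of $x_\varepsilon^\theta=(x_\varepsilon^{\theta_1},\dots,x_\varepsilon^{\theta_m})$ in the Banach space $\mathcal C([0,T],\mathbb C^m)$ of continuous functions on $[0,T]$. Then, if $\theta\in C_X^m$, $P_\varepsilon^\theta$ converges weakly, as $\varepsilon$ tends to zero, towards the law on $\mathcal C([0,T],\mathbb C^m)$ of an $m$-dimensional complex Brownian motion.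
   Context: For a real random variable $Z$, $\phi_Z(u)=E(e^{iuZ})$, $u\in\mathbb R$, is its characteristic function; $\|z\|$ is the modulus of a complex number $z$. The constants $c(\theta_j)$ are real. A process $X$ has independent increments if for all $0\le s<t$ the increment $X_t-X_s$ is independent of $\sigma(X_u,\ 0\le u\le s)$; $X$ is assumed jointly measurable in $(s,\omega)$ so that the integrals defining $x_\varepsilon^{\theta_j}$ make sense. A complex Brownian motion is a $\mathbb C$-valued process whose real and imaginary parts are two independent standard Brownian motions (started at $0$); an $m$-dimensional complex Brownian motion is a $\mathbb C^m$-valued process whose $m$ components are independent complex Brownian motions. *)

theory Defs
  imports "HOL-Probability.Probability"
begin

section \<open>Processes indexed by \<open>[0,\<infinity>)\<close>\<close>

text \<open>Processes are functions \<open>real \<Rightarrow> 'a \<Rightarrow> 'b\<close>; only the values at times \<open>t \<ge> 0\<close> are ever used.\<close>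

definition process_sigma ::
  "'a measure \<Rightarrow> (real \<Rightarrow> 'a \<Rightarrow> 'b::topological_space) \<Rightarrow> real set \<Rightarrow> 'a set set" where
  "process_sigma M X I =
     sigma_sets (space M) {X u -` A \<inter> space M | u A. u \<in> I \<and> A \<in> sets borel}"

definition independent_increments :: "'a measure \<Rightarrow> (real \<Rightarrow> 'a \<Rightarrow> real) \<Rightarrow> bool" where
  "independent_increments M X \<longleftrightarrow>
     (\<forall>s t. 0 \<le> s \<longrightarrow> s < t \<longrightarrow>
        prob_space.indep_set M
          {(\<lambda>\<omega>. X t \<omega> - X s \<omega>) -` A \<inter> space M | A. A \<in> sets borel}
          (process_sigma M X {0..s}))"

definition jointly_measurable :: "'a measure \<Rightarrow> (real \<Rightarrow> 'a \<Rightarrow> real) \<Rightarrow> bool" where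
  "jointly_measurable M X \<longleftrightarrow>
     (\<lambda>(s, \<omega>). X s \<omega>) \<in> borel_measurable (restrict_space borel {0..} \<Otimes>\<^sub>M M)"

definition standard_brownian_motion :: "'a measure \<Rightarrow> (real \<Rightarrow> 'a \<Rightarrow> real) \<Rightarrow> bool" where
  "standard_brownian_motion M B \<longleftrightarrow>
     prob_space M \<and>
     (\<forall>t\<ge>0. B t \<in> borel_measurable M) \<and>
     (\<forall>\<omega>\<in>space M. B 0 \<omega> = 0 \<and> continuous_on {0..} (\<lambda>t. B t \<omega>)) \<and>
     independent_increments M B \<and>
     (\<forall>s t. 0 \<le> s \<longrightarrow> s < t \<longrightarrow>
        distributed M lborel (\<lambda>\<omega>. B t \<omega> - B s \<omega>)
          (\<lambda>x. ennreal (normal_density 0 (sqrt (t - s)) x)))"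

definition complex_brownian_motion :: "'a measure \<Rightarrow> (real \<Rightarrow> 'a \<Rightarrow> complex) \<Rightarrow> bool" where
  "complex_brownian_motion M Z \<longleftrightarrow>
     standard_brownian_motion M (\<lambda>t \<omega>. Re (Z t \<omega>)) \<and>
     standard_brownian_motion M (\<lambda>t \<omega>. Im (Z t \<omega>)) \<and>
     prob_space.indep_set M
       (process_sigma M (\<lambda>t \<omega>. Re (Z t \<omega>)) {0..})
       (process_sigma M (\<lambda>t \<omega>. Im (Z t \<omega>)) {0..})"

definition multi_complex_brownian_motion ::
  "'a measure \<Rightarrow> (real \<Rightarrow> 'a \<Rightarrow> complex ^ 'm) \<Rightarrow> bool" where
  "multi_complex_brownian_motion M W \<longleftrightarrow>
     (\<forall>j. complex_brownian_motion M (\<lambda>t \<omega>. W t \<omega> $ j)) \<and>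
     prob_space.indep_sets M (\<lambda>j. process_sigma M (\<lambda>t \<omega>. W t \<omega> $ j) {0..}) UNIV"


section \<open>Conditions on the characteristic functions of the increments\<close>

definition char_incr :: "'a measure \<Rightarrow> (real \<Rightarrow> 'a \<Rightarrow> real) \<Rightarrow> real \<Rightarrow> real \<Rightarrow> real \<Rightarrow> complex" where
  "char_incr M X y x u = char (distr M borel (\<lambda>\<omega>. X y \<omega> - X x \<omega>)) u"

definition cond_A :: "'a measure \<Rightarrow> (real \<Rightarrow> 'a \<Rightarrow> real) \<Rightarrow> real \<Rightarrow> real \<Rightarrow> bool" where
  "cond_A M X T \<theta> \<longleftrightarrow>
     (\<exists>K::real. \<forall>s t \<epsilon>. 0 \<le> s \<longrightarrow> s < t \<longrightarrow> t \<le> T \<longrightarrow> 0 < \<epsilon> \<longrightarrow>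
        \<epsilon>\<^sup>2 * (LINT y:{2 * s / \<epsilon>\<^sup>2..2 * t / \<epsilon>\<^sup>2}|lborel. LINT x:{2 * s / \<epsilon>\<^sup>2..y}|lborel.
               cmod (char_incr M X y x \<theta>))
        \<le> K * (t - s))"

text \<open>The constant is an explicit argument, because the processes \<open>x_eps\<close> below are built from it.\<close>

definition cond_B :: "'a measure \<Rightarrow> (real \<Rightarrow> 'a \<Rightarrow> real) \<Rightarrow> real \<Rightarrow> real \<Rightarrow> real \<Rightarrow> bool" where
  "cond_B M X T \<theta> c \<longleftrightarrow>
     (\<forall>s t. 0 \<le> s \<longrightarrow> s < t \<longrightarrow> t \<le> T \<longrightarrow>
        ((\<lambda>\<epsilon>. complex_of_real (\<epsilon>\<^sup>2 * c\<^sup>2) *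
            (LINT x:{2 * s / \<epsilon>\<^sup>2..2 * t / \<epsilon>\<^sup>2}|lborel. LINT y:{2 * s / \<epsilon>\<^sup>2..x}|lborel.
               char_incr M X x y \<theta> + char_incr M X x y (-\<theta>)))
         \<longlongrightarrow> complex_of_real (2 * (t - s))) (at_right 0))"

definition cond_C :: "'a measure \<Rightarrow> (real \<Rightarrow> 'a \<Rightarrow> real) \<Rightarrow> real \<Rightarrow> real \<Rightarrow> bool" where
  "cond_C M X T \<theta> \<longleftrightarrow>
     (\<forall>s t. 0 \<le> s \<longrightarrow> s < t \<longrightarrow> t \<le> T \<longrightarrow>
        ((\<lambda>\<epsilon>. \<epsilon>\<^sup>2 *
            (LINT y:{2 * s / \<epsilon>\<^sup>2..2 * t / \<epsilon>\<^sup>2}|lborel. LINT x:{2 * s / \<epsilon>\<^sup>2..y}|lborel.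
               cmod (char_incr M X y x \<theta>) * cmod (char_incr M X x (2 * s / \<epsilon>\<^sup>2) (2 * \<theta>))))
         \<longlongrightarrow> 0) (at_right 0))"

definition cond_D :: "'a measure \<Rightarrow> (real \<Rightarrow> 'a \<Rightarrow> real) \<Rightarrow> real \<Rightarrow> real \<Rightarrow> real \<Rightarrow> bool" where
  "cond_D M X T \<theta> \<theta>' \<longleftrightarrow>
     (\<forall>c\<^sub>1\<in>{-1, 1}. \<forall>s t. 0 \<le> s \<longrightarrow> s < t \<longrightarrow> t \<le> T \<longrightarrow>
        ((\<lambda>\<epsilon>. \<epsilon>\<^sup>2 *
            (LINT y:{2 * s / \<epsilon>\<^sup>2..2 * t / \<epsilon>\<^sup>2}|lborel. LINT x:{2 * s / \<epsilon>\<^sup>2..y}|lborel.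
               cmod (char_incr M X y x \<theta>) * cmod (char_incr M X x (2 * s / \<epsilon>\<^sup>2) (\<theta> + c\<^sub>1 * \<theta>'))))
         \<longlongrightarrow> 0) (at_right 0))"

definition admissible :: "'a measure \<Rightarrow> (real \<Rightarrow> 'a \<Rightarrow> real) \<Rightarrow> real \<Rightarrow> (real ^ 'm) set" where
  "admissible M X T =
     {\<theta>. (\<forall>j. cond_A M X T (\<theta> $ j) \<and> (\<exists>c. cond_B M X T (\<theta> $ j) c) \<and> cond_C M X T (\<theta> $ j)) \<and>
         (\<forall>j h. h \<noteq> j \<longrightarrow> cond_D M X T (\<theta> $ j) (\<theta> $ h))}"


section \<open>Laws on path space and weak convergence\<close>

definition path_space :: "real \<Rightarrow> (real \<Rightarrow> complex ^ 'm) metric" where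
  "path_space T = cfunspace (top_of_set {0..T}) euclidean_metric"

definition borel_sigma :: "'a topology \<Rightarrow> 'a measure" where
  "borel_sigma S = sigma (topspace S) {U. openin S U}"

text \<open>Elements of \<open>path_space T\<close> are extensional functions, whence the \<open>restrict\<close>.\<close>

definition path_law ::
  "real \<Rightarrow> 'a measure \<Rightarrow> (real \<Rightarrow> 'a \<Rightarrow> complex ^ 'm) \<Rightarrow> (real \<Rightarrow> complex ^ 'm) measure" where
  "path_law T M Y =
     distr M (borel_sigma (mtopology_of (path_space T))) (\<lambda>\<omega>. restrict (\<lambda>t. Y t \<omega>) {0..T})"

text \<open>
  Weak convergence along a filter, on a general topological space. The requirement that the
  measures be Borel probability measures matters: \<open>distr\<close> along a non-measurable map is not
  the image law.
\<close>

definition converges_weakly ::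
  "'b topology \<Rightarrow> ('i \<Rightarrow> 'b measure) \<Rightarrow> 'b measure \<Rightarrow> 'i filter \<Rightarrow> bool" where
  "converges_weakly S P Q F \<longleftrightarrow>
     (\<forall>\<^sub>F i in F. prob_space (P i) \<and> sets (P i) = sets (borel_sigma S)) \<and>
     prob_space Q \<and> sets Q = sets (borel_sigma S) \<and>
     (\<forall>f::'b \<Rightarrow> real. continuous_map S euclideanreal f \<longrightarrow> bounded (f ` topspace S) \<longrightarrow>
        ((\<lambda>i. \<integral>w. f w \<partial>P i) \<longlongrightarrow> (\<integral>w. f w \<partial>Q)) F)"

definition x_eps ::
  "(real \<Rightarrow> 'a \<Rightarrow> real) \<Rightarrow> (real \<Rightarrow> real) \<Rightarrow> real ^ 'm \<Rightarrow> real \<Rightarrow> real \<Rightarrow> 'a \<Rightarrow> complex ^ 'm" where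
  "x_eps X c \<theta> \<epsilon> t \<omega> =
     (\<chi> j. complex_of_real (\<epsilon> * c (\<theta> $ j)) *
            (LINT s:{0..2 * t / \<epsilon>\<^sup>2}|lborel. iexp (\<theta> $ j * X s \<omega>)))"

end

theory Submission
  imports Defs
begin

text \<open>
  Write \<open>G \<theta> a b\<close> for the integral of \<open>e\<^sup>i\<^sup>\<theta>\<^sup>X\<close> over \<open>[a, b]\<close>. Multiplying it by \<open>e\<^sup>-\<^sup>i\<^sup>\<theta>\<^sup>X\<close> at time \<open>a\<close>
  leaves a functional of the increments after \<open>a\<close>, so given the past an increment of the limit
  process has mean close to \<open>0\<close>, and by (B), (C), (D) its second moments are asymptotically those
  of the complex Brownian motion: all the unwanted ones carry a nontrivial rotation of the past and
  vanish. Condition (A) and the monotonicity of the modulus of the characteristic functions give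
  \<open>|\<phi>| \<le> 2K / (b - a)\<close>, and this logarithmic control of the means makes a doubling argument
  for \<open>E |G \<theta> a b|\<^sup>4 \<le> D (b - a)\<^sup>2\<close> work. A Lindeberg expansion over short intervals then
  identifies the limit of the characteristic functions of the finite-dimensional distributions, and
  the fourth moment bound gives tightness by dyadic chaining. Weak convergence is obtained without
  Prokhorov's theorem: a Lipschitz functional of the path is compared with the same functional of its
  dyadic piecewise linear interpolation, uniformly in \<open>\<epsilon>\<close>, and bounded continuous functionals are
  approximated from below by Lipschitz ones.
\<close>

text \<open>The doubling step is the crux. Let \<open>G\<close> be split at the midpoint of an
  interval of length 2h into A + B. Minkowski's inequality alone turns a bound D h^2 for the two
  halves into 16 D h^2, while the target is D (2h)^2 = 4 D h^2. The dangerous mixed terms are |A|^2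
  A conj(B) and |B|^2 A conj(B). In each of them the remaining factor of degree one has, after a
  rotation, a mean of order log h instead of sqrt h. Young's inequality trades these terms for half
  of the fourth moments plus a remainder of order h log(h)^2, which is O(h^2) for large h; the main
  factor becomes 2 * 3/2 = 3 < 4. In the second term the factor of degree one is the earlier one.
  This is why functionals of the future appear beside those of the past, with a rotation inserted at
  the midpoint. Conditions (B), (C), (D) are limits for fixed times s and t, without uniformity.
  Hence the Lindeberg partition is fixed before \<epsilon> tends to 0: a local error of order
  \<delta>^(3/2), summed over n steps of length (t - s)/n, is of order n^(-1/2).\<close>

definition cpath :: "real \<Rightarrow> (real \<Rightarrow> 'e::euclidean_space) metric" where
  "cpath T = cfunspace (top_of_set {0..T}) euclidean_metric"

text \<open>Compactness of [0, T] makes the boundedness clause of \<open>cfunspace\<close>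
  automatic.\<close>

lemma mem_cpath: "f \<in> mspace (cpath T) \<longleftrightarrow> f \<in> extensional {0..T} \<and> continuous_on {0..T} f"
proof -
  have "bounded (f ` {0..T})" if "continuous_on {0..T} f"
    using compact_continuous_image[OF that] compact_imp_bounded by blast
  then show ?thesis
    by (auto simp: cpath_def)
qed

lemma mdist_cpath_le:
  assumes "0 \<le> B" "\<And>t. t \<in> {0..T} \<Longrightarrow> dist (f t) (g t) \<le> B"
  shows "mdist (cpath T) f g \<le> B"
  unfolding cpath_def by (rule mdist_cfunspace_le) (use assms in auto)

lemma restrict_mem_cpath: "continuous_on {0..T} f \<Longrightarrow> restrict f {0..T} \<in> mspace (cpath T)"
  unfolding mem_cpath using continuous_on_cong[of "{0..T}" "{0..T}" "restrict f {0..T}" f] by auto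

section \<open>Topology and Borel sets of a metric\<close>

lemma openin_mtopology_of:
  "openin (mtopology_of m) U \<longleftrightarrow>
     U \<subseteq> mspace m \<and> (\<forall>x\<in>U. \<exists>r>0. \<forall>y\<in>mspace m. mdist m x y < r \<longrightarrow> y \<in> U)"
proof -
  interpret Metric_space "mspace m" "mdist m" by simp
  show ?thesis
    unfolding mtopology_of_def openin_mtopology by (meson in_mball subset_iff)
qed

lemma continuous_map_mtopology_of_real:
  "continuous_map (mtopology_of m) euclideanreal h \<longleftrightarrow>
     (\<forall>x\<in>mspace m. \<forall>e>0. \<exists>d>0. \<forall>y. y \<in> mspace m \<and> mdist m x y < d \<longrightarrow> \<bar>h x - h y\<bar> < e)"
proof -
  interpret Metric_space "mspace m" "mdist m" by simp
  show ?thesis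
    using metric_continuous_map[OF Met_TC.Metric_space_axioms, of h]
    unfolding mtopology_of_def mtopology_is_euclidean dist_real_def
    by (simp only: subset_UNIV simp_thms)
qed

lemma measurable_borel_sigma_continuous:
  fixes f :: "'a \<Rightarrow> real"
  assumes f: "continuous_map S euclideanreal f" and P: "sets P = sets (borel_sigma S)"
  shows "f \<in> borel_measurable P"
proof -
  have "f \<in> borel_measurable (borel_sigma S)"
  proof (rule borel_measurableI)
    fix U :: "real set" assume "open U"
    then have "openin S {x \<in> topspace S. f x \<in> U}"
      using f by (auto simp: continuous_map_def)
    moreover have "f -` U \<inter> space (borel_sigma S) = {x \<in> topspace S. f x \<in> U}"
      by (auto simp: borel_sigma_def space_measure_of_conv)
    ultimately show "f -` U \<inter> space (borel_sigma S) \<in> sets (borel_sigma S)"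
      unfolding borel_sigma_def
      by (subst sets_measure_of) (auto dest: openin_subset intro!: sigma_sets.Basic)
  qed
  then show ?thesis using P by (simp cong: measurable_cong_sets)
qed

text \<open>Interchange of limits: the comparison family \<open>a'\<close> and its limit may change
  with \<open>e\<close>, as long as the error is uniform along \<open>F\<close>.\<close>

lemma tendsto_approx:
  fixes a :: "'i \<Rightarrow> 'b::real_normed_vector"
  assumes "\<And>e. 0 < e \<Longrightarrow> \<exists>a' b'. (a' \<longlongrightarrow> b') F \<and> (\<forall>\<^sub>F i in F. norm (a i - a' i) \<le> e) \<and> norm (b' - b) \<le> e"
  shows "(a \<longlongrightarrow> b) F"
proof (rule tendstoI)
  fix e :: real assume "0 < e"
  then obtain a' b' where *: "(a' \<longlongrightarrow> b') F" "\<forall>\<^sub>F i in F. norm (a i - a' i) \<le> e/3" "norm (b' - b) \<le> e/3"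
    using assms[of "e/3"] by auto
  have "\<forall>\<^sub>F i in F. dist (a' i) b' < e/3" using tendstoD[OF *(1), of "e/3"] \<open>0 < e\<close> by simp
  with *(2) show "\<forall>\<^sub>F i in F. dist (a i) b < e"
  proof eventually_elim
    case (elim i)
    have "a i - b = (a i - a' i) + (a' i - b') + (b' - b)" by simp
    then have "norm (a i - b) \<le> norm (a i - a' i) + norm (a' i - b') + norm (b' - b)"
      by (metis norm_triangle_le norm_triangle_ineq add_mono order_refl)
    with elim *(3) show ?case by (simp add: dist_norm)
  qed
qed

subsection \<open>Infimal convolution\<close>

text \<open>The Pasch-Hausdorff envelope: for bounded \<open>h\<close> and \<open>k \<ge> 0\<close>
  it is the largest \<open>k\<close>-Lipschitz function below \<open>h\<close> on the
  carrier.\<close>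

definition infconv :: "'a metric \<Rightarrow> ('a \<Rightarrow> real) \<Rightarrow> real \<Rightarrow> 'a \<Rightarrow> real" where
  "infconv m h k x = (INF y\<in>mspace m. h y + k * mdist m x y)"

locale bounded_fun_metric =
  fixes m :: "'a metric" and h :: "'a \<Rightarrow> real" and B :: real
  assumes bdd: "\<And>y. y \<in> mspace m \<Longrightarrow> \<bar>h y\<bar> \<le> B"
begin

lemma bdd_below_infconv:
  assumes "0 \<le> k"
  shows "bdd_below ((\<lambda>y. h y + k * mdist m x y) ` mspace m)"
proof (rule bdd_belowI2[where m="- B"])
  fix y assume "y \<in> mspace m"
  moreover have "0 \<le> k * mdist m x y" using assms by simp
  ultimately show "- B \<le> h y + k * mdist m x y" using bdd[of y] by linarith
qed

lemma infconv_le: "0 \<le> k \<Longrightarrow> y \<in> mspace m \<Longrightarrow> infconv m h k x \<le> h y + k * mdist m x y"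
  unfolding infconv_def by (rule cINF_lower[OF bdd_below_infconv])

lemma infconv_le_self: "0 \<le> k \<Longrightarrow> x \<in> mspace m \<Longrightarrow> infconv m h k x \<le> h x"
  using infconv_le[of k x x] by (metis add.right_neutral mdist_zero mult_zero_right)

lemma infconv_ge: "x \<in> mspace m \<Longrightarrow> (\<And>y. y \<in> mspace m \<Longrightarrow> c \<le> h y + k * mdist m x y) \<Longrightarrow> c \<le> infconv m h k x"
  unfolding infconv_def by (rule cINF_greatest) auto

lemma abs_infconv_le: 
  assumes "0 \<le> k" "x \<in> mspace m" shows "\<bar>infconv m h k x\<bar> \<le> B"
proof -
  have "infconv m h k x \<le> B" using infconv_le_self[OF assms] bdd[OF assms(2)] by linarith
  moreover have "- B \<le> infconv m h k x"
  proof (rule infconv_ge[OF assms(2)])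
    fix y assume "y \<in> mspace m"
    moreover have "0 \<le> k * mdist m x y" using assms by simp
    ultimately show "- B \<le> h y + k * mdist m x y" using bdd[of y] by linarith
  qed
  ultimately show ?thesis by linarith
qed

lemma infconv_Lipschitz:
  assumes "0 \<le> k" "x \<in> mspace m" "y \<in> mspace m"
  shows "\<bar>infconv m h k x - infconv m h k y\<bar> \<le> k * mdist m x y"
proof -
  have *: "infconv m h k x - k * mdist m x y \<le> infconv m h k y" if xy: "x \<in> mspace m" "y \<in> mspace m" for x y
  proof (rule infconv_ge[OF xy(2)])
    fix z assume z: "z \<in> mspace m"
    have "mdist m x z \<le> mdist m x y + mdist m y z" using xy z by (rule mdist_triangle)
    then have "k * mdist m x z \<le> k * mdist m x y + k * mdist m y z"
      by (metis assms(1) distrib_left mult_left_mono)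
    then show "infconv m h k x - k * mdist m x y \<le> h z + k * mdist m y z"
      using infconv_le[OF assms(1) z, of x] by linarith
  qed
  show ?thesis using *[of x y] *[of y x] assms by (simp add: mdist_commute abs_le_iff)
qed

text \<open>Moving by at least d costs k * d, which for large k is no less than the oscillation 2 *
  B of \<open>h\<close>. So only points near \<open>x\<close> compete in the infimum, and there
  \<open>h\<close> is almost \<open>h x\<close>.\<close>

lemma infconv_tendsto:
  assumes x: "x \<in> mspace m" and h: "continuous_map (mtopology_of m) euclideanreal h"
  shows "(\<lambda>k::nat. infconv m h (real k) x) \<longlonglongrightarrow> h x"
proof (rule LIMSEQ_I)
  fix e :: real assume e: "0 < e"
  obtain d where d: "0 < d" "\<And>y. y \<in> mspace m \<Longrightarrow> mdist m x y < d \<Longrightarrow> \<bar>h x - h y\<bar> < e/2"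
    using h[unfolded continuous_map_mtopology_of_real, rule_format, OF x half_gt_zero[OF e]] by blast
  obtain N :: nat where N: "2 * B / d < N" using reals_Archimedean2 by blast
  have B: "0 \<le> B" using bdd[OF x] by linarith
  show "\<exists>no. \<forall>k\<ge>no. norm (infconv m h (real k) x - h x) < e"
  proof (intro exI allI impI)
    fix k assume k: "N \<le> k"
    have "h x - e/2 \<le> infconv m h (real k) x"
    proof (rule infconv_ge[OF x])
      fix y assume y: "y \<in> mspace m"
      show "h x - e/2 \<le> h y + real k * mdist m x y"
      proof (cases "mdist m x y < d")
        case True
        have "0 \<le> real k * mdist m x y" by simp
        then show ?thesis using d(2)[OF y True] by linarith
      next
        case False
        have "2 * B \<le> real k * d" using N k d(1) by (simp add: field_simps) (smt (verit) mult_le_cancel_left_pos of_nat_mono)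
        also have "\<dots> \<le> real k * mdist m x y" using False by (intro mult_left_mono) auto
        finally show ?thesis using bdd[OF x] bdd[OF y] e by linarith
      qed
    qed
    moreover have "infconv m h (real k) x \<le> h x" by (rule infconv_le_self) (use x in auto)
    ultimately show "norm (infconv m h (real k) x - h x) < e" using e by auto
  qed
qed

end


lemma Lipschitz_continuous_map_real:
  assumes "\<And>x y. x \<in> mspace m \<Longrightarrow> y \<in> mspace m \<Longrightarrow> \<bar>h x - h y\<bar> \<le> L * mdist m x y"
  shows "continuous_map (mtopology_of m) euclideanreal h"
  unfolding continuous_map_mtopology_of_real
proof (intro ballI allI impI)
  fix x and e :: real assume x: "x \<in> mspace m" and e: "0 < e"
  show "\<exists>d>0. \<forall>y. y \<in> mspace m \<and> mdist m x y < d \<longrightarrow> \<bar>h x - h y\<bar> < e"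
  proof (intro exI conjI allI impI)
    \<comment> \<open>A positive divisor whatever the sign of \<open>L\<close>.\<close>
    show "0 < e / (\<bar>L\<bar> + 1)" using e by simp
    fix y assume "y \<in> mspace m \<and> mdist m x y < e / (\<bar>L\<bar> + 1)"
    then have y: "y \<in> mspace m" "mdist m x y < e / (\<bar>L\<bar> + 1)" by auto
    have "\<bar>h x - h y\<bar> \<le> L * mdist m x y" using assms[OF x y(1)] by linarith
    also have "\<dots> \<le> (\<bar>L\<bar> + 1) * mdist m x y" by (intro mult_right_mono) auto
    also have "\<dots> < e" using y(2) by (simp add: field_simps)
    finally show "\<bar>h x - h y\<bar> < e" .
  qed
qed

text \<open>Envelopes \<open>g k\<close> lie below \<open>f\<close> and converge to it, so the lower
  limit of the integrals of \<open>f\<close> is at least the integral of each \<open>g k\<close>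
  under \<open>Q\<close>, hence of \<open>f\<close> by dominated convergence. The same for
  \<open>- f\<close> gives the upper bound. Only a one-sided approximation is used, which is why
  pointwise convergence of the envelopes suffices.\<close>

theorem converges_weakly_Lipschitz:
  fixes m :: "'b metric"
  assumes P: "\<forall>\<^sub>F i in F. prob_space (P i) \<and> sets (P i) = sets (borel_sigma (mtopology_of m))"
    and Q: "prob_space Q" "sets Q = sets (borel_sigma (mtopology_of m))"
    and lim: "\<And>f B L. 0 \<le> L \<Longrightarrow> (\<And>x. x \<in> mspace m \<Longrightarrow> \<bar>f x\<bar> \<le> B) \<Longrightarrow>
      (\<And>x y. x \<in> mspace m \<Longrightarrow> y \<in> mspace m \<Longrightarrow> \<bar>f x - f y\<bar> \<le> L * mdist m x y) \<Longrightarrow>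
      ((\<lambda>i. \<integral>w. f w \<partial>P i) \<longlongrightarrow> (\<integral>w. f w \<partial>Q)) F"
  shows "converges_weakly (mtopology_of m) P Q F"
proof -
  interpret Q: prob_space Q by fact
  have sp: "space R = mspace m" if "sets R = sets (borel_sigma (mtopology_of m))" for R :: "'b measure"
    using sets_eq_imp_space_eq[OF that] by (simp add: borel_sigma_def space_measure_of_conv)
  have lower: "\<forall>\<^sub>F i in F. (\<integral>w. f w \<partial>Q) - e < (\<integral>w. f w \<partial>P i)"
    if f: "continuous_map (mtopology_of m) euclideanreal f" and B: "\<And>x. x \<in> mspace m \<Longrightarrow> \<bar>f x\<bar> \<le> B"
      and e: "0 < e" for f B and e :: real
  proof -
    interpret bounded_fun_metric m f B by standard fact
    define g where "g k = infconv m f (real k)" for k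
    have g_cont: "continuous_map (mtopology_of m) euclideanreal (g k)" for k
      unfolding g_def by (rule Lipschitz_continuous_map_real[OF infconv_Lipschitz]) auto
    have int: "integrable R h" if "prob_space R" and R: "sets R = sets (borel_sigma (mtopology_of m))"
      and "continuous_map (mtopology_of m) euclideanreal h" "\<And>x. x \<in> mspace m \<Longrightarrow> \<bar>h x\<bar> \<le> B" for R h
    proof -
      interpret R: prob_space R by fact
      show ?thesis
        by (rule R.integrable_const_bound[where B=B])
           (use that(4) sp[OF R] measurable_borel_sigma_continuous[OF that(3) R] in \<open>auto intro: AE_I2\<close>)
    qed
    have "(\<lambda>k. \<integral>w. g k w \<partial>Q) \<longlonglongrightarrow> (\<integral>w. f w \<partial>Q)"
    proof (rule integral_dominated_convergence[where w="\<lambda>_. B"])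
      show "AE x in Q. (\<lambda>k. g k x) \<longlonglongrightarrow> f x"
        unfolding g_def by (auto intro!: AE_I2 infconv_tendsto f simp: sp[OF Q(2)])
      show "AE x in Q. norm (g k x) \<le> B" for k
        unfolding g_def by (auto intro!: AE_I2 abs_infconv_le simp: sp[OF Q(2)])
    qed (use measurable_borel_sigma_continuous[OF f Q(2)] measurable_borel_sigma_continuous[OF g_cont Q(2)] in simp_all)
    then have "\<forall>\<^sub>F k in sequentially. (\<integral>w. f w \<partial>Q) - e < (\<integral>w. g k w \<partial>Q)"
      using e by (intro order_tendstoD) auto
    then obtain k where k: "(\<integral>w. f w \<partial>Q) - e < (\<integral>w. g k w \<partial>Q)"
      using eventually_happens'[OF sequentially_bot] by blast
    have "((\<lambda>i. \<integral>w. g k w \<partial>P i) \<longlongrightarrow> (\<integral>w. g k w \<partial>Q)) F"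
      unfolding g_def by (rule lim[of "real k" _ B]) (auto intro: abs_infconv_le infconv_Lipschitz)
    then have "\<forall>\<^sub>F i in F. (\<integral>w. f w \<partial>Q) - e < (\<integral>w. g k w \<partial>P i)"
      using k by (rule order_tendstoD)
    with P show ?thesis
    proof eventually_elim
      case (elim i)
      have "(\<integral>w. g k w \<partial>P i) \<le> (\<integral>w. f w \<partial>P i)"
      proof (rule integral_mono)
        show "integrable (P i) (g k)"
          by (rule int) (use elim g_cont abs_infconv_le in \<open>simp_all add: g_def\<close>)
        show "integrable (P i) f"
          by (rule int) (use elim f B in simp_all)
        show "g k x \<le> f x" if "x \<in> space (P i)" for x
          using that elim sp[of "P i"] by (simp add: g_def infconv_le_self)
      qed
      with elim show ?case by linarith
    qed
  qed
  show ?thesis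
    unfolding converges_weakly_def
  proof (intro conjI allI impI)
    show "\<forall>\<^sub>F i in F. prob_space (P i) \<and> sets (P i) = sets (borel_sigma (mtopology_of m))" by (fact P)
  next
    show "prob_space Q" "sets Q = sets (borel_sigma (mtopology_of m))" by (fact Q)+
  next
    fix f :: "'b \<Rightarrow> real"
    assume f: "continuous_map (mtopology_of m) euclideanreal f" and "bounded (f ` topspace (mtopology_of m))"
    then obtain B where B: "\<And>x. x \<in> mspace m \<Longrightarrow> \<bar>f x\<bar> \<le> B"
      by (auto simp: bounded_iff)
    have f': "continuous_map (mtopology_of m) euclideanreal (\<lambda>x. - f x)"
      using f by (rule continuous_map_minus)
    show "((\<lambda>i. \<integral>w. f w \<partial>P i) \<longlongrightarrow> (\<integral>w. f w \<partial>Q)) F"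
    proof (rule order_tendstoI)
      fix a assume "a < (\<integral>w. f w \<partial>Q)"
      then show "\<forall>\<^sub>F i in F. a < (\<integral>w. f w \<partial>P i)"
        using lower[OF f B, of "(\<integral>w. f w \<partial>Q) - a"] by simp
    next
      fix a assume "(\<integral>w. f w \<partial>Q) < a"
      then show "\<forall>\<^sub>F i in F. (\<integral>w. f w \<partial>P i) < a"
        using lower[OF f' , of B "a - (\<integral>w. f w \<partial>Q)"] B by simp
    qed
  qed
qed

subsection \<open>Piecewise linear interpolation\<close>

definition clamp01 :: "real \<Rightarrow> real" where "clamp01 x = max 0 (min 1 x)"

text \<open>Capping the index at \<open>N\<close> gives every natural number a time in [0, T], so
  that the grid is an infinite increasing sequence as required by the statements on
  finite-dimensional distributions.\<close>

definition grid :: "real \<Rightarrow> nat \<Rightarrow> nat \<Rightarrow> real" where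
  "grid T N k = T * real (min k N) / real N"

text \<open>A sum of ramps instead of a case distinction on cells: the path is visibly continuous,
  and it is linear in the values, of which only \<open>v 0\<close> to \<open>v N\<close>
  enter.\<close>

definition interp :: "real \<Rightarrow> nat \<Rightarrow> (nat \<Rightarrow> 'e::euclidean_space) \<Rightarrow> real \<Rightarrow> 'e" where
  "interp T N v = restrict (\<lambda>t. v 0 + (\<Sum>k<N. clamp01 (real N * t / T - real k) *\<^sub>R (v (Suc k) - v k))) {0..T}"

lemma grid_mem: "0 < T \<Longrightarrow> grid T N k \<in> {0..T}"
  by (auto simp: grid_def divide_le_eq)

lemma interp_mem_cpath: "0 < T \<Longrightarrow> interp T N v \<in> mspace (cpath T)"
  unfolding interp_def clamp01_def by (intro restrict_mem_cpath continuous_intros) auto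

text \<open>Ramps of earlier cells are saturated and telescope to \<open>v k - v 0\<close>; ramps of
  later cells are still zero.\<close>

lemma interp_between:
  assumes T: "0 < T" and t: "t \<in> {0..T}" and k: "k < N" "real k \<le> real N * t / T" "real N * t / T \<le> real k + 1"
  shows "interp T N v t = v k + (real N * t / T - real k) *\<^sub>R (v (Suc k) - v k)"
proof -
  define u where "u = real N * t / T"
  have u: "real k \<le> u" "u \<le> real k + 1" using k by (auto simp: u_def)
  have split: "{..<N} = {..<k} \<union> {k..<Suc k} \<union> {Suc k..<N}" using k(1) by auto
  have "(\<Sum>i<N. clamp01 (u - real i) *\<^sub>R (v (Suc i) - v i)) =
     (\<Sum>i<k. clamp01 (u - real i) *\<^sub>R (v (Suc i) - v i)) + clamp01 (u - real k) *\<^sub>R (v (Suc k) - v k)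
     + (\<Sum>i=Suc k..<N. clamp01 (u - real i) *\<^sub>R (v (Suc i) - v i))"
    unfolding split
    by (subst sum.union_disjoint, simp, simp, force, subst sum.union_disjoint, simp, simp, force) simp
  also have "(\<Sum>i<k. clamp01 (u - real i) *\<^sub>R (v (Suc i) - v i)) = (\<Sum>i<k. v (Suc i) - v i)"
  proof (intro sum.cong refl)
    fix i assume "i \<in> {..<k}"
    then have "real i + 1 \<le> real k" by (simp flip: of_nat_Suc)
    then have "clamp01 (u - real i) = 1" using u unfolding clamp01_def by linarith
    then show "clamp01 (u - real i) *\<^sub>R (v (Suc i) - v i) = v (Suc i) - v i" by simp
  qed
  also have "\<dots> = v k - v 0" by (rule sum_lessThan_telescope)
  also have "(\<Sum>i=Suc k..<N. clamp01 (u - real i) *\<^sub>R (v (Suc i) - v i)) = 0"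
  proof (intro sum.neutral ballI)
    fix i assume "i \<in> {Suc k..<N}"
    then have "real k + 1 \<le> real i" by (simp flip: of_nat_Suc)
    then have "clamp01 (u - real i) = 0" using u unfolding clamp01_def by linarith
    then show "clamp01 (u - real i) *\<^sub>R (v (Suc i) - v i) = 0" by simp
  qed
  also have "clamp01 (u - real k) = u - real k" using u unfolding clamp01_def by linarith
  finally show ?thesis using t by (simp add: interp_def u_def)
qed

text \<open>The constant 3 counts the initial value, the right ends and the left ends of the cells,
  each bounded by the full sum.\<close>

lemma interp_Lipschitz:
  fixes v w :: "nat \<Rightarrow> 'e::euclidean_space"
  shows "mdist (cpath T) (interp T N v) (interp T N w) \<le> 3 * (\<Sum>k\<le>N. norm (v k - w k))"
proof (rule mdist_cpath_le)
  let ?S = "\<Sum>k\<le>N. norm (v k - w k)"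
  show "0 \<le> 3 * ?S" by (simp add: sum_nonneg)
  fix t assume t: "t \<in> {0..T}"
  let ?c = "\<lambda>k. clamp01 (real N * t / T - real k)"
  have c: "\<bar>?c k\<bar> \<le> 1" for k by (auto simp: clamp01_def)
  have "interp T N v t - interp T N w t =
      (v 0 - w 0) + (\<Sum>k<N. ?c k *\<^sub>R ((v (Suc k) - w (Suc k)) - (v k - w k)))"
    using t by (simp add: interp_def algebra_simps sum.distrib sum_subtractf)
  also have "norm \<dots> \<le> norm (v 0 - w 0) + (\<Sum>k<N. norm (v (Suc k) - w (Suc k)) + norm (v k - w k))"
  proof (intro order_trans[OF norm_triangle_ineq] add_mono order_refl order_trans[OF norm_sum] sum_mono)
    fix k
    have "norm (?c k *\<^sub>R ((v (Suc k) - w (Suc k)) - (v k - w k))) \<le> 1 * norm ((v (Suc k) - w (Suc k)) - (v k - w k))"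
      unfolding norm_scaleR by (intro mult_right_mono c) auto
    also have "\<dots> \<le> norm (v (Suc k) - w (Suc k)) + norm (v k - w k)"
      by (simp add: norm_triangle_ineq4)
    finally show "norm (?c k *\<^sub>R ((v (Suc k) - w (Suc k)) - (v k - w k))) \<le> norm (v (Suc k) - w (Suc k)) + norm (v k - w k)" .
  qed
  also have "\<dots> = norm (v 0 - w 0) + (\<Sum>k<N. norm (v (Suc k) - w (Suc k))) + (\<Sum>k<N. norm (v k - w k))"
    by (simp add: sum.distrib)
  also have "norm (v 0 - w 0) \<le> ?S" by (rule member_le_sum) auto
  also have "(\<Sum>k<N. norm (v (Suc k) - w (Suc k))) \<le> ?S"
  proof -
    have "(\<Sum>k<N. norm (v (Suc k) - w (Suc k))) = (\<Sum>k\<in>{Suc 0..N}. norm (v k - w k))"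
      by (rule sum.reindex_bij_witness[where i="\<lambda>k. k - 1" and j=Suc]) auto
    also have "\<dots> \<le> ?S" by (rule sum_mono2) auto
    finally show ?thesis .
  qed
  also have "(\<Sum>k<N. norm (v k - w k)) \<le> ?S" by (rule sum_mono2) auto
  finally show "dist (interp T N v t) (interp T N w t) \<le> 3 * ?S" by (simp add: dist_norm)
qed

text \<open>The first closeness premise is restricted to the cell with index
  \<open>nat \<lfloor>real N * t / T\<rfloor>\<close> and to \<open>t < T\<close>, because this is
  the form in which dyadic chaining provides it.\<close>

lemma interp_grid_close:
  fixes f :: "real \<Rightarrow> 'e::euclidean_space"
  assumes T: "0 < T" and N: "0 < N" and t: "t \<in> {0..T}" and a: "0 \<le> a" "0 \<le> b"
    and f1: "\<And>k. k < N \<Longrightarrow> T * real k / real N \<le> t \<Longrightarrow> t \<le> T * real (Suc k) / real N \<Longrightarrow> t < T \<Longrightarrow>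
       k = nat \<lfloor>real N * t / T\<rfloor> \<Longrightarrow> norm (f (T * real k / real N) - f t) \<le> a"
    and f2: "\<And>k. k < N \<Longrightarrow> norm (f (T * real (Suc k) / real N) - f (T * real k / real N)) \<le> b"
  shows "dist (interp T N (\<lambda>k. f (grid T N k)) t) (f t) \<le> a + b"
proof (cases "t = T")
  case True
  \<comment> \<open>At \<open>t = T\<close> the floor would select the nonexistent cell
    \<open>N\<close>; the right end of cell \<open>N - 1\<close> gives the value exactly.\<close>
  have "interp T N (\<lambda>k. f (grid T N k)) t = f t"
    using True T N by (subst interp_between[where k="N - 1"]) (auto simp: grid_def of_nat_diff)
  then show ?thesis using a by simp
next
  case False
  define u where "u = real N * t / T"
  define k where "k = nat \<lfloor>u\<rfloor>"
  have u: "0 \<le> u" "u < real N" using False t T N by (auto simp: u_def divide_less_eq)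
  have k: "real k \<le> u" "u \<le> real k + 1" using u(1) unfolding k_def by linarith+
  then have kN: "k < N" using u(2) by linarith
  have tk: "T * real k / real N \<le> t" "t \<le> T * real (Suc k) / real N"
    using k T N by (auto simp: u_def field_simps)
  have "interp T N (\<lambda>k. f (grid T N k)) t = f (grid T N k) + (u - real k) *\<^sub>R (f (grid T N (Suc k)) - f (grid T N k))"
    unfolding u_def by (rule interp_between) (use T t k kN in \<open>auto simp: u_def\<close>)
  also have "grid T N k = T * real k / real N" using kN by (simp add: grid_def)
  also have "grid T N (Suc k) = T * real (Suc k) / real N" using kN by (simp add: grid_def)
  finally have "interp T N (\<lambda>k. f (grid T N k)) t - f t =
     (f (T * real k / real N) - f t) + (u - real k) *\<^sub>R (f (T * real (Suc k) / real N) - f (T * real k / real N))" by simp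
  also have "norm \<dots> \<le> a + 1 * b"
  proof (intro order_trans[OF norm_triangle_ineq] add_mono)
    show "norm (f (T * real k / real N) - f t) \<le> a" using f1[OF kN tk] False t by (auto simp: k_def u_def)
    show "norm ((u - real k) *\<^sub>R (f (T * real (Suc k) / real N) - f (T * real k / real N))) \<le> 1 * b"
      unfolding norm_scaleR using f2[OF kN] k by (intro mult_mono) auto
  qed
  finally show ?thesis by (simp add: dist_norm)
qed

lemma interp_grid_tendsto:
  fixes f :: "real \<Rightarrow> 'e::euclidean_space"
  assumes T: "0 < T" and f: "continuous_on {0..T} f"
  shows "(\<lambda>N. mdist (cpath T) (interp T N (\<lambda>k. f (grid T N k))) (restrict f {0..T})) \<longlonglongrightarrow> 0"
proof (rule LIMSEQ_I)
  fix e :: real assume e: "0 < e"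
  have "uniformly_continuous_on {0..T} f" using f by (simp add: compact_uniformly_continuous)
  then obtain d where d: "0 < d" "\<And>s t. s \<in> {0..T} \<Longrightarrow> t \<in> {0..T} \<Longrightarrow> dist s t < d \<Longrightarrow> dist (f s) (f t) < e/3"
    unfolding uniformly_continuous_on_def using e by (metis dist_commute zero_less_divide_iff zero_less_numeral)
  obtain N0 :: nat where N0: "T / d < N0" using reals_Archimedean2 by blast
  show "\<exists>no. \<forall>N\<ge>no. norm (mdist (cpath T) (interp T N (\<lambda>k. f (grid T N k))) (restrict f {0..T}) - 0) < e"
  proof (intro exI allI impI)
    fix N assume N: "N0 \<le> N"
    have "0 < real N0" using N0 T d by (smt (verit) divide_pos_pos)
    then have N': "0 < N" using N by linarith
    have TN: "T / real N < d"
    proof -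
      have "T / d < real N" using N0 N by linarith
      then show ?thesis using N' d T by (simp add: field_simps)
    qed
    have "mdist (cpath T) (interp T N (\<lambda>k. f (grid T N k))) (restrict f {0..T}) \<le> e/3 + e/3"
    proof (rule mdist_cpath_le)
      fix t assume t: "t \<in> {0..T}"
      have in_T: "T * real k / real N \<in> {0..T}" if "k \<le> N" for k
        using that T N' by (auto simp: field_simps)
      have step: "T * real (Suc k) / real N - T * real k / real N = T / real N" for k
        using N' by (simp add: field_simps)
      have "dist (interp T N (\<lambda>k. f (grid T N k)) t) (f t) \<le> e/3 + e/3"
      proof (rule interp_grid_close[OF T N' t])
        fix k assume k: "k < N" 
        show "norm (f (T * real (Suc k) / real N) - f (T * real k / real N)) \<le> e/3"
          using d(2)[OF in_T[of "Suc k"] in_T[of k]] k TN step[of k] T by (simp add: dist_norm)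
        assume tk: "T * real k / real N \<le> t" "t \<le> T * real (Suc k) / real N" 
        show "norm (f (T * real k / real N) - f t) \<le> e/3"
          using d(2)[OF in_T[of k] t] k tk TN step[of k] T by (simp add: dist_norm)
      qed (use e in auto)
      then show "dist (interp T N (\<lambda>k. f (grid T N k)) t) (restrict f {0..T} t) \<le> e/3 + e/3" using t by simp
    qed (use e in auto)
    then show "norm (mdist (cpath T) (interp T N (\<lambda>k. f (grid T N k))) (restrict f {0..T}) - 0) < e"
      using e by simp
  qed
qed

text \<open>Since only finitely many coordinates enter the bound, it controls \<open>G\<close> in
  the product topology on sequences, for which measurability can be checked coordinatewise.\<close>

lemma continuous_on_finite_Lipschitz:
  fixes G :: "(nat \<Rightarrow> 'e::euclidean_space) \<Rightarrow> real"
  assumes "\<And>v w. \<bar>G v - G w\<bar> \<le> C * (\<Sum>k\<le>N. norm (v k - w k))"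
  shows "continuous_on UNIV G"
  unfolding continuous_on_def
proof (intro ballI)
  fix w :: "nat \<Rightarrow> 'e"
  have coord: "((\<lambda>v. v k) \<longlongrightarrow> w k) (at w)" for k
    using continuous_on_product_coordinates[of k] by (auto simp: continuous_on_def)
  have "((\<lambda>v. C * (\<Sum>k\<le>N. norm (v k - w k))) \<longlongrightarrow> C * (\<Sum>k\<le>N. norm (w k - w k))) (at w)"
    by (intro tendsto_intros coord)
  then have "((\<lambda>v. C * (\<Sum>k\<le>N. norm (v k - w k))) \<longlongrightarrow> 0) (at w)" by simp
  then have "((\<lambda>v. G v - G w) \<longlongrightarrow> 0) (at w)"
    by (rule Lim_null_comparison[rotated]) (use assms in \<open>auto intro!: always_eventually\<close>)
  then show "(G \<longlongrightarrow> G w) (at w within UNIV)" by (simp add: LIM_zero_iff)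
qed

lemma borel_measurable_finite_Lipschitz:
  fixes G :: "(nat \<Rightarrow> 'e::euclidean_space) \<Rightarrow> real"
  assumes "\<And>v w. \<bar>G v - G w\<bar> \<le> C * (\<Sum>k\<le>N. norm (v k - w k))"
    and "\<And>k. (\<lambda>\<omega>. V \<omega> k) \<in> borel_measurable M"
  shows "(\<lambda>\<omega>. G (V \<omega>)) \<in> borel_measurable M"
proof -
  have "V \<in> borel_measurable M" using assms(2) by (rule measurable_coordinatewise_then_product)
  moreover have "G \<in> borel_measurable borel"
    using continuous_on_finite_Lipschitz[OF assms(1)] by (rule borel_measurable_continuous_onI)
  ultimately show ?thesis by (rule measurable_compose)
qed

lemma interp_fun_Lipschitz:
  assumes T: "0 < T" and L: "0 \<le> L" "\<And>x y. x \<in> mspace (cpath T) \<Longrightarrow> y \<in> mspace (cpath T) \<Longrightarrow> \<bar>f x - f y\<bar> \<le> L * mdist (cpath T) x y"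
  shows "\<bar>f (interp T N v) - f (interp T N w)\<bar> \<le> 3 * L * (\<Sum>k\<le>N. norm (v k - w k))"
proof -
  have "\<bar>f (interp T N v) - f (interp T N w)\<bar> \<le> L * mdist (cpath T) (interp T N v) (interp T N w)"
    by (rule L(2)) (rule interp_mem_cpath[OF T])+
  also have "\<dots> \<le> L * (3 * (\<Sum>k\<le>N. norm (v k - w k)))"
    using L(1) interp_Lipschitz by (intro mult_left_mono) auto
  finally show ?thesis by simp
qed

lemma Lipschitz_interp_grid_tendsto:
  assumes T: "0 < T" and y: "continuous_on {0..T} y" 
    and L: "0 \<le> L" "\<And>x y. x \<in> mspace (cpath T) \<Longrightarrow> y \<in> mspace (cpath T) \<Longrightarrow> \<bar>f x - f y\<bar> \<le> L * mdist (cpath T) x y"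
  shows "(\<lambda>N. f (interp T N (\<lambda>k. y (grid T N k)))) \<longlonglongrightarrow> f (restrict y {0..T})"
proof -
  have "(\<lambda>N. L * mdist (cpath T) (interp T N (\<lambda>k. y (grid T N k))) (restrict y {0..T})) \<longlonglongrightarrow> L * 0"
    by (intro tendsto_mult tendsto_const interp_grid_tendsto[OF T y])
  then have lim: "(\<lambda>N. L * mdist (cpath T) (interp T N (\<lambda>k. y (grid T N k))) (restrict y {0..T})) \<longlonglongrightarrow> 0"
    by simp
  have "(\<lambda>N. f (interp T N (\<lambda>k. y (grid T N k))) - f (restrict y {0..T})) \<longlonglongrightarrow> 0"
  proof (rule Lim_null_comparison[OF always_eventually lim], intro allI)
    show "norm (f (interp T N (\<lambda>k. y (grid T N k))) - f (restrict y {0..T}))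
      \<le> L * mdist (cpath T) (interp T N (\<lambda>k. y (grid T N k))) (restrict y {0..T})" for N
      unfolding real_norm_def by (intro L(2) interp_mem_cpath[OF T] restrict_mem_cpath[OF y])
  qed
  then show ?thesis by (simp add: LIM_zero_iff)
qed

text \<open>Along continuous paths the functional is the pointwise limit of its values at the
  interpolations, each of which depends on finitely many of the variables
  \<open>Y t\<close>.\<close>

lemma borel_measurable_Lipschitz_path:
  fixes Y :: "real \<Rightarrow> 'a \<Rightarrow> 'e::euclidean_space"
  assumes T: "0 < T" and Y: "\<And>t. t \<in> {0..T} \<Longrightarrow> Y t \<in> borel_measurable M"
    and cont: "\<And>\<omega>. \<omega> \<in> space M \<Longrightarrow> continuous_on {0..T} (\<lambda>t. Y t \<omega>)"
    and L: "0 \<le> L" "\<And>x y. x \<in> mspace (cpath T) \<Longrightarrow> y \<in> mspace (cpath T) \<Longrightarrow> \<bar>f x - f y\<bar> \<le> L * mdist (cpath T) x y"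
  shows "(\<lambda>\<omega>. f (restrict (\<lambda>t. Y t \<omega>) {0..T})) \<in> borel_measurable M"
proof (rule borel_measurable_LIMSEQ_real)
  show "(\<lambda>N. f (interp T N (\<lambda>k. Y (grid T N k) \<omega>))) \<longlonglongrightarrow> f (restrict (\<lambda>t. Y t \<omega>) {0..T})"
    if "\<omega> \<in> space M" for \<omega>
    by (rule Lipschitz_interp_grid_tendsto[OF T cont[OF that] L])
  show "(\<lambda>\<omega>. f (interp T N (\<lambda>k. Y (grid T N k) \<omega>))) \<in> borel_measurable M" for N
    by (rule borel_measurable_finite_Lipschitz[where G="\<lambda>v. f (interp T N v)"], rule interp_fun_Lipschitz[OF T L], assumption, assumption) (intro Y grid_mem T)
qed

text \<open>Every open set is the positivity set of a Lipschitz functional, so each generator of the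
  Borel sets is handled directly, without a countable base of balls.\<close>

lemma measurable_path:
  fixes Y :: "real \<Rightarrow> 'a \<Rightarrow> 'e::euclidean_space"
  assumes T: "0 < T" and Y: "\<And>t. t \<in> {0..T} \<Longrightarrow> Y t \<in> borel_measurable M"
    and cont: "\<And>\<omega>. \<omega> \<in> space M \<Longrightarrow> continuous_on {0..T} (\<lambda>t. Y t \<omega>)"
  shows "(\<lambda>\<omega>. restrict (\<lambda>t. Y t \<omega>) {0..T}) \<in> M \<rightarrow>\<^sub>M borel_sigma (mtopology_of (cpath T))"
  unfolding borel_sigma_def
proof (rule measurable_measure_of)
  let ?m = "cpath T :: (real \<Rightarrow> 'e) metric"
  show "{U. openin (mtopology_of ?m) U} \<subseteq> Pow (topspace (mtopology_of ?m))" using openin_subset by blast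
  show "(\<lambda>\<omega>. restrict (\<lambda>t. Y t \<omega>) {0..T}) \<in> space M \<rightarrow> topspace (mtopology_of ?m)"
    using cont by (auto intro: restrict_mem_cpath)
  fix U assume "U \<in> {U. openin (mtopology_of ?m) U}"
  then have U: "openin (mtopology_of ?m) U" by simp
  \<comment> \<open>The envelope of slope 1 of this indicator is the distance to the complement of
    \<open>U\<close>, cut off at 1.\<close>
  define h where "h y = (if y \<in> U then 1 else 0 :: real)" for y
  interpret bounded_fun_metric ?m h 1 by standard (auto simp: h_def)
  have pos: "0 < infconv ?m h 1 x \<longleftrightarrow> x \<in> U" if x: "x \<in> mspace ?m" for x
  proof
    assume "0 < infconv ?m h 1 x"
    then have "0 < h x" using infconv_le_self[of 1 x] x by simp
    then show "x \<in> U" by (auto simp: h_def split: if_splits)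
  next
    assume "x \<in> U"
    then obtain r where r: "0 < r" "\<And>y. y \<in> mspace ?m \<Longrightarrow> mdist ?m x y < r \<Longrightarrow> y \<in> U"
      using U unfolding openin_mtopology_of by blast
    have "min 1 r \<le> infconv ?m h 1 x"
    proof (rule infconv_ge[OF x])
      fix y assume y: "y \<in> mspace ?m"
      show "min 1 r \<le> h y + 1 * mdist ?m x y"
      proof (cases "mdist ?m x y < r")
        case True
        then have "h y = 1" using r(2)[OF y] by (simp add: h_def)
        then show ?thesis using mdist_nonneg[of ?m x y] by linarith
      next
        case False
        moreover have "0 \<le> h y" by (simp add: h_def)
        ultimately show ?thesis by linarith
      qed
    qed
    then show "0 < infconv ?m h 1 x" using r(1) by linarith
  qed
  have [measurable]: "(\<lambda>\<omega>. infconv ?m h 1 (restrict (\<lambda>t. Y t \<omega>) {0..T})) \<in> borel_measurable M"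
    by (rule borel_measurable_Lipschitz_path[where L=1, OF T Y cont zero_le_one infconv_Lipschitz[OF zero_le_one]])
  have "(\<lambda>\<omega>. restrict (\<lambda>t. Y t \<omega>) {0..T}) -` U \<inter> space M =
      {\<omega> \<in> space M. 0 < infconv ?m h 1 (restrict (\<lambda>t. Y t \<omega>) {0..T})}"
    using pos restrict_mem_cpath[OF cont] by auto
  also have "\<dots> \<in> sets M" by measurable
  finally show "(\<lambda>\<omega>. restrict (\<lambda>t. Y t \<omega>) {0..T}) -` U \<inter> space M \<in> sets M" .
qed

subsection \<open>Dyadic chaining\<close>

text \<open>The left dyadic neighbours \<open>d k\<close> of \<open>t\<close> converge to
  \<open>t\<close>, and consecutive ones coincide or differ by one step of the finer level. The
  increments therefore add up to at most a geometric tail, for which 10 * (9/10)^n leaves some room.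
  The condition \<open>t < T\<close> keeps the cell index below 2^k.\<close>

lemma dyadic_chaining:
  fixes w :: "real \<Rightarrow> 'e::euclidean_space"
  assumes T: "0 < T" and w: "continuous_on {0..T} w" and t: "t \<in> {0..<T}"
    and inc: "\<And>k j. n \<le> k \<Longrightarrow> j < 2^k \<Longrightarrow>
       norm (w (T * real (Suc j) / 2^k) - w (T * real j / 2^k)) \<le> (9/10)^k"
  shows "norm (w (T * real (nat \<lfloor>2^n * t / T\<rfloor>) / 2^n) - w t) \<le> 10 * (9/10)^n"
proof -
  define j where "j k = nat \<lfloor>2^k * t / T\<rfloor>" for k :: nat
  define d where "d k = T * real (j k) / 2^k" for k
  have nn: "0 \<le> 2^k * t / T" for k using t T by simp
  have j: "real (j k) \<le> 2^k * t / T" "2^k * t / T < real (j k) + 1" for k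
    using nn[of k] unfolding j_def by linarith+
  have "2^k * t / T < 2^k" for k using t T by (simp add: divide_less_eq)
  then have jlt: "real (j k) < 2^k" for k using j(1)[of k] by (meson le_less_trans)
  then have jlt': "j k < 2^k" for k by (metis of_nat_less_iff of_nat_numeral of_nat_power)
  have d: "d k \<le> t" "t - d k \<le> T / 2^k" "d k \<in> {0..T}" for k
  proof -
    show "d k \<le> t" using j(1)[of k] T by (simp add: d_def field_simps)
    have "t < T * (real (j k) + 1) / 2^k" using j(2)[of k] T by (simp add: field_simps)
    then show "t - d k \<le> T / 2^k" by (simp add: d_def distrib_left add_divide_distrib)
    then show "d k \<in> {0..T}" using \<open>d k \<le> t\<close> t T by (auto simp: d_def)
  qed
  \<comment> \<open>Doubling a real number doubles its floor, possibly with one added.\<close>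
  have jSuc: "j (Suc k) = 2 * j k \<or> j (Suc k) = Suc (2 * j k)" for k
  proof -
    have "2^Suc k * t / T = 2 * (2^k * t / T)" by simp
    note * = j[of k] j[of "Suc k", unfolded this]
    have "real (j (Suc k)) < real (2 * (j k + 1))" using * by simp
    moreover have "real (2 * j k) < real (j (Suc k) + 1)" using * by simp
    ultimately have "j (Suc k) < 2 * (j k + 1)" "2 * j k < j (Suc k) + 1" by (simp_all only: of_nat_less_iff)
    then show ?thesis by arith
  qed
  have step: "norm (w (d (Suc k)) - w (d k)) \<le> (9/10)^Suc k" if "n \<le> k" for k
  proof -
    have dk: "d k = T * real (2 * j k) / 2^Suc k" by (simp add: d_def)
    show ?thesis
      using jSuc[of k]
    proof
      assume "j (Suc k) = 2 * j k"
      then have "d (Suc k) = d k" unfolding dk by (simp add: d_def)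
      then show ?thesis by simp
    next
      assume *: "j (Suc k) = Suc (2 * j k)"
      have "2 * j k < 2^Suc k" using jlt'[of k] by simp
      then show ?thesis using inc[of "Suc k" "2 * j k"] that * unfolding dk by (simp add: d_def)
    qed
  qed
  \<comment> \<open>Keeping the difference of two powers makes the induction close: 10 * (1 - 9/10)
    = 1 dominates the factor 9/10 of the new step.\<close>
  have bound: "norm (w (d n) - w (d (n + m))) \<le> 10 * ((9/10)^n - (9/10)^(n+m))" for m
  proof (induction m)
    case (Suc m)
    have "norm (w (d n) - w (d (n + Suc m))) \<le> norm (w (d n) - w (d (n + m))) + norm (w (d (Suc (n + m))) - w (d (n + m)))"
      using norm_triangle_ineq4[of "w (d n) - w (d (n + m))" "w (d (Suc (n + m))) - w (d (n + m))"] by simp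
    also have "\<dots> \<le> 10 * ((9/10)^n - (9/10)^(n+m)) + (9/10)^Suc (n+m)" using Suc step[of "n+m"] by auto
    also have "\<dots> = 10 * ((9/10)^n - (9/10)^(n+Suc m)) - (1/10) * (9/10)^(n+m)" by (simp add: algebra_simps)
    also have "\<dots> \<le> 10 * ((9/10)^n - (9/10)^(n+Suc m))" by simp
    finally show ?case .
  qed simp
  have "(\<lambda>m. T / 2^m) \<longlonglongrightarrow> 0" by (rule LIMSEQ_divide_realpow_zero) simp
  then have "(\<lambda>m. T / 2^(n+m)) \<longlonglongrightarrow> 0" using LIMSEQ_ignore_initial_segment[of "\<lambda>m. T / 2^m" 0 n] by (simp add: add.commute)
  then have "(\<lambda>m. d (n + m) - t) \<longlonglongrightarrow> 0"
    by (rule Lim_null_comparison[rotated]) (use d in \<open>auto intro!: always_eventually simp: abs_le_iff\<close>)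
  then have "(\<lambda>m. d (n + m)) \<longlonglongrightarrow> t" by (simp add: LIM_zero_iff)
  then have "(\<lambda>m. w (d (n + m))) \<longlonglongrightarrow> w t"
    by (rule continuous_on_tendsto_compose[OF w]) (use d t in auto)
  then have "(\<lambda>m. norm (w (d n) - w (d (n + m)))) \<longlonglongrightarrow> norm (w (d n) - w t)" by (intro tendsto_intros)
  moreover have "norm (w (d n) - w (d (n + m))) \<le> 10 * (9/10)^n" for m
    using bound[of m] zero_le_power[of "9/10::real" "n+m"] by (simp only: right_diff_distrib) linarith
  ultimately show ?thesis
    unfolding d_def j_def by (intro LIMSEQ_le_const2) auto
qed

lemma norm_integral_le:
  fixes f :: "'a \<Rightarrow> 'b::{banach, second_countable_topology}"
  assumes "integrable M f" "integrable M g" "\<And>x. x \<in> space M \<Longrightarrow> norm (f x) \<le> g x"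
  shows "norm (\<integral>x. f x \<partial>M) \<le> (\<integral>x. g x \<partial>M)"
  by (rule order_trans[OF integral_norm_bound integral_mono]) (use assms in auto)


subsection \<open>Convergence of finite-dimensional distributions\<close>

text \<open>Linear combinations of characters of finitely many coordinates. Their expectations are
  determined by characteristic functions, and they form an algebra, as Stone-Weierstrass
  requires.\<close>

inductive_set trigpoly :: "((nat \<Rightarrow> 'e::euclidean_space) \<Rightarrow> complex) set" where
  iexp: "(\<lambda>v. iexp (\<Sum>k\<le>K. l k \<bullet> v k)) \<in> trigpoly"
| add: "f \<in> trigpoly \<Longrightarrow> g \<in> trigpoly \<Longrightarrow> (\<lambda>v. f v + g v) \<in> trigpoly"
| scale: "f \<in> trigpoly \<Longrightarrow> (\<lambda>v. c * f v) \<in> trigpoly"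

lemma trigpoly_const: "(\<lambda>v. c) \<in> trigpoly"
  using trigpoly.scale[OF trigpoly.iexp[of "\<lambda>_. 0" 0], of c] by simp

lemma trigpoly_mult:
  assumes "f \<in> trigpoly" "g \<in> trigpoly" shows "(\<lambda>v. f v * g v) \<in> trigpoly"
  using assms(1)
proof induction
  case (iexp l K)
  show ?case using assms(2)
  proof induction
    case (iexp l' K')
    \<comment> \<open>Both frequency families are padded with zeros to the common length.\<close>
    let ?l = "\<lambda>k. (if k \<le> K then l k else 0) + (if k \<le> K' then l' k else 0)"
    have "(\<Sum>k\<le>max K K'. ?l k \<bullet> v k) = (\<Sum>k\<le>K. l k \<bullet> v k) + (\<Sum>k\<le>K'. l' k \<bullet> v k)" for v
    proof -
      have "(\<Sum>k\<le>max K K'. (if k \<le> K then l k else 0) \<bullet> v k) = (\<Sum>k\<le>K. l k \<bullet> v k)"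
        by (rule sum.mono_neutral_cong_right) auto
      moreover have "(\<Sum>k\<le>max K K'. (if k \<le> K' then l' k else 0) \<bullet> v k) = (\<Sum>k\<le>K'. l' k \<bullet> v k)"
        by (rule sum.mono_neutral_cong_right) auto
      ultimately show ?thesis by (simp add: inner_add_left sum.distrib)
    qed
    then have "(\<lambda>v. iexp (\<Sum>k\<le>K. l k \<bullet> v k) * iexp (\<Sum>k\<le>K'. l' k \<bullet> v k)) =
       (\<lambda>v. iexp (\<Sum>k\<le>max K K'. ?l k \<bullet> v k))"
      by (simp add: exp_add[symmetric] distrib_left)
    then show ?case using trigpoly.iexp[of ?l "max K K'"] by simp
  next
    case (add f g) then show ?case by (simp add: distrib_left trigpoly.add)
  next
    case (scale f c) then show ?case
      using trigpoly.scale[OF scale.IH, of c] by (simp add: mult.left_commute)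
  qed
next
  case (add f h) then show ?case by (simp add: distrib_right trigpoly.add)
next
  case (scale f c) then show ?case
    using trigpoly.scale[OF scale.IH, of c] by (simp add: mult.assoc)
qed

lemma trigpoly_continuous: "f \<in> trigpoly \<Longrightarrow> continuous_on UNIV f"
  by (induction rule: trigpoly.induct) (intro continuous_intros continuous_on_product_coordinates; simp)+

lemma trigpoly_bounded: "f \<in> trigpoly \<Longrightarrow> \<exists>B. \<forall>v. cmod (f v) \<le> B"
proof (induction rule: trigpoly.induct)
  case (iexp l K) then show ?case by (intro exI[of _ 1]) simp
next
  case (add f g)
  then obtain B B' where "\<forall>v. cmod (f v) \<le> B" "\<forall>v. cmod (g v) \<le> B'" by auto
  then show ?case by (intro exI[of _ "B + B'"]) (auto intro!: norm_triangle_le add_mono)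
next
  case (scale f c)
  then obtain B where "\<forall>v. cmod (f v) \<le> B" by auto
  then show ?case by (intro exI[of _ "cmod c * B"]) (auto simp: norm_mult intro!: mult_left_mono)
qed

lemma trigpoly_integrable:
  fixes V :: "'a \<Rightarrow> nat \<Rightarrow> 'e::euclidean_space"
  assumes "prob_space M" "f \<in> trigpoly" "\<And>k. (\<lambda>\<omega>. V \<omega> k) \<in> borel_measurable M"
  shows "integrable M (\<lambda>\<omega>. f (V \<omega>))"
proof -
  interpret prob_space M by fact
  obtain B where B: "\<And>v. cmod (f v) \<le> B" using trigpoly_bounded[OF assms(2)] by auto
  have "V \<in> borel_measurable M" using assms(3) by (rule measurable_coordinatewise_then_product)
  moreover have "f \<in> borel_measurable borel"
    using trigpoly_continuous[OF assms(2)] by (rule borel_measurable_continuous_onI)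
  ultimately have "(\<lambda>\<omega>. f (V \<omega>)) \<in> borel_measurable M" by (rule measurable_compose)
  then show ?thesis by (intro integrable_const_bound[where B=B]) (simp_all add: B)
qed

lemma trigpoly_tendsto:
  fixes V :: "'i \<Rightarrow> 'a \<Rightarrow> nat \<Rightarrow> 'e::euclidean_space" and U :: "'b \<Rightarrow> nat \<Rightarrow> 'e"
  assumes M: "prob_space M" and N: "prob_space N"
    and V: "\<And>i k. (\<lambda>\<omega>. V i \<omega> k) \<in> borel_measurable M" and U: "\<And>k. (\<lambda>\<omega>. U \<omega> k) \<in> borel_measurable N"
    and chars: "\<And>l K. ((\<lambda>i. \<integral>\<omega>. iexp (\<Sum>k\<le>K. l k \<bullet> V i \<omega> k) \<partial>M) \<longlongrightarrow> (\<integral>\<omega>. iexp (\<Sum>k\<le>K. l k \<bullet> U \<omega> k) \<partial>N)) F"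
    and f: "f \<in> trigpoly"
  shows "((\<lambda>i. \<integral>\<omega>. f (V i \<omega>) \<partial>M) \<longlongrightarrow> (\<integral>\<omega>. f (U \<omega>) \<partial>N)) F"
  using f
proof induction
  case (iexp l K) show ?case by (rule chars)
next
  case (add f g)
  have "integrable M (\<lambda>\<omega>. f (V i \<omega>))" "integrable M (\<lambda>\<omega>. g (V i \<omega>))"
    "integrable N (\<lambda>\<omega>. f (U \<omega>))" "integrable N (\<lambda>\<omega>. g (U \<omega>))" for i
    by (rule trigpoly_integrable[OF M add(1)], rule V, rule trigpoly_integrable[OF M add(2)], rule V,
        rule trigpoly_integrable[OF N add(1)], rule U, rule trigpoly_integrable[OF N add(2)], rule U)
  then show ?case using add by (simp add: tendsto_add)
next
  case (scale f c) then show ?case by (simp add: tendsto_mult)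
qed

text \<open>A change of variables into a compact cube. Its coordinates are trigonometric
  polynomials, and \<open>arcsin_map\<close> inverts it where \<open>a * norm (v k) \<le> 1\<close>,
  since 1 < pi/2. A polynomial approximation on the cube thus pulls back to a trigonometric
  approximation that is uniform on the whole noncompact space.\<close>

definition sin_map :: "real \<Rightarrow> (nat \<Rightarrow> 'e::euclidean_space) \<Rightarrow> nat \<Rightarrow> 'e" where
  "sin_map a v k = (\<Sum>b\<in>Basis. sin (a * (v k \<bullet> b)) *\<^sub>R b)"

definition arcsin_map :: "real \<Rightarrow> (nat \<Rightarrow> 'e::euclidean_space) \<Rightarrow> nat \<Rightarrow> 'e" where
  "arcsin_map a s k = (\<Sum>b\<in>Basis. (arcsin (s k \<bullet> b) / a) *\<^sub>R b)"

definition seq_cube :: "(nat \<Rightarrow> 'e::euclidean_space) set" where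
  "seq_cube = {s. \<forall>k. \<forall>b\<in>Basis. \<bar>s k \<bullet> b\<bar> \<le> 1}"

lemma sin_map_inner: "b \<in> Basis \<Longrightarrow> sin_map a v k \<bullet> b = sin (a * (v k \<bullet> b))"
  by (simp add: sin_map_def)

lemma sin_map_in_cube: "sin_map a v \<in> seq_cube"
  by (auto simp: seq_cube_def sin_map_inner)

lemma arcsin_sin_map:
  assumes "0 < a" "a * norm (v k) \<le> 1"
  shows "arcsin_map a (sin_map a v) k = v k"
proof (rule euclidean_eqI)
  fix b :: 'a assume b: "b \<in> Basis"
  have "\<bar>a * (v k \<bullet> b)\<bar> \<le> 1"
    using Basis_le_norm[OF b, of "v k"] assms by (simp add: abs_mult) (meson mult_left_mono order.trans less_imp_le)
  moreover have "1 < pi / 2" using pi_gt3 by simp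
  ultimately have "arcsin (sin (a * (v k \<bullet> b))) = a * (v k \<bullet> b)" by (intro arcsin_sin) linarith+
  then show "arcsin_map a (sin_map a v) k \<bullet> b = v k \<bullet> b"
    using assms(1) b by (simp add: arcsin_map_def sin_map_inner)
qed

text \<open>Tychonoff's theorem for a product of compact boxes.\<close>

lemma compact_seq_cube: "compact (seq_cube :: (nat \<Rightarrow> 'e::euclidean_space) set)"
proof -
  have "seq_cube = PiE UNIV (\<lambda>_. cbox (- One) (One :: 'e))"
    by (auto simp: seq_cube_def PiE_iff mem_box abs_le_iff minus_le_iff)
  moreover have "compactin (product_topology (\<lambda>_. euclidean) UNIV) (PiE UNIV (\<lambda>_::nat. cbox (- One) (One :: 'e)))"
    unfolding compactin_PiE by (simp add: compact_cbox)
  ultimately show ?thesis by (simp add: euclidean_product_topology flip: compactin_euclidean_iff)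
qed

lemma continuous_arcsin_map: "continuous_on seq_cube (arcsin_map a)"
  unfolding arcsin_map_def
proof (intro continuous_on_coordinatewise_then_product continuous_on_sum continuous_on_scaleR continuous_on_const)
  fix k and b :: 'a assume b: "b \<in> Basis"
  have "continuous_on seq_cube (\<lambda>s. s k \<bullet> b :: real)"
    by (intro continuous_intros continuous_on_product_then_coordinatewise[of _ "\<lambda>x. x"] continuous_on_id)
  then have "continuous_on seq_cube (\<lambda>s. inverse a * arcsin (s k \<bullet> b))"
    by (intro continuous_on_mult continuous_on_const continuous_on_arcsin)
       (use b in \<open>auto simp: seq_cube_def abs_le_iff minus_le_iff\<close>)
  then show "continuous_on seq_cube (\<lambda>s. arcsin (s k \<bullet> b) / a)"
    by (simp add: divide_inverse mult.commute)
qed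

text \<open>The algebra for Stone-Weierstrass consists of those functions on the cube whose pullback
  is a trigonometric polynomial. Coordinates belong to it because the sine is a combination of two
  exponentials, and they already separate points.\<close>

lemma function_ring_trig:
  "function_ring_on {f. continuous_on seq_cube f \<and> (\<lambda>v. complex_of_real (f (sin_map a v))) \<in> trigpoly}
     (seq_cube :: (nat \<Rightarrow> 'e::euclidean_space) set)"
proof (unfold_locales)
  fix x y :: "nat \<Rightarrow> 'e" assume "x \<noteq> y"
  then obtain k where "x k \<noteq> y k" by auto
  then obtain b where b: "b \<in> Basis" "x k \<bullet> b \<noteq> y k \<bullet> b" using euclidean_eqI by blast
  define f where "f s = s k \<bullet> b" for s :: "nat \<Rightarrow> 'e"
  have "continuous_on seq_cube f"
    unfolding f_def by (intro continuous_intros continuous_on_product_then_coordinatewise[of _ "\<lambda>x. x"] continuous_on_id)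
  moreover have "(\<lambda>v. complex_of_real (f (sin_map a v))) \<in> trigpoly"
  proof -
    define l where "l r j = (if j = k then (r * a) *\<^sub>R b else 0)" for r :: real and j
    have l: "(\<Sum>j\<le>k. l r j \<bullet> v j) = r * (a * (v k \<bullet> b))" for r v
    proof -
      have "(\<Sum>j\<le>k. l r j \<bullet> v j) = (\<Sum>j\<in>{k}. l r j \<bullet> v j)"
        by (rule sum.mono_neutral_right) (auto simp: l_def)
      then show ?thesis by (simp add: l_def inner_commute)
    qed
    \<comment> \<open>Euler's formula for the sine, with frequencies a and -a in the single
      coordinate \<open>k\<close> along \<open>b\<close>.\<close>
    have "(\<lambda>v. (- \<i> / 2) * iexp (\<Sum>j\<le>k. l 1 j \<bullet> v j) + (\<i> / 2) * iexp (\<Sum>j\<le>k. l (-1) j \<bullet> v j)) \<in> trigpoly"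
      by (intro trigpoly.intros)
    moreover have "(- \<i> / 2) * iexp (\<Sum>j\<le>k. l 1 j \<bullet> v j) + (\<i> / 2) * iexp (\<Sum>j\<le>k. l (-1) j \<bullet> v j)
        = complex_of_real (f (sin_map a v))" for v
      unfolding l f_def sin_map_inner[OF b(1)]
      by (simp add: complex_eq_iff Re_exp Im_exp)
    ultimately show ?thesis by simp
  qed
  moreover have "f x \<noteq> f y" using b by (simp add: f_def)
  ultimately show "\<exists>f\<in>{f. continuous_on seq_cube f \<and> (\<lambda>v. complex_of_real (f (sin_map a v))) \<in> trigpoly}. f x \<noteq> f y"
    by blast
qed (auto intro: compact_seq_cube continuous_intros trigpoly_const trigpoly.add trigpoly_mult)

text \<open>A substitute for Levy's continuity theorem. \<open>H R\<close> replaces the argument of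
  \<open>G\<close> by the arcsine of its sine at scale R. It equals \<open>G\<close> as long as the
  relevant coordinates have norm at most R, an event that is likely uniformly in the index by
  \<open>tight\<close>; and it is a uniform limit of trigonometric polynomials.\<close>

theorem char_convergence_Lipschitz:
  fixes V :: "'i \<Rightarrow> 'a \<Rightarrow> nat \<Rightarrow> 'e::euclidean_space" and U :: "'b \<Rightarrow> nat \<Rightarrow> 'e"
  assumes M: "prob_space M" and N: "prob_space N"
    and V: "\<And>i k. (\<lambda>\<omega>. V i \<omega> k) \<in> borel_measurable M" and U: "\<And>k. (\<lambda>\<omega>. U \<omega> k) \<in> borel_measurable N"
    and chars: "\<And>l K. ((\<lambda>i. \<integral>\<omega>. iexp (\<Sum>k\<le>K. l k \<bullet> V i \<omega> k) \<partial>M) \<longlongrightarrow> (\<integral>\<omega>. iexp (\<Sum>k\<le>K. l k \<bullet> U \<omega> k) \<partial>N)) F"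
    and tight: "\<And>k \<eta>. 0 < \<eta> \<Longrightarrow> \<forall>\<^sub>F R in at_top. \<forall>i. measure M {\<omega>\<in>space M. R < norm (V i \<omega> k)} \<le> \<eta>"
    and G: "\<And>v w. \<bar>G v - G w\<bar> \<le> C * (\<Sum>k\<le>n. norm (v k - w k))" and B: "\<And>v. \<bar>G v\<bar> \<le> B"
  shows "((\<lambda>i. \<integral>\<omega>. G (V i \<omega>) \<partial>M) \<longlongrightarrow> (\<integral>\<omega>. G (U \<omega>) \<partial>N)) F"
proof -
  interpret M: prob_space M by fact
  interpret N: prob_space N by fact
  have B0: "0 \<le> B" using B[of undefined] by linarith
  define H where "H R v = G (arcsin_map (1/R) (sin_map (1/R) v))" for R v
  have G_fin: "G v = G w" if "\<And>k. k \<le> n \<Longrightarrow> v k = w k" for v w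
    using G[of v w] that by simp
  have H_eq: "H R v = G v" if "0 < R" "\<And>k. k \<le> n \<Longrightarrow> norm (v k) \<le> R" for R v
    unfolding H_def by (rule G_fin, rule arcsin_sin_map) (use that in \<open>auto simp: field_simps\<close>)
  have contG: "continuous_on UNIV G" by (rule continuous_on_finite_Lipschitz[OF G])
  have cont_arc: "continuous_on seq_cube (\<lambda>s. G (arcsin_map a s))" for a
    by (rule continuous_on_compose2[OF contG continuous_arcsin_map]) auto
  have contH: "continuous_on UNIV (H R)" for R
    unfolding H_def
  proof (rule continuous_on_compose2[OF cont_arc])
    show "continuous_on UNIV (sin_map (1/R) :: (nat \<Rightarrow> 'e) \<Rightarrow> _)"
      unfolding sin_map_def
      by (intro continuous_on_coordinatewise_then_product continuous_intros continuous_on_product_coordinates)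
  qed (auto intro: sin_map_in_cube)
  have V': "V i \<in> borel_measurable M" for i using V by (rule measurable_coordinatewise_then_product)
  have U': "U \<in> borel_measurable N" using U by (rule measurable_coordinatewise_then_product)
  have intM: "integrable M (\<lambda>\<omega>. f (V i \<omega>))" if "continuous_on UNIV f" "\<And>v. \<bar>f v\<bar> \<le> D" for f :: "_ \<Rightarrow> real" and i D
    using measurable_compose[OF V' borel_measurable_continuous_onI[OF that(1)]] that(2)
    by (intro M.integrable_const_bound[where B=D]) auto
  have intN: "integrable N (\<lambda>\<omega>. f (U \<omega>))" if "continuous_on UNIV f" "\<And>v. \<bar>f v\<bar> \<le> D" for f :: "_ \<Rightarrow> real" and D
    using measurable_compose[OF U' borel_measurable_continuous_onI[OF that(1)]] that(2)
    by (intro N.integrable_const_bound[where B=D]) auto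
  have BH: "\<bar>H R v\<bar> \<le> B" for R v by (simp add: H_def B)
  \<comment> \<open>The image of \<open>sin_map\<close> stays in the cube, so the Stone-Weierstrass
    error is at most \<open>e\<close> at every sample point and for every index.\<close>
  have lim_H: "((\<lambda>i. \<integral>\<omega>. H R (V i \<omega>) \<partial>M) \<longlongrightarrow> (\<integral>\<omega>. H R (U \<omega>) \<partial>N)) F" for R
  proof (rule tendsto_approx)
    fix e :: real assume e: "0 < e"
    interpret function_ring_on "{f. continuous_on seq_cube f \<and> (\<lambda>v. complex_of_real (f (sin_map (1/R) v))) \<in> trigpoly}"
      "seq_cube :: (nat \<Rightarrow> 'e) set" by (rule function_ring_trig)
    obtain g where g: "(\<lambda>v. complex_of_real (g (sin_map (1/R) v))) \<in> trigpoly"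
      and g_close: "\<And>s. s \<in> seq_cube \<Longrightarrow> \<bar>G (arcsin_map (1/R) s) - g s\<bar> < e"
      using Stone_Weierstrass_basic[OF cont_arc e] by blast
    define g' where "g' v = g (sin_map (1/R) v)" for v
    have close: "\<bar>H R v - g' v\<bar> \<le> e" for v
      using g_close[OF sin_map_in_cube, of "1/R" v] by (simp add: H_def g'_def)
    have "((\<lambda>i. \<integral>\<omega>. complex_of_real (g' (V i \<omega>)) \<partial>M) \<longlongrightarrow> (\<integral>\<omega>. complex_of_real (g' (U \<omega>)) \<partial>N)) F"
      using trigpoly_tendsto[OF M N V U chars g] by (simp add: g'_def)
    then have "((\<lambda>i. \<integral>\<omega>. g' (V i \<omega>) \<partial>M) \<longlongrightarrow> (\<integral>\<omega>. g' (U \<omega>) \<partial>N)) F"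
      by (simp add: tendsto_of_real_iff)
    moreover have gM: "integrable M (\<lambda>\<omega>. g' (V i \<omega>))" for i
      using trigpoly_integrable[OF M g V] by (simp add: g'_def complex_of_real_integrable_eq)
    moreover have gN: "integrable N (\<lambda>\<omega>. g' (U \<omega>))"
      using trigpoly_integrable[OF N g U] by (simp add: g'_def complex_of_real_integrable_eq)
    moreover have "norm ((\<integral>\<omega>. H R (V i \<omega>) \<partial>M) - (\<integral>\<omega>. g' (V i \<omega>) \<partial>M)) \<le> e" for i
    proof -
      have "norm (\<integral>\<omega>. H R (V i \<omega>) - g' (V i \<omega>) \<partial>M) \<le> (\<integral>\<omega>. e \<partial>M)"
        using close by (intro norm_integral_le Bochner_Integration.integrable_diff intM[OF contH BH] gM) auto
      then show ?thesis by (simp add: Bochner_Integration.integral_diff[OF intM[OF contH BH] gM] M.prob_space)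
    qed
    moreover have "norm ((\<integral>\<omega>. g' (U \<omega>) \<partial>N) - (\<integral>\<omega>. H R (U \<omega>) \<partial>N)) \<le> e"
    proof -
      have "norm (\<integral>\<omega>. H R (U \<omega>) - g' (U \<omega>) \<partial>N) \<le> (\<integral>\<omega>. e \<partial>N)"
        using close by (intro norm_integral_le Bochner_Integration.integrable_diff intN[OF contH BH] gN) auto
      then show ?thesis
        by (simp add: Bochner_Integration.integral_diff[OF intN[OF contH BH] gN] N.prob_space abs_minus_commute)
    qed
    ultimately show "\<exists>a' b'. (a' \<longlongrightarrow> b') F \<and> (\<forall>\<^sub>F i in F. norm ((\<integral>\<omega>. H R (V i \<omega>) \<partial>M) - a' i) \<le> e)
        \<and> norm (b' - (\<integral>\<omega>. H R (U \<omega>) \<partial>N)) \<le> e"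
      by (intro exI[of _ "\<lambda>i. \<integral>\<omega>. g' (V i \<omega>) \<partial>M"] exI[of _ "\<integral>\<omega>. g' (U \<omega>) \<partial>N"] conjI always_eventually allI)
  qed
  have lim_R: "((\<lambda>R. \<integral>\<omega>. H R (U \<omega>) \<partial>N) \<longlongrightarrow> (\<integral>\<omega>. G (U \<omega>) \<partial>N)) at_top"
  proof (rule integral_dominated_convergence_at_top[where w="\<lambda>_. B"])
    show "AE \<omega> in N. ((\<lambda>R. H R (U \<omega>)) \<longlongrightarrow> G (U \<omega>)) at_top"
    proof (rule AE_I2)
      fix \<omega>
      have "\<forall>\<^sub>F R in at_top. H R (U \<omega>) = G (U \<omega>)"
      proof (rule eventually_at_top_linorderI)
        fix R assume R: "1 + (\<Sum>k\<le>n. norm (U \<omega> k)) \<le> R"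
        show "H R (U \<omega>) = G (U \<omega>)"
        proof (rule H_eq)
          show "0 < R" using R sum_nonneg[of "{..n}" "\<lambda>k. norm (U \<omega> k)"] by simp
          show "norm (U \<omega> k) \<le> R" if "k \<le> n" for k
            using member_le_sum[of k "{..n}" "\<lambda>k. norm (U \<omega> k)"] that R by simp
        qed
      qed
      then show "((\<lambda>R. H R (U \<omega>)) \<longlongrightarrow> G (U \<omega>)) at_top" by (rule tendsto_eventually)
    qed
  qed (use measurable_compose[OF U' borel_measurable_continuous_onI[OF contH]]
       measurable_compose[OF U' borel_measurable_continuous_onI[OF contG]] BH in \<open>auto intro: always_eventually\<close>)
  show ?thesis
  proof (rule tendsto_approx)
    fix e :: real assume e: "0 < e"
    \<comment> \<open>A union bound over the n + 1 coordinates, each bad event costing 2 * B; the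
      added 1 keeps the divisor positive if B = 0.\<close>
    define \<eta> where "\<eta> = e / ((2 * B + 1) * (real n + 1))"
    have \<eta>: "0 < \<eta>" using e B0 by (simp add: \<eta>_def)
    have "\<forall>\<^sub>F R in at_top. \<forall>k\<in>{..n}. \<forall>i. measure M {\<omega>\<in>space M. R < norm (V i \<omega> k)} \<le> \<eta>"
      using tight[OF \<eta>] by (intro eventually_ball_finite) auto
    moreover have "\<forall>\<^sub>F R in at_top. dist (\<integral>\<omega>. H R (U \<omega>) \<partial>N) (\<integral>\<omega>. G (U \<omega>) \<partial>N) < e"
      using lim_R e by (rule tendstoD)
    moreover have "\<forall>\<^sub>F R in at_top. (0::real) < R" by (rule eventually_gt_at_top)
    ultimately have "\<forall>\<^sub>F R in at_top. (\<forall>k\<in>{..n}. \<forall>i. measure M {\<omega>\<in>space M. R < norm (V i \<omega> k)} \<le> \<eta>) \<and>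
        dist (\<integral>\<omega>. H R (U \<omega>) \<partial>N) (\<integral>\<omega>. G (U \<omega>) \<partial>N) < e \<and> 0 < R"
      by eventually_elim blast
    then obtain R where R': "(\<forall>k\<in>{..n}. \<forall>i. measure M {\<omega>\<in>space M. R < norm (V i \<omega> k)} \<le> \<eta>) \<and>
        dist (\<integral>\<omega>. H R (U \<omega>) \<partial>N) (\<integral>\<omega>. G (U \<omega>) \<partial>N) < e \<and> 0 < R"
      using eventually_happens'[OF trivial_limit_at_top_linorder] by blast
    have R: "\<And>k i. k \<le> n \<Longrightarrow> measure M {\<omega>\<in>space M. R < norm (V i \<omega> k)} \<le> \<eta>"
        "dist (\<integral>\<omega>. H R (U \<omega>) \<partial>N) (\<integral>\<omega>. G (U \<omega>) \<partial>N) < e" "0 < R"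
      using R' by auto
    have close: "norm ((\<integral>\<omega>. G (V i \<omega>) \<partial>M) - (\<integral>\<omega>. H R (V i \<omega>) \<partial>M)) \<le> e" for i
    proof -
      define A where "A k = {\<omega>\<in>space M. R < norm (V i \<omega> k)}" for k
      have A[measurable]: "A k \<in> sets M" for k unfolding A_def using V[of i k] by measurable
      have "norm (\<integral>\<omega>. G (V i \<omega>) - H R (V i \<omega>) \<partial>M) \<le> (\<integral>\<omega>. (\<Sum>k\<le>n. 2 * B * indicator (A k) \<omega>) \<partial>M)"
      proof (intro norm_integral_le Bochner_Integration.integrable_diff intM[OF contH BH] intM[OF contG B])
        show "integrable M (\<lambda>\<omega>. \<Sum>k\<le>n. 2 * B * indicator (A k) \<omega>)"
          by (intro Bochner_Integration.integrable_sum integrable_mult_right integrable_real_indicator) (auto simp: M.emeasure_eq_measure)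
        fix \<omega> assume \<omega>: "\<omega> \<in> space M"
        show "norm (G (V i \<omega>) - H R (V i \<omega>)) \<le> (\<Sum>k\<le>n. 2 * B * indicator (A k) \<omega>)"
        proof (cases "\<exists>k\<le>n. \<omega> \<in> A k")
          case True
          then obtain k where k: "k \<le> n" "\<omega> \<in> A k" by auto
          have "norm (G (V i \<omega>) - H R (V i \<omega>)) \<le> 2 * B * indicator (A k) \<omega>"
            using B[of "V i \<omega>"] BH[of R "V i \<omega>"] k by (simp add: abs_le_iff)
          also have "\<dots> \<le> (\<Sum>k\<le>n. 2 * B * indicator (A k) \<omega>)"
            using k B0 by (intro member_le_sum) auto
          finally show ?thesis .
        next
          case False
          then have "H R (V i \<omega>) = G (V i \<omega>)"
            using \<omega> by (intro H_eq R(3)) (auto simp: A_def not_less)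
          then show ?thesis using B0 by (auto intro!: sum_nonneg)
        qed
      qed
      also have "\<dots> = (\<Sum>k\<le>n. 2 * B * measure M (A k))"
        by (subst Bochner_Integration.integral_sum)
           (auto intro!: integrable_mult_right integrable_real_indicator simp: M.emeasure_eq_measure)
      also have "\<dots> \<le> (\<Sum>k\<le>n. 2 * B * \<eta>)"
        using B0 R(1) by (intro sum_mono mult_left_mono) (auto simp: A_def)
      also have "\<dots> \<le> (2 * B + 1) * (real n + 1) * \<eta>"
        using \<eta> by (simp add: algebra_simps)
      also have "\<dots> = e" using B0 by (simp add: \<eta>_def)
      finally show ?thesis
        by (simp add: Bochner_Integration.integral_diff[OF intM[OF contG B] intM[OF contH BH]])
    qed
    show "\<exists>a' b'. (a' \<longlongrightarrow> b') F \<and> (\<forall>\<^sub>F i in F. norm ((\<integral>\<omega>. G (V i \<omega>) \<partial>M) - a' i) \<le> e)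
        \<and> norm (b' - (\<integral>\<omega>. G (U \<omega>) \<partial>N)) \<le> e"
      using R(2) close
      by (intro exI[of _ "\<lambda>i. \<integral>\<omega>. H R (V i \<omega>) \<partial>M"] exI[of _ "\<integral>\<omega>. H R (U \<omega>) \<partial>N"] conjI always_eventually allI lim_H)
         (auto simp: dist_norm)
  qed
qed

subsection \<open>Weak convergence in path space\<close>

lemma (in prob_space) fourth_moment_tail:
  fixes Z :: "'a \<Rightarrow> 'e::euclidean_space"
  assumes Z: "Z \<in> borel_measurable M" "integrable M (\<lambda>\<omega>. norm (Z \<omega>) ^ 4)" and r: "0 < r"
  shows "prob {\<omega>\<in>space M. r < norm (Z \<omega>)} \<le> expectation (\<lambda>\<omega>. norm (Z \<omega>) ^ 4) / r ^ 4"
proof -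
  have "prob {\<omega>\<in>space M. r < norm (Z \<omega>)} \<le> prob {\<omega>\<in>space M. r ^ 4 \<le> norm (Z \<omega>) ^ 4}"
    using Z(1) r by (intro finite_measure_mono) (auto intro!: power_mono)
  also have "\<dots> \<le> expectation (\<lambda>\<omega>. norm (Z \<omega>) ^ 4) / r ^ 4"
    using Z(2) r by (intro integral_Markov_inequality_measure[where A="{}"]) auto
  finally show ?thesis .
qed

text \<open>By the fourth moment bound and chaining, the path is close to its dyadic interpolation
  outside an event whose probability is small uniformly in the index. The values of a Lipschitz
  functional at the path and at the interpolation differ accordingly, and at the interpolation the
  functional depends on finitely many times, where the characteristic functions decide.\<close>

theorem converges_weakly_path:
  fixes Y :: "'i \<Rightarrow> real \<Rightarrow> 'a \<Rightarrow> 'e::euclidean_space" and W :: "real \<Rightarrow> 'b \<Rightarrow> 'e"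
  assumes T: "0 < T" and M: "prob_space M" and N: "prob_space N"
    and Y: "\<And>i t. t \<in> {0..T} \<Longrightarrow> Y i t \<in> borel_measurable M"
    and Y_cont: "\<And>i \<omega>. \<omega> \<in> space M \<Longrightarrow> continuous_on {0..T} (\<lambda>t. Y i t \<omega>)"
    and Y_0: "\<And>i \<omega>. \<omega> \<in> space M \<Longrightarrow> Y i 0 \<omega> = 0"
    and W: "\<And>t. t \<in> {0..T} \<Longrightarrow> W t \<in> borel_measurable N"
    and W_cont: "\<And>\<omega>. \<omega> \<in> space N \<Longrightarrow> continuous_on {0..T} (\<lambda>t. W t \<omega>)"
    and C0: "0 \<le> C"
    and moment_int: "\<And>i s t. 0 \<le> s \<Longrightarrow> s \<le> t \<Longrightarrow> t \<le> T \<Longrightarrow> integrable M (\<lambda>\<omega>. norm (Y i t \<omega> - Y i s \<omega>) ^ 4)"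
    and moment: "\<And>i s t. 0 \<le> s \<Longrightarrow> s \<le> t \<Longrightarrow> t \<le> T \<Longrightarrow>
      (\<integral>\<omega>. norm (Y i t \<omega> - Y i s \<omega>) ^ 4 \<partial>M) \<le> C * (t - s)\<^sup>2"
    and chars: "\<And>t l K. incseq t \<Longrightarrow> t 0 = 0 \<Longrightarrow> (\<And>k. t k \<in> {0..T}) \<Longrightarrow>
      ((\<lambda>i. \<integral>\<omega>. iexp (\<Sum>k\<le>K. l k \<bullet> Y i (t k) \<omega>) \<partial>M) \<longlongrightarrow>
        (\<integral>\<omega>. iexp (\<Sum>k\<le>K. l k \<bullet> W (t k) \<omega>) \<partial>N)) F"
  shows "converges_weakly (mtopology_of (cpath T))
     (\<lambda>i. distr M (borel_sigma (mtopology_of (cpath T))) (\<lambda>\<omega>. restrict (\<lambda>t. Y i t \<omega>) {0..T}))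
     (distr N (borel_sigma (mtopology_of (cpath T))) (\<lambda>\<omega>. restrict (\<lambda>t. W t \<omega>) {0..T})) F"
proof (rule converges_weakly_Lipschitz)
  interpret M: prob_space M by fact
  interpret N: prob_space N by fact
  let ?B = "borel_sigma (mtopology_of (cpath T :: (real \<Rightarrow> 'e) metric))"
  let ?Y = "\<lambda>i \<omega>. restrict (\<lambda>t. Y i t \<omega>) {0..T}" and ?W = "\<lambda>\<omega>. restrict (\<lambda>t. W t \<omega>) {0..T}"
  have mY: "?Y i \<in> M \<rightarrow>\<^sub>M ?B" for i by (rule measurable_path[OF T Y Y_cont])
  have mW: "?W \<in> N \<rightarrow>\<^sub>M ?B" by (rule measurable_path[OF T W W_cont])
  show "\<forall>\<^sub>F i in F. prob_space (distr M ?B (?Y i)) \<and> sets (distr M ?B (?Y i)) = sets ?B"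
    using M.prob_space_distr[OF mY] by (intro always_eventually) simp
  show "prob_space (distr N ?B ?W)" using N.prob_space_distr[OF mW] .
  show "sets (distr N ?B ?W) = sets ?B" by simp
  fix f :: "(real \<Rightarrow> 'e) \<Rightarrow> real" and B L
  assume L0: "0 \<le> L" and B: "\<And>x. x \<in> mspace (cpath T) \<Longrightarrow> \<bar>f x\<bar> \<le> B"
    and L: "\<And>x y. x \<in> mspace (cpath T) \<Longrightarrow> y \<in> mspace (cpath T) \<Longrightarrow> \<bar>f x - f y\<bar> \<le> L * mdist (cpath T) x y"
  have B0: "0 \<le> B" using B[OF interp_mem_cpath[OF T]] by (meson abs_ge_zero order_trans)
  have f: "f \<in> borel_measurable ?B"
    by (rule measurable_borel_sigma_continuous[OF Lipschitz_continuous_map_real[OF L]]) auto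
  have fY: "(\<lambda>\<omega>. f (?Y i \<omega>)) \<in> borel_measurable M" for i using measurable_compose[OF mY f] .
  have fW: "(\<lambda>\<omega>. f (?W \<omega>)) \<in> borel_measurable N" using measurable_compose[OF mW f] .
  define G where "G n v = f (interp T n v)" for n v
  have G_B: "\<bar>G n v\<bar> \<le> B" for n v unfolding G_def by (rule B[OF interp_mem_cpath[OF T]])
  have G_L: "\<bar>G n v - G n w\<bar> \<le> 3 * L * (\<Sum>k\<le>n. norm (v k - w k))" for n v w
    unfolding G_def by (rule interp_fun_Lipschitz[OF T L0 L])
  have GY: "(\<lambda>\<omega>. G n (\<lambda>k. Y i (grid T n k) \<omega>)) \<in> borel_measurable M" for n i
    by (rule borel_measurable_finite_Lipschitz[OF G_L]) (intro Y grid_mem T)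
  have GW: "(\<lambda>\<omega>. G n (\<lambda>k. W (grid T n k) \<omega>)) \<in> borel_measurable N" for n
    by (rule borel_measurable_finite_Lipschitz[OF G_L]) (intro W grid_mem T)
  have lim_G: "((\<lambda>i. \<integral>\<omega>. G n (\<lambda>k. Y i (grid T n k) \<omega>) \<partial>M) \<longlongrightarrow> (\<integral>\<omega>. G n (\<lambda>k. W (grid T n k) \<omega>) \<partial>N)) F" for n
  proof (rule char_convergence_Lipschitz[OF M N _ _ _ _ G_L G_B])
    show "Y i (grid T n k) \<in> borel_measurable M" for i k by (intro Y grid_mem T)
    show "W (grid T n k) \<in> borel_measurable N" for k by (intro W grid_mem T)
    show "((\<lambda>i. \<integral>\<omega>. iexp (\<Sum>k\<le>K. l k \<bullet> Y i (grid T n k) \<omega>) \<partial>M) \<longlongrightarrow>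
        (\<integral>\<omega>. iexp (\<Sum>k\<le>K. l k \<bullet> W (grid T n k) \<omega>) \<partial>N)) F" for l K
    proof (rule chars)
      show "incseq (grid T n)"
        using T by (auto simp: incseq_def grid_def intro!: divide_right_mono mult_left_mono min.mono)
    qed (use grid_mem[OF T, of n] in \<open>auto simp: grid_def\<close>)
    fix k and \<eta> :: real assume \<eta>: "0 < \<eta>"
    show "\<forall>\<^sub>F R in at_top. \<forall>i. measure M {\<omega> \<in> space M. R < norm (Y i (grid T n k) \<omega>)} \<le> \<eta>"
    proof (rule eventually_at_top_linorderI, intro allI)
      \<comment> \<open>The summand 1 ensures \<open>1 \<le> R\<close>, so that R ^ 4 can be
        replaced by R in the Markov bound.\<close>
      fix R i assume R: "1 + C * T\<^sup>2 / \<eta> \<le> R"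
      have R1: "1 \<le> R" using R C0 \<eta> by (smt (verit) divide_nonneg_pos mult_nonneg_nonneg zero_le_power2)
      let ?t = "grid T n k"
      have t: "?t \<in> {0..T}" by (rule grid_mem[OF T])
      have eq: "(\<integral>\<omega>. norm (Y i ?t \<omega> - Y i 0 \<omega>) ^ 4 \<partial>M) = (\<integral>\<omega>. norm (Y i ?t \<omega>) ^ 4 \<partial>M)"
        by (intro Bochner_Integration.integral_cong) (simp_all add: Y_0)
      have int: "integrable M (\<lambda>\<omega>. norm (Y i ?t \<omega>) ^ 4)"
        using moment_int[of 0 ?t i] t Y_0 by (simp cong: Bochner_Integration.integrable_cong)
      have "measure M {\<omega> \<in> space M. R < norm (Y i ?t \<omega>)} \<le> (\<integral>\<omega>. norm (Y i ?t \<omega>) ^ 4 \<partial>M) / R ^ 4"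
        using R1 by (intro M.fourth_moment_tail Y t int) auto
      also have "\<dots> \<le> (C * T\<^sup>2) / R ^ 4"
      proof (intro divide_right_mono)
        have "(\<integral>\<omega>. norm (Y i ?t \<omega>) ^ 4 \<partial>M) \<le> C * (?t - 0)\<^sup>2"
          using moment[of 0 ?t i] t eq by simp
        also have "\<dots> \<le> C * T\<^sup>2" using t C0 by (intro mult_left_mono power_mono) auto
        finally show "(\<integral>\<omega>. norm (Y i ?t \<omega>) ^ 4 \<partial>M) \<le> C * T\<^sup>2" .
      qed (use R1 in auto)
      also have "\<dots> \<le> (C * T\<^sup>2) / R ^ 1"
        using R1 C0 by (intro divide_left_mono power_increasing) auto
      also have "\<dots> \<le> \<eta>"
        using R R1 \<eta> by (simp add: field_simps)
      finally show "measure M {\<omega> \<in> space M. R < norm (Y i ?t \<omega>)} \<le> \<eta>" .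
    qed
  qed
  \<comment> \<open>This is 1 / (2 * (9/10)^4): at level k there are 2^k increments, each too large
    with probability at most C (T/2^k)^2 / (9/10)^(4k). The threshold base 9/10 is admissible
    because it exceeds 2^(-1/4), which means q < 1.\<close>
  define q :: real where "q = 10000 / 13122"
  \<comment> \<open>11 = 10 + 1: chaining from the cell's left end to \<open>t\<close>, and one
    increment of the interpolation. On the bad event the two values differ by at most 2 * B.\<close>
  define err where "err n = 11 * L * (9/10)^n + 2 * B * (C * T\<^sup>2 * q ^ n * (1 / (1 - q)))" for n
  have q: "0 < q" "q < 1" by (auto simp: q_def)
  have err_lim: "err \<longlonglongrightarrow> 11 * L * 0 + 2 * B * (C * T\<^sup>2 * 0 * (1 / (1 - q)))"
    unfolding err_def using q by (intro tendsto_intros LIMSEQ_realpow_zero) auto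
  have err: "norm ((\<integral>\<omega>. f (?Y i \<omega>) \<partial>M) - (\<integral>\<omega>. G (2^n) (\<lambda>k. Y i (grid T (2^n) k) \<omega>) \<partial>M)) \<le> err n" for i n
  proof -
    define dy where "dy k j = T * real j / 2^k" for k j :: nat
    have dy: "dy k j \<in> {0..T}" if "j \<le> 2^k" for k j
    proof -
      have "real j \<le> 2^k" using that by (metis of_nat_le_iff of_nat_numeral of_nat_power)
      then show ?thesis using T by (auto simp: dy_def field_simps)
    qed
    have dy_step: "dy k (Suc j) - dy k j = T / 2^k" for k j by (simp add: dy_def field_simps)
    define D where "D k = (\<Union>j<2^k. {\<omega>\<in>space M. (9/10)^k < norm (Y i (dy k (Suc j)) \<omega> - Y i (dy k j) \<omega>)})" for k :: nat
    have YD: "(\<lambda>\<omega>. Y i (dy k (Suc j)) \<omega> - Y i (dy k j) \<omega>) \<in> borel_measurable M" if "j < 2^k" for k j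
      using that by (intro borel_measurable_diff Y dy) auto
    have Dsets: "D k \<in> sets M" for k
      unfolding D_def
    proof (intro sets.finite_UN)
      fix j :: nat assume "j \<in> {..<2^k}"
      then have [measurable]: "(\<lambda>\<omega>. Y i (dy k (Suc j)) \<omega> - Y i (dy k j) \<omega>) \<in> borel_measurable M" by (intro YD) simp
      show "{\<omega>\<in>space M. (9/10)^k < norm (Y i (dy k (Suc j)) \<omega> - Y i (dy k j) \<omega>)} \<in> sets M" by measurable
    qed simp
    have Dprob: "measure M (D k) \<le> C * T\<^sup>2 * q ^ k" for k
    proof -
      have "measure M (D k) \<le> (\<Sum>j<2^k. measure M {\<omega>\<in>space M. (9/10)^k < norm (Y i (dy k (Suc j)) \<omega> - Y i (dy k j) \<omega>)})"
        unfolding D_def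
      proof (intro M.finite_measure_subadditive_finite)
        show "(\<lambda>j. {\<omega>\<in>space M. (9/10)^k < norm (Y i (dy k (Suc j)) \<omega> - Y i (dy k j) \<omega>)}) ` {..<2^k} \<subseteq> sets M"
        proof (intro image_subsetI)
          fix j :: nat assume "j \<in> {..<2^k}"
          then have [measurable]: "(\<lambda>\<omega>. Y i (dy k (Suc j)) \<omega> - Y i (dy k j) \<omega>) \<in> borel_measurable M" by (intro YD) simp
          show "{\<omega>\<in>space M. (9/10)^k < norm (Y i (dy k (Suc j)) \<omega> - Y i (dy k j) \<omega>)} \<in> sets M" by measurable
        qed
      qed simp
      also have "\<dots> \<le> (\<Sum>j<(2::nat)^k. C * (T / 2^k)\<^sup>2 / ((9/10)^k)^4)"
      proof (intro sum_mono)
        fix j :: nat assume j: "j \<in> {..<2^k}"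
        have le: "dy k j \<le> dy k (Suc j)" using dy_step[of k j] T by (smt (verit) divide_nonneg_pos zero_less_power)
        have in_T: "dy k j \<in> {0..T}" "dy k (Suc j) \<in> {0..T}" using j by (auto intro!: dy simp del: atLeastAtMost_iff)
        have "measure M {\<omega>\<in>space M. (9/10)^k < norm (Y i (dy k (Suc j)) \<omega> - Y i (dy k j) \<omega>)}
          \<le> (\<integral>\<omega>. norm (Y i (dy k (Suc j)) \<omega> - Y i (dy k j) \<omega>) ^ 4 \<partial>M) / ((9/10)^k)^4"
          using le in_T j by (intro M.fourth_moment_tail YD moment_int) auto
        also have "\<dots> \<le> C * (T / 2^k)\<^sup>2 / ((9/10)^k)^4"
          using moment[of "dy k j" "dy k (Suc j)" i] le in_T dy_step[of k j] by (intro divide_right_mono) auto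
        finally show "measure M {\<omega>\<in>space M. (9/10)^k < norm (Y i (dy k (Suc j)) \<omega> - Y i (dy k j) \<omega>)}
           \<le> C * (T / 2^k)\<^sup>2 / ((9/10)^k)^4" .
      qed
      also have "\<dots> = C * T\<^sup>2 * (2^k / ((2^k)\<^sup>2 * ((9/10)^k)^4))" by (simp add: power_divide)
      also have "2^k / ((2^k)\<^sup>2 * ((9/10::real)^k)^4) = q ^ k"
      proof -
        have "((9/10::real)^k)^4 = (6561/10000)^k"
          by (simp add: power_mult[symmetric] mult.commute[of k 4]) (simp add: power_mult power_divide)
        moreover have "2^k / ((2^k)\<^sup>2 * c^k) = (1 / (2 * c))^k" for c :: real
          by (simp add: power2_eq_square power_divide power_mult_distrib)
        from this[of "6561/10000"] have "2^k / ((2^k)\<^sup>2 * (6561/10000::real)^k) = q ^ k" by (simp add: q_def)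
        ultimately show ?thesis by simp
      qed
      finally show ?thesis .
    qed
    define E where "E = (\<Union>k. D (n + k))"
    have [measurable]: "E \<in> sets M" unfolding E_def using Dsets by auto
    have E_prob: "measure M E \<le> C * T\<^sup>2 * q ^ n * (1 / (1 - q))"
    proof -
      have geo: "(\<lambda>k. C * T\<^sup>2 * q ^ (n + k)) sums (C * T\<^sup>2 * q ^ n * (1 / (1 - q)))"
        unfolding power_add mult.assoc[symmetric] using q by (intro sums_mult geometric_sums) auto
      have summ: "summable (\<lambda>k. measure M (D (n + k)))"
        by (rule summable_comparison_test'[OF sums_summable[OF geo], where N=0]) (use Dprob in auto)
      have "measure M E \<le> (\<Sum>k. measure M (D (n + k)))"
        unfolding E_def using Dsets by (intro M.finite_measure_subadditive_countably summ) auto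
      also have "\<dots> \<le> (\<Sum>k. C * T\<^sup>2 * q ^ (n + k))"
        by (intro suminf_le summ sums_summable[OF geo] Dprob)
      also have "\<dots> = C * T\<^sup>2 * q ^ n * (1 / (1 - q))" using geo by (simp add: sums_iff)
      finally show ?thesis .
    qed
    have intf: "integrable M (\<lambda>\<omega>. f (?Y i \<omega>))"
      by (rule M.integrable_const_bound[where B=B, OF AE_I2 fY]) (simp add: B restrict_mem_cpath[OF Y_cont])
    have intG: "integrable M (\<lambda>\<omega>. G (2^n) (\<lambda>k. Y i (grid T (2^n) k) \<omega>))"
      by (rule M.integrable_const_bound[where B=B, OF AE_I2 GY]) (simp add: G_B)
    have "norm (\<integral>\<omega>. f (?Y i \<omega>) - G (2^n) (\<lambda>k. Y i (grid T (2^n) k) \<omega>) \<partial>M)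
        \<le> (\<integral>\<omega>. 11 * L * (9/10)^n + 2 * B * indicator E \<omega> \<partial>M)"
    proof (rule norm_integral_le)
      show "integrable M (\<lambda>\<omega>. f (?Y i \<omega>) - G (2^n) (\<lambda>k. Y i (grid T (2^n) k) \<omega>))"
        using intf intG by (rule Bochner_Integration.integrable_diff)
      show "integrable M (\<lambda>\<omega>. 11 * L * (9/10)^n + 2 * B * indicator E \<omega>)"
        by (intro Bochner_Integration.integrable_add integrable_mult_right integrable_real_indicator) (auto simp: M.emeasure_eq_measure)
      fix \<omega> assume \<omega>: "\<omega> \<in> space M"
      note mem = restrict_mem_cpath[OF Y_cont[OF \<omega>], of i]
      show "norm (f (?Y i \<omega>) - G (2^n) (\<lambda>k. Y i (grid T (2^n) k) \<omega>)) \<le> 11 * L * (9/10)^n + 2 * B * indicator E \<omega>"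
      proof (cases "\<omega> \<in> E")
        case True
        have "0 \<le> 11 * L * (9/10)^n" using L0 by simp
        then show ?thesis
          using True B[OF mem] G_B[of "2^n" "\<lambda>k. Y i (grid T (2^n) k) \<omega>"] by simp
      next
        case False
        have inc: "norm (Y i (T * real (Suc j) / 2^k) \<omega> - Y i (T * real j / 2^k) \<omega>) \<le> (9/10)^k" if k: "n \<le> k" "j < 2^k" for k j
        proof (rule ccontr)
          assume "\<not> ?thesis"
          then have "\<omega> \<in> D k" using \<omega> k(2) unfolding D_def dy_def not_le by blast
          then have "\<omega> \<in> E" unfolding E_def using k(1) le_Suc_ex by blast
          with False show False ..
        qed
        have "mdist (cpath T) (?Y i \<omega>) (interp T (2^n) (\<lambda>k. Y i (grid T (2^n) k) \<omega>)) \<le> 10 * (9/10)^n + (9/10)^n"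
        proof (rule mdist_cpath_le)
          fix t assume t: "t \<in> {0..T}"
          have "dist (interp T (2^n) (\<lambda>k. Y i (grid T (2^n) k) \<omega>) t) (Y i t \<omega>) \<le> 10 * (9/10)^n + (9/10)^n"
          proof (rule interp_grid_close[OF T _ t, where f="\<lambda>t. Y i t \<omega>"])
            fix k :: nat assume k: "k < 2^n"
            then show "norm (Y i (T * real (Suc k) / real (2^n)) \<omega> - Y i (T * real k / real (2^n)) \<omega>) \<le> (9/10)^n"
              using inc[of n k] by simp
            assume "t < T" "k = nat \<lfloor>real (2^n) * t / T\<rfloor>"
            then show "norm (Y i (T * real k / real (2^n)) \<omega> - Y i t \<omega>) \<le> 10 * (9/10)^n"
              using dyadic_chaining[OF T Y_cont[OF \<omega>], of t n i] inc t by simp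
          qed auto
          then show "dist (?Y i \<omega> t) (interp T (2^n) (\<lambda>k. Y i (grid T (2^n) k) \<omega>) t) \<le> 10 * (9/10)^n + (9/10)^n"
            using t by (simp add: dist_commute)
        qed simp
        then have "L * mdist (cpath T) (?Y i \<omega>) (interp T (2^n) (\<lambda>k. Y i (grid T (2^n) k) \<omega>)) \<le> L * (10 * (9/10)^n + (9/10)^n)"
          using L0 by (rule mult_left_mono)
        then have "norm (f (?Y i \<omega>) - G (2^n) (\<lambda>k. Y i (grid T (2^n) k) \<omega>)) \<le> L * (10 * (9/10)^n + (9/10)^n)"
          unfolding G_def real_norm_def using L[OF mem interp_mem_cpath[OF T]] by (rule order_trans[rotated])
        also have "\<dots> = 11 * L * (9/10)^n" by (simp add: algebra_simps)
        finally show ?thesis using False by simp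
      qed
    qed
    also have "\<dots> = 11 * L * (9/10)^n + 2 * B * measure M E"
      by (subst Bochner_Integration.integral_add) (auto simp: M.emeasure_eq_measure M.prob_space)
    also have "\<dots> \<le> err n" unfolding err_def using E_prob B0 by (intro add_left_mono mult_left_mono) auto
    finally show ?thesis using intf intG by simp
  qed
  have lim_W: "(\<lambda>n. \<integral>\<omega>. G n (\<lambda>k. W (grid T n k) \<omega>) \<partial>N) \<longlonglongrightarrow> (\<integral>\<omega>. f (?W \<omega>) \<partial>N)"
  proof (rule integral_dominated_convergence[where w="\<lambda>_. B"])
    show "AE \<omega> in N. (\<lambda>n. G n (\<lambda>k. W (grid T n k) \<omega>)) \<longlonglongrightarrow> f (?W \<omega>)"
      unfolding G_def by (intro AE_I2 Lipschitz_interp_grid_tendsto[OF T W_cont L0 L])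
  qed (use fW GW G_B in auto)
  \<comment> \<open>Only dyadic meshes carry an error bound, so the limit is taken along powers of
    two.\<close>
  then have "(\<lambda>n. \<integral>\<omega>. G (2^n) (\<lambda>k. W (grid T (2^n) k) \<omega>) \<partial>N) \<longlonglongrightarrow> (\<integral>\<omega>. f (?W \<omega>) \<partial>N)"
    by (rule LIMSEQ_subseq_LIMSEQ[unfolded comp_def, where f="\<lambda>n. 2^n"]) (simp add: strict_mono_def)
  note lim_W = this
  have "((\<lambda>i. \<integral>\<omega>. f (?Y i \<omega>) \<partial>M) \<longlongrightarrow> (\<integral>\<omega>. f (?W \<omega>) \<partial>N)) F"
  proof (rule tendsto_approx)
    fix e :: real assume e: "0 < e"
    have "\<forall>\<^sub>F n in sequentially. err n < e" using err_lim e by (intro order_tendstoD) auto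
    moreover have "\<forall>\<^sub>F n in sequentially. dist (\<integral>\<omega>. G (2^n) (\<lambda>k. W (grid T (2^n) k) \<omega>) \<partial>N) (\<integral>\<omega>. f (?W \<omega>) \<partial>N) < e"
      using lim_W e by (rule tendstoD)
    ultimately have "\<forall>\<^sub>F n in sequentially. err n < e \<and> dist (\<integral>\<omega>. G (2^n) (\<lambda>k. W (grid T (2^n) k) \<omega>) \<partial>N) (\<integral>\<omega>. f (?W \<omega>) \<partial>N) < e"
      by eventually_elim blast
    then obtain n where n: "err n < e" "dist (\<integral>\<omega>. G (2^n) (\<lambda>k. W (grid T (2^n) k) \<omega>) \<partial>N) (\<integral>\<omega>. f (?W \<omega>) \<partial>N) < e"
      using eventually_happens'[OF sequentially_bot] by blast
    show "\<exists>a' b'. (a' \<longlongrightarrow> b') F \<and> (\<forall>\<^sub>F i in F. norm ((\<integral>\<omega>. f (?Y i \<omega>) \<partial>M) - a' i) \<le> e)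
        \<and> norm (b' - (\<integral>\<omega>. f (?W \<omega>) \<partial>N)) \<le> e"
      by (intro exI conjI always_eventually allI) (rule lim_G[of "2^n"], rule order_trans[OF err], use n in \<open>auto simp: dist_norm\<close>)
  qed
  then show "((\<lambda>i. \<integral>w. f w \<partial>distr M ?B (?Y i)) \<longlongrightarrow> (\<integral>w. f w \<partial>distr N ?B ?W)) F"
    by (simp add: integral_distr[OF mY f] integral_distr[OF mW f])
qed

subsection \<open>Characteristic functions along a filtration\<close>

text \<open>The form needed for the Lindeberg argument: for each tolerance a new error family
  \<open>r\<close>, belonging to a new partition.\<close>

lemma tendsto_0_approx:
  fixes a :: "'i \<Rightarrow> 'b::real_normed_vector"
  assumes "\<And>e. 0 < e \<Longrightarrow> \<exists>r. (r \<longlongrightarrow> 0) F \<and> (\<forall>i. norm (a i) \<le> r i + e)"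
  shows "(a \<longlongrightarrow> 0) F"
proof (rule tendstoI)
  fix e :: real assume "0 < e"
  then obtain r where r: "(r \<longlongrightarrow> 0) F" "\<And>i. norm (a i) \<le> r i + e/2" using assms[of "e/2"] by auto
  have "\<forall>\<^sub>F i in F. r i < e/2" using order_tendstoD(2)[OF r(1), of "e/2"] \<open>0 < e\<close> by simp
  then show "\<forall>\<^sub>F i in F. dist (a i) 0 < e"
  proof eventually_elim
    case (elim i)
    then show ?case using r(2)[of i] by simp
  qed
qed

text \<open>An abstract past: \<open>test s\<close> collects the bounded multipliers allowed at time
  s, and closure under \<open>test_step\<close> lets the exponential of an increment be absorbed
  into the multiplier. It is instantiated by functionals adapted to a filtration for Brownian
  motion, and by functionals that satisfy a factorization of expectations for the oscillatory
  integrals.\<close>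

locale test_process = prob_space M for M :: "'a measure" +
  fixes test :: "real \<Rightarrow> ('a \<Rightarrow> complex) set" and Y :: "real \<Rightarrow> 'a \<Rightarrow> 'e::euclidean_space" and T :: real
  assumes test_measurable: "\<And>s V. 0 \<le> s \<Longrightarrow> s \<le> T \<Longrightarrow> V \<in> test s \<Longrightarrow> V \<in> borel_measurable M"
    and test_bound: "\<And>s V \<omega>. 0 \<le> s \<Longrightarrow> s \<le> T \<Longrightarrow> V \<in> test s \<Longrightarrow> \<omega> \<in> space M \<Longrightarrow> cmod (V \<omega>) \<le> 1"
    and test_one: "\<And>s. 0 \<le> s \<Longrightarrow> s \<le> T \<Longrightarrow> (\<lambda>_. 1) \<in> test s"
    and test_step: "\<And>s t V l. 0 \<le> s \<Longrightarrow> s \<le> t \<Longrightarrow> t \<le> T \<Longrightarrow> V \<in> test s \<Longrightarrow>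
      (\<lambda>\<omega>. V \<omega> * iexp (l \<bullet> (Y t \<omega> - Y s \<omega>))) \<in> test t"
begin

lemma test_integrable:
  assumes "0 \<le> s" "s \<le> T" "V \<in> test s" shows "integrable M V"
  using assms by (intro integrable_const_bound[where B=1] test_measurable[of s] AE_I2 test_bound[of s])

lemma cmod_expectation_test: 
  assumes "0 \<le> s" "s \<le> T" "V \<in> test s" shows "cmod (expectation V) \<le> 1"
proof -
  have "cmod (expectation V) \<le> (\<integral>\<omega>. 1 \<partial>M)"
    using assms by (intro norm_integral_le test_integrable[of s] test_bound[of s]) auto
  then show ?thesis by (simp add: prob_space)
qed

text \<open>The factors of the increments are replaced by \<open>q\<close> one at a time. The bound
  \<open>\<bar>q\<bar> \<le> 1\<close> prevents earlier errors from being amplified.\<close>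

lemma char_telescope:
  assumes s: "0 \<le> s" "0 \<le> \<delta>" "s + real n * \<delta> \<le> T" and V: "V \<in> test s" and q: "\<bar>q\<bar> \<le> 1"
    and step: "\<And>k V. k < n \<Longrightarrow> V \<in> test (s + real k * \<delta>) \<Longrightarrow>
       cmod (expectation (\<lambda>\<omega>. V \<omega> * iexp (l \<bullet> (Y (s + real (Suc k) * \<delta>) \<omega> - Y (s + real k * \<delta>) \<omega>))) - expectation V * of_real q) \<le> r k"
  shows "cmod (expectation (\<lambda>\<omega>. V \<omega> * iexp (l \<bullet> (Y (s + real n * \<delta>) \<omega> - Y s \<omega>))) - expectation V * of_real (q ^ n)) \<le> (\<Sum>k<n. r k)"
proof -
  have "cmod (expectation (\<lambda>\<omega>. V \<omega> * iexp (l \<bullet> (Y (s + real k * \<delta>) \<omega> - Y s \<omega>))) - expectation V * of_real (q ^ k)) \<le> (\<Sum>j<k. r j)"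
    if "k \<le> n" for k
    using that
  proof (induction k)
    case (Suc k)
    let ?t = "s + real k * \<delta>" and ?u = "s + real (Suc k) * \<delta>"
    define V' where "V' \<omega> = V \<omega> * iexp (l \<bullet> (Y ?t \<omega> - Y s \<omega>))" for \<omega>
    have "real k * \<delta> \<le> real n * \<delta>" using Suc.prems s by (intro mult_right_mono) auto
    then have V': "V' \<in> test ?t"
      unfolding V'_def using s by (intro test_step V) auto
    have "expectation (\<lambda>\<omega>. V \<omega> * iexp (l \<bullet> (Y ?u \<omega> - Y s \<omega>))) = expectation (\<lambda>\<omega>. V' \<omega> * iexp (l \<bullet> (Y ?u \<omega> - Y ?t \<omega>)))"
      by (intro Bochner_Integration.integral_cong) (auto simp: V'_def exp_add[symmetric] inner_diff_right algebra_simps)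
    then have "expectation (\<lambda>\<omega>. V \<omega> * iexp (l \<bullet> (Y ?u \<omega> - Y s \<omega>))) - expectation V * of_real (q ^ Suc k) =
       (expectation (\<lambda>\<omega>. V' \<omega> * iexp (l \<bullet> (Y ?u \<omega> - Y ?t \<omega>))) - expectation V' * of_real q)
       + of_real q * (expectation V' - expectation V * of_real (q ^ k))"
      by (simp add: algebra_simps)
    also have "cmod \<dots> \<le> r k + 1 * (\<Sum>j<k. r j)"
    proof (intro order_trans[OF norm_triangle_ineq] add_mono)
      show "cmod (expectation (\<lambda>\<omega>. V' \<omega> * iexp (l \<bullet> (Y ?u \<omega> - Y ?t \<omega>))) - expectation V' * of_real q) \<le> r k"
        using Suc.prems by (intro step V') auto
      show "cmod (of_real q * (expectation V' - expectation V * of_real (q ^ k))) \<le> 1 * (\<Sum>j<k. r j)"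
        unfolding norm_mult using Suc q unfolding V'_def[abs_def] by (intro mult_mono) auto
    qed
    finally show ?case by simp
  qed simp
  then show ?thesis by simp
qed

end

text \<open>For increasing \<open>t\<close> with \<open>t 0 = 0\<close>, half the variance of the
  sum of \<open>l k \<bullet> B (t k)\<close> for a Brownian motion B. The recursion moves the last
  frequency onto the last increment and adds it to the frequency before.\<close>

primrec gauss_exponent :: "(nat \<Rightarrow> real) \<Rightarrow> (nat \<Rightarrow> 'e::real_inner) \<Rightarrow> nat \<Rightarrow> real" where
  "gauss_exponent t l 0 = 0"
| "gauss_exponent t l (Suc n) =
     gauss_exponent t (\<lambda>k. if k = n then l n + l (Suc n) else l k) n + (t (Suc n) - t n) * (norm (l (Suc n)))\<^sup>2 / 2"

locale test_family =
  fixes M :: "'a measure" and test :: "'i \<Rightarrow> real \<Rightarrow> ('a \<Rightarrow> complex) set" and Y :: "'i \<Rightarrow> real \<Rightarrow> 'a \<Rightarrow> 'e::euclidean_space" 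
    and T :: real and F :: "'i filter"
  assumes fp: "\<And>i. test_process M (test i) (Y i) T"
begin

text \<open>With n equal steps of length \<delta> = D / n, the local errors add up to n * C *
  \<delta>^(3/2) = C * D^(3/2) / sqrt n plus finitely many null families, while the product (1 +
  x/n)^n tends to exp x. The number n is chosen first, so the null families need no uniformity in
  the times.\<close>

lemma char_increment_limit:
  assumes st: "0 \<le> s" "s < t" "t \<le> T"
    and loc: "\<And>s t. 0 \<le> s \<Longrightarrow> s < t \<Longrightarrow> t \<le> T \<Longrightarrow> \<exists>\<rho>. (\<rho> \<longlongrightarrow> 0) F \<and>
      (\<forall>i. \<forall>V\<in>test i s.
        cmod ((\<integral>\<omega>. V \<omega> * iexp (l \<bullet> (Y i t \<omega> - Y i s \<omega>)) \<partial>M) - (\<integral>\<omega>. V \<omega> \<partial>M) * of_real (1 - (norm l)\<^sup>2 * (t - s) / 2))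
        \<le> \<rho> i + C * ((t - s) * sqrt (t - s)))"
    and V: "\<And>i. V i \<in> test i s"
  shows "((\<lambda>i. (\<integral>\<omega>. V i \<omega> * iexp (l \<bullet> (Y i t \<omega> - Y i s \<omega>)) \<partial>M) -
      (\<integral>\<omega>. V i \<omega> \<partial>M) * of_real (exp (- ((norm l)\<^sup>2 * (t - s) / 2)))) \<longlongrightarrow> 0) F"
proof (rule tendsto_0_approx)
  fix e :: real assume e: "0 < e"
  define x where "x = - ((norm l)\<^sup>2 * (t - s) / 2)"
  define D where "D = t - s"
  have D: "0 < D" using st by (simp add: D_def)
  have l1: "(\<lambda>n. (1 + x / real n) ^ n) \<longlonglongrightarrow> exp x" by (rule tendsto_exp_limit_sequentially)
  have l2: "(\<lambda>n. C * (D * (sqrt D / sqrt (real n)))) \<longlonglongrightarrow> C * (D * 0)"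
    by (intro tendsto_intros tendsto_divide_0[OF tendsto_const] filterlim_at_top_imp_at_infinity
          filterlim_compose[OF sqrt_at_top filterlim_real_sequentially])
  have l3: "(\<lambda>n. x / real n) \<longlonglongrightarrow> 0" by (rule lim_const_over_n)
  have "\<forall>\<^sub>F n in sequentially. \<bar>(1 + x / real n) ^ n - exp x\<bar> < e/2"
    using tendstoD[OF l1, of "e/2"] e by (simp add: dist_real_def)
  moreover have "\<forall>\<^sub>F n in sequentially. C * (D * (sqrt D / sqrt (real n))) < e/2"
    using order_tendstoD(2)[OF l2, of "e/2"] e by simp
  \<comment> \<open>Together with \<open>x \<le> 0\<close> this puts
    \<open>q = 1 + x / real n\<close> into [0, 1], as the telescoping requires.\<close>
  moreover have "\<forall>\<^sub>F n in sequentially. -1 < x / real n"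
    using order_tendstoD(1)[OF l3, of "-1"] by simp
  ultimately have "\<forall>\<^sub>F n in sequentially. \<bar>(1 + x / real n) ^ n - exp x\<bar> < e/2 \<and>
      C * (D * (sqrt D / sqrt (real n))) < e/2 \<and> -1 < x / real n \<and> 0 < n"
    using eventually_gt_at_top[of 0] by eventually_elim simp
  then obtain n :: nat where n: "\<bar>(1 + x / real n) ^ n - exp x\<bar> < e/2" "C * (D * (sqrt D / sqrt (real n))) < e/2"
     "-1 < x / real n" "0 < n"
    using eventually_happens'[OF sequentially_bot] by blast
  define \<delta> where "\<delta> = D / real n"
  have \<delta>: "0 < \<delta>" "real n * \<delta> = D" using D n by (auto simp: \<delta>_def)
  define q where "q = 1 + x / real n"
  have x0: "x \<le> 0" using st by (simp add: x_def)
  have q: "\<bar>q\<bar> \<le> 1" using n(3) x0 n(4) by (auto simp: q_def abs_le_iff divide_le_0_iff)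
  have q_eq: "q = 1 - (norm l)\<^sup>2 * \<delta> / 2" by (simp add: q_def x_def \<delta>_def D_def)
  have sk: "s + real k * \<delta> \<le> t" if "k \<le> n" for k
  proof -
    have "real k * \<delta> \<le> real n * \<delta>" using that \<delta> by (intro mult_right_mono) auto
    then show ?thesis using \<delta> by (simp add: D_def)
  qed
  define P where "P k \<rho> \<longleftrightarrow> (\<rho> \<longlongrightarrow> 0) F \<and>
      (\<forall>i. \<forall>V\<in>test i (s + real k * \<delta>).
        cmod ((\<integral>\<omega>. V \<omega> * iexp (l \<bullet> (Y i (s + real (Suc k) * \<delta>) \<omega> - Y i (s + real k * \<delta>) \<omega>)) \<partial>M) - (\<integral>\<omega>. V \<omega> \<partial>M) * of_real q)
        \<le> \<rho> i + C * (\<delta> * sqrt \<delta>))" for k \<rho>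
  have "\<exists>\<rho>. k < n \<longrightarrow> P k \<rho>" for k
  proof (cases "k < n")
    case True
    have d: "s + real (Suc k) * \<delta> - (s + real k * \<delta>) = \<delta>" by (simp add: algebra_simps)
    have "\<exists>\<rho>. P k \<rho>"
      unfolding P_def q_eq using loc[of "s + real k * \<delta>" "s + real (Suc k) * \<delta>", unfolded d] sk[of "Suc k"] True st \<delta> d
      by simp
    then show ?thesis by blast
  qed simp
  then obtain \<rho> where P: "\<And>k. k < n \<Longrightarrow> P k (\<rho> k)" by metis
  have \<rho>: "\<And>k. k < n \<Longrightarrow> (\<rho> k \<longlongrightarrow> 0) F"
    "\<And>k i V. k < n \<Longrightarrow> V \<in> test i (s + real k * \<delta>) \<Longrightarrow>
        cmod ((\<integral>\<omega>. V \<omega> * iexp (l \<bullet> (Y i (s + real (Suc k) * \<delta>) \<omega> - Y i (s + real k * \<delta>) \<omega>)) \<partial>M) - (\<integral>\<omega>. V \<omega> \<partial>M) * of_real q)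
        \<le> \<rho> k i + C * (\<delta> * sqrt \<delta>)"
    using P unfolding P_def by blast+
  show "\<exists>r. (r \<longlongrightarrow> 0) F \<and> (\<forall>i. norm ((\<integral>\<omega>. V i \<omega> * iexp (l \<bullet> (Y i t \<omega> - Y i s \<omega>)) \<partial>M) -
      (\<integral>\<omega>. V i \<omega> \<partial>M) * of_real (exp (- ((norm l)\<^sup>2 * (t - s) / 2)))) \<le> r i + e)"
  proof (intro exI conjI allI)
    show "((\<lambda>i. \<Sum>k<n. \<rho> k i) \<longlongrightarrow> 0) F" by (rule tendsto_null_sum) (use \<rho>(1) in auto)
    fix i
    interpret test_process M "test i" "Y i" T by (rule fp)
    have tn: "s + real n * \<delta> = t" using \<delta> by (simp add: D_def)
    have "cmod (expectation (\<lambda>\<omega>. V i \<omega> * iexp (l \<bullet> (Y i t \<omega> - Y i s \<omega>))) - expectation (V i) * of_real (q ^ n))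
        \<le> (\<Sum>k<n. \<rho> k i + C * (\<delta> * sqrt \<delta>))"
      by (rule char_telescope[where n=n and s=s and \<delta>=\<delta>, unfolded tn, OF st(1) less_imp_le[OF \<delta>(1)] st(3) V q]) (rule \<rho>(2))
    also have "\<dots> = (\<Sum>k<n. \<rho> k i) + real n * (C * (\<delta> * sqrt \<delta>))" by (simp add: sum.distrib)
    also have "real n * (C * (\<delta> * sqrt \<delta>)) = C * (D * (sqrt D / sqrt (real n)))"
      using \<delta>(2) by (simp add: \<delta>_def real_sqrt_divide)
    finally have 1: "cmod (expectation (\<lambda>\<omega>. V i \<omega> * iexp (l \<bullet> (Y i t \<omega> - Y i s \<omega>))) - expectation (V i) * of_real (q ^ n))
        \<le> (\<Sum>k<n. \<rho> k i) + e/2" using n(2) by linarith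
    have "cmod (expectation (V i) * of_real (q ^ n) - expectation (V i) * of_real (exp x)) = cmod (expectation (V i)) * \<bar>q ^ n - exp x\<bar>"
      unfolding right_diff_distrib[symmetric] norm_mult of_real_diff[symmetric] norm_of_real ..
    also have "\<dots> \<le> 1 * (e/2)"
      using n(1) st by (intro mult_mono cmod_expectation_test[OF _ _ V]) (auto simp: q_def)
    finally have 2: "cmod (expectation (V i) * of_real (q ^ n) - expectation (V i) * of_real (exp x)) \<le> e/2" by simp
    show "norm (expectation (\<lambda>\<omega>. V i \<omega> * iexp (l \<bullet> (Y i t \<omega> - Y i s \<omega>))) -
      expectation (V i) * of_real (exp (- ((norm l)\<^sup>2 * (t - s) / 2)))) \<le> (\<Sum>k<n. \<rho> k i) + e"
      using norm_triangle_ineq[of "expectation (\<lambda>\<omega>. V i \<omega> * iexp (l \<bullet> (Y i t \<omega> - Y i s \<omega>))) - expectation (V i) * of_real (q ^ n)"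
         "expectation (V i) * of_real (q ^ n) - expectation (V i) * of_real (exp x)"] 1 2
      unfolding x_def by simp
  qed
qed

text \<open>Summation by parts on the last term, in the pattern of the recursion of
  \<open>gauss_exponent\<close>.\<close>

lemma iexp_sum_split:
  "iexp (\<Sum>k\<le>Suc n. l k \<bullet> y k) =
    iexp (\<Sum>k\<le>n. (if k = n then l n + l (Suc n) else l k) \<bullet> y k) * iexp (l (Suc n) \<bullet> (y (Suc n) - y n :: 'e))"
proof -
  have "(\<Sum>k\<le>n. (if k = n then l n + l (Suc n) else l k) \<bullet> y k) = (\<Sum>k\<le>n. l k \<bullet> y k + (if k = n then l (Suc n) \<bullet> y n else 0))"
    by (intro sum.cong) (auto simp: inner_add_left)
  also have "\<dots> = (\<Sum>k\<le>n. l k \<bullet> y k) + l (Suc n) \<bullet> y n" by (simp add: sum.distrib)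
  finally have "(\<Sum>k\<le>Suc n. l k \<bullet> y k) =
      (\<Sum>k\<le>n. (if k = n then l n + l (Suc n) else l k) \<bullet> y k) + l (Suc n) \<bullet> (y (Suc n) - y n)"
    by (simp add: inner_diff_right)
  then show ?thesis by (simp only: of_real_add distrib_left exp_add)
qed

lemma iexp_sum_in_test:
  assumes Y0: "\<And>i \<omega>. Y i 0 \<omega> = 0" and t: "incseq t" "t 0 = 0" "\<And>k. t k \<in> {0..T}"
  shows "(\<lambda>\<omega>. iexp (\<Sum>k\<le>n. l k \<bullet> Y i (t k) \<omega>)) \<in> test i (t n)"
proof -
  interpret test_process M "test i" "Y i" T by (rule fp)
  show ?thesis
  proof (induction n arbitrary: l)
    case 0
    then show ?case using test_one[of 0] t(3)[of 0] by (simp add: t(2) Y0)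
  next
    case (Suc n)
    have "t n \<le> t (Suc n)" using t(1) by (simp add: incseqD)
    then show ?case unfolding iexp_sum_split using t(3)[of n] t(3)[of "Suc n"] by (intro test_step Suc) auto
  qed
qed

text \<open>Induction on the number of times: all but the last increment form a multiplier from
  \<open>test\<close>, and the last increment contributes its Gaussian factor in the limit.
  Coinciding times contribute the factor 1.\<close>

lemma fdd_char_limit:
  assumes Y0: "\<And>i \<omega>. Y i 0 \<omega> = 0"
    and inc: "\<And>s t l V. 0 \<le> s \<Longrightarrow> s < t \<Longrightarrow> t \<le> T \<Longrightarrow> (\<And>i. V i \<in> test i s) \<Longrightarrow>
      ((\<lambda>i. (\<integral>\<omega>. V i \<omega> * iexp (l \<bullet> (Y i t \<omega> - Y i s \<omega>)) \<partial>M) -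
        (\<integral>\<omega>. V i \<omega> \<partial>M) * of_real (exp (- ((norm l)\<^sup>2 * (t - s) / 2)))) \<longlongrightarrow> 0) F"
    and t: "incseq t" "t 0 = 0" "\<And>k. t k \<in> {0..T}"
  shows "((\<lambda>i. \<integral>\<omega>. iexp (\<Sum>k\<le>n. l k \<bullet> Y i (t k) \<omega>) \<partial>M) \<longlongrightarrow> of_real (exp (- gauss_exponent t l n))) F"
proof (induction n arbitrary: l)
  case 0
  have "(\<integral>\<omega>. iexp (\<Sum>k\<le>0. l k \<bullet> Y i (t k) \<omega>) \<partial>M) = 1" for i
  proof -
    interpret test_process M "test i" "Y i" T by (rule fp)
    have "(\<integral>\<omega>. iexp (\<Sum>k\<le>0. l k \<bullet> Y i (t k) \<omega>) \<partial>M) = (\<integral>\<omega>. 1 \<partial>M)"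
      by (intro Bochner_Integration.integral_cong) (simp_all add: t Y0)
    then show ?thesis by (simp add: prob_space)
  qed
  then show ?case by simp
next
  case (Suc n)
  define l' where "l' k = (if k = n then l n + l (Suc n) else l k)" for k
  define V where "V i \<omega> = iexp (\<Sum>k\<le>n. l' k \<bullet> Y i (t k) \<omega>)" for i \<omega>
  have split: "iexp (\<Sum>k\<le>Suc n. l k \<bullet> Y i (t k) \<omega>) = V i \<omega> * iexp (l (Suc n) \<bullet> (Y i (t (Suc n)) \<omega> - Y i (t n) \<omega>))" for i \<omega>
    unfolding V_def l'_def by (rule iexp_sum_split)
  have V: "V i \<in> test i (t n)" for i
    unfolding V_def[abs_def] by (rule iexp_sum_in_test[OF Y0 t])
  let ?c = "complex_of_real (exp (- ((norm (l (Suc n)))\<^sup>2 * (t (Suc n) - t n) / 2)))"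
  have "((\<lambda>i. (\<integral>\<omega>. V i \<omega> * iexp (l (Suc n) \<bullet> (Y i (t (Suc n)) \<omega> - Y i (t n) \<omega>)) \<partial>M) - (\<integral>\<omega>. V i \<omega> \<partial>M) * ?c) \<longlongrightarrow> 0) F"
  proof (cases "t n < t (Suc n)")
    case True
    then show ?thesis using t(3)[of n] t(3)[of "Suc n"] by (intro inc V) auto
  next
    case False
    then have "t (Suc n) = t n" using incseqD[OF t(1), of n "Suc n"] by simp
    then show ?thesis by simp
  qed
  moreover have "((\<lambda>i. (\<integral>\<omega>. V i \<omega> \<partial>M) * ?c) \<longlongrightarrow> of_real (exp (- gauss_exponent t l' n)) * ?c) F"
    unfolding V_def by (intro tendsto_mult tendsto_const Suc.IH)
  ultimately have "((\<lambda>i. (\<integral>\<omega>. V i \<omega> * iexp (l (Suc n) \<bullet> (Y i (t (Suc n)) \<omega> - Y i (t n) \<omega>)) \<partial>M)) \<longlongrightarrow>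
      0 + of_real (exp (- gauss_exponent t l' n)) * ?c) F"
    using tendsto_add by fastforce
  moreover have "0 + of_real (exp (- gauss_exponent t l' n)) * ?c = complex_of_real (exp (- gauss_exponent t l (Suc n)))"
    unfolding add_0 of_real_mult[symmetric] exp_add[symmetric] by (simp add: l'_def[abs_def] mult.commute)
  ultimately show ?case unfolding split by (simp del: gauss_exponent.simps)
qed

end

subsection \<open>Natural filtration and independent increments\<close>

definition process_algebra :: "'a measure \<Rightarrow> (real \<Rightarrow> 'a \<Rightarrow> 'b::topological_space) \<Rightarrow> real set \<Rightarrow> 'a measure" where
  "process_algebra M X I = sigma (space M) {X u -` A \<inter> space M | u A. u \<in> I \<and> A \<in> sets borel}"

lemma space_process_algebra [simp]: "space (process_algebra M X I) = space M"
  by (simp add: process_algebra_def space_measure_of_conv)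

lemma sets_process_algebra: "sets (process_algebra M X I) = process_sigma M X I"
  unfolding process_algebra_def process_sigma_def by (rule sets_measure_of) auto

lemma subalgebra_process_algebra:
  assumes "\<And>u. u \<in> I \<Longrightarrow> X u \<in> borel_measurable M"
  shows "subalgebra M (process_algebra M X I)"
  unfolding subalgebra_def sets_process_algebra process_sigma_def
  using assms by (auto intro!: sets.sigma_sets_subset measurable_sets)

lemma process_algebra_mono: "I \<subseteq> J \<Longrightarrow> sets (process_algebra M X I) \<subseteq> sets (process_algebra M X J)"
  unfolding sets_process_algebra process_sigma_def by (rule sigma_sets_mono') auto

lemma measurable_process_algebra: "u \<in> I \<Longrightarrow> X u \<in> borel_measurable (process_algebra M X I)"
  unfolding process_algebra_def
  by (rule measurableI) (auto simp: space_measure_of_conv intro!: in_measure_of)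

lemma vimage_in_process_sigma:
  assumes "f \<in> measurable (process_algebra M X I) N" "A \<in> sets N"
  shows "f -` A \<inter> space M \<in> process_sigma M X I"
  using measurable_sets[OF assms] by (simp add: sets_process_algebra)

text \<open>Preimages under one function form an intersection-stable family, so independence passes
  to the generated \<sigma>-algebras. Hence \<open>A\<close> may be the bare family of preimages
  occurring in \<open>independent_increments\<close>.\<close>

lemma (in prob_space) indep_set_integral_mult:
  fixes f g :: "'a \<Rightarrow> complex"
  assumes ind: "indep_set A B"
    and f: "integrable M f" "\<And>S. S \<in> sets borel \<Longrightarrow> f -` S \<inter> space M \<in> A"
    and g: "integrable M g" "\<And>S. S \<in> sets borel \<Longrightarrow> g -` S \<inter> space M \<in> B"
  shows "expectation (\<lambda>\<omega>. f \<omega> * g \<omega>) = expectation f * expectation g"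
proof (rule indep_var_lebesgue_integral[OF _ f(1) g(1)])
  have "indep_set {f -` S \<inter> space M | S. S \<in> sets borel} {g -` S \<inter> space M | S. S \<in> sets borel}"
    using ind f(2) g(2) unfolding indep_sets2_eq by blast
  moreover have "Int_stable {h -` S \<inter> space M | S. S \<in> sets borel}" for h :: "'a \<Rightarrow> complex"
  proof (rule Int_stableI)
    fix a b assume "a \<in> {h -` S \<inter> space M | S. S \<in> sets borel}" "b \<in> {h -` S \<inter> space M | S. S \<in> sets borel}"
    then obtain S R where "S \<in> sets borel" "R \<in> sets borel" "a = h -` S \<inter> space M" "b = h -` R \<inter> space M" by auto
    then show "a \<inter> b \<in> {h -` S \<inter> space M | S. S \<in> sets borel}" by (intro CollectI exI[of _ "S \<inter> R"]) auto
  qed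
  ultimately show "indep_var borel f borel g"
    using f(1) g(1) unfolding indep_var_eq by (auto intro: indep_set_sigma_sets)
qed

lemma char_incr_eq:
  assumes "X t \<in> borel_measurable M" "X s \<in> borel_measurable M"
  shows "char_incr M X t s u = (\<integral>\<omega>. iexp (u * (X t \<omega> - X s \<omega>)) \<partial>M)"
  unfolding char_incr_def char_def using assms by (subst integral_distr) auto

lemma (in prob_space) char_incr_same [simp]: "char_incr M X s s u = 1"
proof -
  show ?thesis unfolding char_incr_def char_def by (subst integral_distr) (simp_all add: prob_space)
qed

lemma (in prob_space) integral_mult_increment:
  fixes V :: "'a \<Rightarrow> complex"
  assumes ind: "independent_increments M X" and X: "\<And>u. 0 \<le> u \<Longrightarrow> X u \<in> borel_measurable M"
    and st: "0 \<le> s" "s \<le> t" and V: "V \<in> borel_measurable (process_algebra M X {0..s})" "integrable M V"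
  shows "expectation (\<lambda>\<omega>. V \<omega> * iexp (u * (X t \<omega> - X s \<omega>))) = expectation V * char_incr M X t s u"
proof (cases "s = t")
  case True
  then show ?thesis by simp
next
  case False
  have [measurable]: "X s \<in> borel_measurable M" "X t \<in> borel_measurable M" using X st by auto
  have "expectation (\<lambda>\<omega>. iexp (u * (X t \<omega> - X s \<omega>)) * V \<omega>) = expectation (\<lambda>\<omega>. iexp (u * (X t \<omega> - X s \<omega>))) * expectation V"
  proof (rule indep_set_integral_mult)
    show "indep_set {(\<lambda>\<omega>. X t \<omega> - X s \<omega>) -` A \<inter> space M | A. A \<in> sets borel} (process_sigma M X {0..s})"
      using ind st False unfolding independent_increments_def by auto
    show "integrable M (\<lambda>\<omega>. iexp (u * (X t \<omega> - X s \<omega>)))"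
      by (rule integrable_const_bound[where B=1]) auto
    show "(\<lambda>\<omega>. iexp (u * (X t \<omega> - X s \<omega>))) -` S \<inter> space M \<in> {(\<lambda>\<omega>. X t \<omega> - X s \<omega>) -` A \<inter> space M | A. A \<in> sets borel}"
      if "S \<in> sets borel" for S
    proof (intro CollectI exI conjI)
      have "(\<lambda>x. iexp (u * x)) \<in> borel_measurable borel" by measurable
      from measurable_sets[OF this that] show "(\<lambda>x. iexp (u * x)) -` S \<in> sets borel" by simp
    qed auto
    show "V -` S \<inter> space M \<in> process_sigma M X {0..s}" if "S \<in> sets borel" for S
      using V(1) that by (rule vimage_in_process_sigma)
  qed (rule V(2))
  then show ?thesis by (simp add: char_incr_eq mult.commute)
qed

subsection \<open>Characteristic function of Brownian motion\<close>

lemma (in prob_space) char_normal_incr: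
  assumes "distributed M lborel Z (\<lambda>x. ennreal (normal_density 0 \<sigma> x))" "0 < \<sigma>"
  shows "expectation (\<lambda>\<omega>. iexp (u * Z \<omega>)) = of_real (exp (- (\<sigma>\<^sup>2 * u\<^sup>2 / 2)))"
proof -
  have Z: "Z \<in> borel_measurable M" using assms(1) distributed_measurable by fastforce
  have "distributed M lborel (\<lambda>\<omega>. (Z \<omega> - 0) / \<sigma>) std_normal_density"
    using assms normal_standard_normal_convert[of \<sigma> Z 0] by simp
  then have d: "distr M lborel (\<lambda>\<omega>. Z \<omega> / \<sigma>) = std_normal_distribution"
    by (simp add: distributed_distr_eq_density)
  have "expectation (\<lambda>\<omega>. iexp (u * Z \<omega>)) = expectation (\<lambda>\<omega>. iexp ((u * \<sigma>) * (Z \<omega> / \<sigma>)))"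
    using assms(2) by simp
  also have "\<dots> = (\<integral>x. iexp ((u * \<sigma>) * x) \<partial>distr M lborel (\<lambda>\<omega>. Z \<omega> / \<sigma>))"
    using Z by (subst integral_distr) auto
  also have "\<dots> = char std_normal_distribution (u * \<sigma>)" unfolding d char_def ..
  also have "\<dots> = of_real (exp (- (\<sigma>\<^sup>2 * u\<^sup>2 / 2)))"
    by (simp add: char_std_normal_distribution power_mult_distrib mult.commute)
  finally show ?thesis .
qed

text \<open>The limit theorem for increments is applied to a constant sequence of processes: the
  increments have exactly Gaussian factors, and the limit of a constant sequence is an
  equality.\<close>

lemma standard_brownian_motion_char:
  fixes l :: "nat \<Rightarrow> real"
  assumes B: "standard_brownian_motion N B" and t: "incseq t" "t 0 = 0"
  shows "(\<integral>\<omega>. iexp (\<Sum>k\<le>n. l k * B (t k) \<omega>) \<partial>N) = of_real (exp (- gauss_exponent t l n))"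
proof -
  have N: "prob_space N" using B by (simp add: standard_brownian_motion_def)
  interpret prob_space N by fact
  have Bm: "B u \<in> borel_measurable N" if "0 \<le> u" for u using B that by (auto simp: standard_brownian_motion_def)
  have t0: "0 \<le> t k" for k using incseqD[OF t(1), of 0 k] t(2) by simp
  define T where "T = t n"
  \<comment> \<open>Stopped at the last relevant time, so that the whole sequence lies in
    [0, T].\<close>
  define t' where "t' k = min (t k) T" for k
  have t': "t' k = t k" if "k \<le> n" for k using incseqD[OF t(1) that] by (simp add: t'_def T_def)
  have ge: "gauss_exponent t' l m = gauss_exponent t l m" if "m \<le> n" for m l
    using that by (induction m arbitrary: l) (simp_all add: t')
  define test where "test s = {V \<in> borel_measurable (process_algebra N B {0..s}). \<forall>\<omega>\<in>space N. cmod (V \<omega>) \<le> 1}" for s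
  \<comment> \<open>The start at 0 is demanded for every \<open>\<omega>\<close>, also outside
    \<open>space N\<close>.\<close>
  define B' where "B' u \<omega> = (if \<omega> \<in> space N then B u \<omega> else 0)" for u \<omega>
  have sub: "subalgebra N (process_algebra N B {0..s})" for s
    by (rule subalgebra_process_algebra) (use Bm in auto)
  have P: "test_process N test B' T"
  proof
    fix s V assume V: "V \<in> test s" 
    show "V \<in> borel_measurable N" using V measurable_from_subalg[OF sub] by (auto simp: test_def)
    show "cmod (V \<omega>) \<le> 1" if "\<omega> \<in> space N" for \<omega> using V that by (auto simp: test_def)
    fix u l assume su: "0 \<le> s" "s \<le> u"
    have "V \<in> borel_measurable (process_algebra N B {0..u})"
      by (rule measurable_from_subalg[of _ "process_algebra N B {0..s}"])
         (use V process_algebra_mono[of "{0..s}" "{0..u}" N B] su in \<open>auto simp: subalgebra_def test_def\<close>)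
    moreover have [measurable]: "B s \<in> borel_measurable (process_algebra N B {0..u})" "B u \<in> borel_measurable (process_algebra N B {0..u})"
      using su by (auto intro: measurable_process_algebra)
    ultimately have "(\<lambda>\<omega>. V \<omega> * iexp (l * (B u \<omega> - B s \<omega>))) \<in> borel_measurable (process_algebra N B {0..u})"
      by measurable
    then have "(\<lambda>\<omega>. V \<omega> * iexp (l * (B' u \<omega> - B' s \<omega>))) \<in> borel_measurable (process_algebra N B {0..u})"
      by (subst measurable_cong[where g="\<lambda>\<omega>. V \<omega> * iexp (l * (B u \<omega> - B s \<omega>))"]) (auto simp: B'_def)
    then show "(\<lambda>\<omega>. V \<omega> * iexp (l \<bullet> (B' u \<omega> - B' s \<omega>))) \<in> test u"
      using V by (auto simp: test_def norm_mult)
  qed (auto simp: test_def)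
  interpret Q: test_family N "\<lambda>_::nat. test" "\<lambda>_. B'" T sequentially
    by (rule test_family.intro) (rule P)
  have "((\<lambda>i::nat. \<integral>\<omega>. iexp (\<Sum>k\<le>n. l k \<bullet> B' (t' k) \<omega>) \<partial>N) \<longlonglongrightarrow> of_real (exp (- gauss_exponent t' l n)))"
  proof (rule Q.fdd_char_limit)
    show "B' 0 \<omega> = 0" for \<omega> using B by (auto simp: standard_brownian_motion_def B'_def)
    show "incseq t'" using t(1) by (auto simp: incseq_def t'_def intro: min.coboundedI1)
    show "t' 0 = 0" using t0 t(2) by (simp add: t'_def T_def)
    show "t' k \<in> {0..T}" for k using t0 by (simp add: t'_def T_def)
    fix s u l and V :: "nat \<Rightarrow> _" assume su: "0 \<le> s" "s < u" "u \<le> T" and V: "\<And>i. V i \<in> test s"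
    have "expectation (\<lambda>\<omega>. V i \<omega> * iexp (l * (B' u \<omega> - B' s \<omega>))) = expectation (V i) * of_real (exp (- (l\<^sup>2 * (u - s) / 2)))" for i
    proof -
      have "integrable N (V i)"
        by (rule test_process.test_integrable[OF P _ _ V]) (use su in auto)
      then have "expectation (\<lambda>\<omega>. V i \<omega> * iexp (l * (B u \<omega> - B s \<omega>))) = expectation (V i) * char_incr N B u s l"
        using B V[of i] su
        by (intro integral_mult_increment Bm) (auto simp: standard_brownian_motion_def test_def)
      also have "char_incr N B u s l = expectation (\<lambda>\<omega>. iexp (l * (B u \<omega> - B s \<omega>)))"
        using su by (intro char_incr_eq Bm) auto
      also have "\<dots> = of_real (exp (- ((sqrt (u - s))\<^sup>2 * l\<^sup>2 / 2)))"
        using B su by (intro char_normal_incr) (auto simp: standard_brownian_motion_def)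
      also have "expectation (\<lambda>\<omega>. V i \<omega> * iexp (l * (B u \<omega> - B s \<omega>))) = expectation (\<lambda>\<omega>. V i \<omega> * iexp (l * (B' u \<omega> - B' s \<omega>)))"
        by (intro Bochner_Integration.integral_cong) (auto simp: B'_def)
      finally show ?thesis using su by (simp add: mult.commute)
    qed
    then show "(\<lambda>i. expectation (\<lambda>\<omega>. V i \<omega> * iexp (l \<bullet> (B' u \<omega> - B' s \<omega>))) - expectation (V i) * of_real (exp (- ((norm l)\<^sup>2 * (u - s) / 2)))) \<longlonglongrightarrow> 0"
      by simp
  qed
  then have "(\<integral>\<omega>. iexp (\<Sum>k\<le>n. l k \<bullet> B' (t' k) \<omega>) \<partial>N) = of_real (exp (- gauss_exponent t' l n))"
    using LIMSEQ_unique[OF tendsto_const] by blast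
  also have "(\<integral>\<omega>. iexp (\<Sum>k\<le>n. l k \<bullet> B' (t' k) \<omega>) \<partial>N) = (\<integral>\<omega>. iexp (\<Sum>k\<le>n. l k * B (t k) \<omega>) \<partial>N)"
    by (intro Bochner_Integration.integral_cong refl) (simp add: B'_def t')
  finally show ?thesis by (simp add: ge)
qed

text \<open>The quadratic form has no mixed terms between real coordinates; this is the counterpart,
  on the side of exponents, of the independence of real and imaginary part.\<close>

lemma gauss_exponent_complex:
  fixes l :: "nat \<Rightarrow> complex"
  shows "gauss_exponent t l n = gauss_exponent t (\<lambda>k. Re (l k)) n + gauss_exponent t (\<lambda>k. Im (l k)) n"
proof (induction n arbitrary: l)
  case (Suc n)
  show ?case
    by (simp add: Suc if_distrib[of Re] if_distrib[of Im] cmod_power2 distrib_left add_divide_distrib cong: if_cong)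
qed simp

lemma gauss_exponent_vec:
  fixes l :: "nat \<Rightarrow> complex ^ 'm"
  shows "gauss_exponent t l n = (\<Sum>j\<in>UNIV. gauss_exponent t (\<lambda>k. l k $ j) n)"
proof (induction n arbitrary: l)
  case (Suc n)
  have "(norm v)\<^sup>2 = (\<Sum>j\<in>UNIV. (norm (v $ j))\<^sup>2)" for v :: "complex ^ 'm"
    by (simp add: norm_vec_def L2_set_def sum_nonneg)
  then show ?case
    by (simp add: Suc if_distrib[of "\<lambda>v. v $ _"] sum.distrib sum_distrib_left sum_divide_distrib cong: if_cong)
qed simp

lemma process_char_vimage:
  fixes Z :: "real \<Rightarrow> 'a \<Rightarrow> 'e::euclidean_space"
  assumes "\<And>k. k \<le> n \<Longrightarrow> t k \<in> I" "S \<in> sets borel"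
  shows "(\<lambda>\<omega>. iexp (\<Sum>k\<le>n. l k \<bullet> Z (t k) \<omega>)) -` S \<inter> space N \<in> process_sigma N Z I"
proof (rule vimage_in_process_sigma[OF _ assms(2)])
  have [measurable]: "(\<lambda>\<omega>. \<Sum>k\<le>n. l k \<bullet> Z (t k) \<omega>) \<in> borel_measurable (process_algebra N Z I)"
    by (intro borel_measurable_sum borel_measurable_inner measurable_const measurable_process_algebra assms(1)) auto
  show "(\<lambda>\<omega>. iexp (\<Sum>k\<le>n. l k \<bullet> Z (t k) \<omega>)) \<in> borel_measurable (process_algebra N Z I)"
    by measurable
qed

lemma (in prob_space) integrable_iexp_sum:
  fixes Z :: "real \<Rightarrow> 'a \<Rightarrow> 'e::euclidean_space"
  assumes "\<And>k. k \<le> n \<Longrightarrow> Z (t k) \<in> borel_measurable M"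
  shows "integrable M (\<lambda>\<omega>. iexp (\<Sum>k\<le>n. l k \<bullet> Z (t k) \<omega>))"
proof (rule integrable_const_bound[where B=1])
  have [measurable]: "(\<lambda>\<omega>. \<Sum>k\<le>n. l k \<bullet> Z (t k) \<omega>) \<in> borel_measurable M"
    by (intro borel_measurable_sum borel_measurable_inner measurable_const assms) auto
  show "(\<lambda>\<omega>. iexp (\<Sum>k\<le>n. l k \<bullet> Z (t k) \<omega>)) \<in> borel_measurable M" by measurable
qed auto

lemma complex_brownian_motion_measurable:
  assumes "complex_brownian_motion N Z" "0 \<le> u" shows "Z u \<in> borel_measurable N"
proof -
  have "(\<lambda>\<omega>. Re (Z u \<omega>)) \<in> borel_measurable N" "(\<lambda>\<omega>. Im (Z u \<omega>)) \<in> borel_measurable N"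
    using assms by (auto simp: complex_brownian_motion_def standard_brownian_motion_def)
  then show ?thesis by (simp add: borel_measurable_complex_iff)
qed

lemma complex_brownian_motion_char:
  assumes Z: "complex_brownian_motion N Z" and t: "incseq t" "t 0 = 0"
  shows "(\<integral>\<omega>. iexp (\<Sum>k\<le>n. l k \<bullet> Z (t k) \<omega>) \<partial>N) = of_real (exp (- gauss_exponent t l n))"
proof -
  let ?R = "\<lambda>t \<omega>. Re (Z t \<omega>)" and ?I = "\<lambda>t \<omega>. Im (Z t \<omega>)"
  have R: "standard_brownian_motion N ?R" and I: "standard_brownian_motion N ?I"
    and ind: "prob_space.indep_set N (process_sigma N ?R {0..}) (process_sigma N ?I {0..})"
    using Z by (auto simp: complex_brownian_motion_def)
  interpret prob_space N using R by (simp add: standard_brownian_motion_def)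
  have t0: "0 \<le> t k" for k using incseqD[OF t(1), of 0 k] t(2) by simp
  have m: "?R (t k) \<in> borel_measurable N" "?I (t k) \<in> borel_measurable N" for k
    using R I t0 by (auto simp: standard_brownian_motion_def)
  have "(\<integral>\<omega>. iexp (\<Sum>k\<le>n. l k \<bullet> Z (t k) \<omega>) \<partial>N) =
     (\<integral>\<omega>. iexp (\<Sum>k\<le>n. Re (l k) \<bullet> ?R (t k) \<omega>) * iexp (\<Sum>k\<le>n. Im (l k) \<bullet> ?I (t k) \<omega>) \<partial>N)"
    by (simp add: inner_complex_def sum.distrib distrib_left exp_add)
  also have "\<dots> = (\<integral>\<omega>. iexp (\<Sum>k\<le>n. Re (l k) \<bullet> ?R (t k) \<omega>) \<partial>N) * (\<integral>\<omega>. iexp (\<Sum>k\<le>n. Im (l k) \<bullet> ?I (t k) \<omega>) \<partial>N)"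
  proof (rule indep_set_integral_mult[OF ind])
    show "integrable N (\<lambda>\<omega>. iexp (\<Sum>k\<le>n. Re (l k) \<bullet> ?R (t k) \<omega>))"
      "integrable N (\<lambda>\<omega>. iexp (\<Sum>k\<le>n. Im (l k) \<bullet> ?I (t k) \<omega>))"
      by (rule integrable_iexp_sum, rule m)+
    show "(\<lambda>\<omega>. iexp (\<Sum>k\<le>n. Re (l k) \<bullet> ?R (t k) \<omega>)) -` S \<inter> space N \<in> process_sigma N ?R {0..}"
      "(\<lambda>\<omega>. iexp (\<Sum>k\<le>n. Im (l k) \<bullet> ?I (t k) \<omega>)) -` S \<inter> space N \<in> process_sigma N ?I {0..}"
      if "S \<in> sets borel" for S
      using t0 that by (intro process_char_vimage; simp)+
  qed
  also have "\<dots> = of_real (exp (- gauss_exponent t l n))"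
    unfolding inner_real_def standard_brownian_motion_char[OF R t] standard_brownian_motion_char[OF I t]
      gauss_exponent_complex[of t l] minus_add_distrib exp_add of_real_mult ..
  finally show ?thesis .
qed

lemma multi_complex_brownian_motion_char:
  fixes l :: "nat \<Rightarrow> complex ^ 'm"
  assumes W: "multi_complex_brownian_motion N W" and t: "incseq t" "t 0 = 0"
  shows "(\<integral>\<omega>. iexp (\<Sum>k\<le>n. l k \<bullet> W (t k) \<omega>) \<partial>N) = of_real (exp (- gauss_exponent t l n))"
proof -
  let ?Z = "\<lambda>j t \<omega>. W t \<omega> $ j"
  have Z: "complex_brownian_motion N (?Z j)" for j using W by (auto simp: multi_complex_brownian_motion_def)
  have ind: "prob_space.indep_sets N (\<lambda>j. process_sigma N (?Z j) {0..}) UNIV"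
    using W by (auto simp: multi_complex_brownian_motion_def)
  interpret prob_space N using Z by (simp add: complex_brownian_motion_def standard_brownian_motion_def)
  have t0: "0 \<le> t k" for k using incseqD[OF t(1), of 0 k] t(2) by simp
  define f where "f j \<omega> = iexp (\<Sum>k\<le>n. (l k $ j) \<bullet> ?Z j (t k) \<omega>)" for j \<omega>
  have int: "integrable N (f j)" for j
    unfolding f_def by (intro integrable_iexp_sum complex_brownian_motion_measurable[OF Z] t0)
  have indf: "indep_vars (\<lambda>_. borel) f UNIV"
    unfolding indep_vars_def2
  proof
    show "\<forall>i\<in>UNIV. random_variable borel (f i)" using int by auto
    show "indep_sets (\<lambda>i. {f i -` A \<inter> space N |A. A \<in> sets borel}) UNIV"
    proof (rule indep_sets_mono_sets[OF ind])
      have "f j -` S \<inter> space N \<in> process_sigma N (?Z j) {0..}" if "S \<in> sets borel" for j S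
        unfolding f_def by (rule process_char_vimage[OF _ that]) (use t0 in auto)
      then show "{f j -` A \<inter> space N |A. A \<in> sets borel} \<subseteq> process_sigma N (?Z j) {0..}" for j by blast
    qed
  qed
  have "(\<integral>\<omega>. iexp (\<Sum>k\<le>n. l k \<bullet> W (t k) \<omega>) \<partial>N) = (\<integral>\<omega>. (\<Prod>j\<in>UNIV. f j \<omega>) \<partial>N)"
  proof (rule Bochner_Integration.integral_cong[OF refl])
    fix \<omega>
    have "(\<Sum>k\<le>n. l k \<bullet> W (t k) \<omega>) = (\<Sum>j\<in>UNIV. \<Sum>k\<le>n. (l k $ j) \<bullet> ?Z j (t k) \<omega>)"
      unfolding inner_vec_def by (rule sum.swap)
    then show "iexp (\<Sum>k\<le>n. l k \<bullet> W (t k) \<omega>) = (\<Prod>j\<in>UNIV. f j \<omega>)"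
      by (simp add: f_def exp_sum[symmetric] sum_distrib_left)
  qed
  also have "\<dots> = (\<Prod>j\<in>UNIV. \<integral>\<omega>. f j \<omega> \<partial>N)"
    by (rule indep_vars_lebesgue_integral[OF _ indf int]) simp
  also have "\<dots> = (\<Prod>j\<in>UNIV. of_real (exp (- gauss_exponent t (\<lambda>k. l k $ j) n)))"
    unfolding f_def complex_brownian_motion_char[OF Z t] ..
  also have "\<dots> = of_real (exp (- gauss_exponent t l n))"
    unfolding gauss_exponent_vec[of t l] sum_negf[symmetric] exp_sum[OF finite] of_real_prod ..
  finally show ?thesis .
qed

lemma multi_complex_brownian_motion_measurable:
  fixes W :: "real \<Rightarrow> 'b \<Rightarrow> complex ^ 'm"
  assumes W: "multi_complex_brownian_motion N W" and "0 \<le> t" shows "W t \<in> borel_measurable N"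
proof -
  have "(\<lambda>\<omega>. W t \<omega> $ j) \<in> borel_measurable N" for j
    using assms by (intro complex_brownian_motion_measurable) (auto simp: multi_complex_brownian_motion_def)
  then show ?thesis
    unfolding borel_measurable_euclidean_space[of "W t"]
    by (auto simp: Basis_vec_def inner_axis intro!: borel_measurable_inner)
qed

lemma multi_complex_brownian_motion_continuous:
  fixes W :: "real \<Rightarrow> 'b \<Rightarrow> complex ^ 'm"
  assumes W: "multi_complex_brownian_motion N W" and "\<omega> \<in> space N" shows "continuous_on {0..T} (\<lambda>t. W t \<omega>)"
proof -
  have "continuous_on {0..T} (\<lambda>t. W t \<omega> $ j)" for j
  proof -
    have "continuous_on {0..} (\<lambda>t. Re (W t \<omega> $ j))" "continuous_on {0..} (\<lambda>t. Im (W t \<omega> $ j))"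
      using assms by (auto simp: multi_complex_brownian_motion_def complex_brownian_motion_def standard_brownian_motion_def)
    then have "continuous_on {0..} (\<lambda>t. of_real (Re (W t \<omega> $ j)) + \<i> * of_real (Im (W t \<omega> $ j)))"
      by (intro continuous_on_add continuous_on_mult continuous_on_const continuous_on_of_real)
    then have "continuous_on {0..} (\<lambda>t. W t \<omega> $ j)" by (simp only: complex_eq[symmetric])
    then show ?thesis by (rule continuous_on_subset) auto
  qed
  then have "continuous_on {0..T} (\<lambda>t. \<chi> j. W t \<omega> $ j)" by (rule continuous_on_vec_lambda)
  then show ?thesis by simp
qed

subsection \<open>Integrals of bounded functions over intervals\<close>

lemma set_integrable_bounded_Icc:
  fixes f :: "real \<Rightarrow> 'b::{banach, second_countable_topology}"
  assumes [measurable]: "f \<in> borel_measurable borel" and B: "\<And>x. x \<in> {a..b} \<Longrightarrow> norm (f x) \<le> B"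
  shows "set_integrable lborel {a..b} f"
  unfolding set_integrable_def
  by (rule integrableI_bounded_set[where A="{a..b}" and B=B]) (use B in \<open>auto simp: emeasure_lborel_Icc_eq\<close>)

lemma norm_set_integral_Icc_le:
  fixes f :: "real \<Rightarrow> 'b::{banach, second_countable_topology}"
  assumes f: "f \<in> borel_measurable borel" and B: "\<And>x. x \<in> {a..b} \<Longrightarrow> norm (f x) \<le> B" and ab: "a \<le> b"
  shows "norm (LINT x:{a..b}|lborel. f x) \<le> B * (b - a)"
proof -
  have "norm (LINT x:{a..b}|lborel. f x) \<le> (LINT x:{a..b}|lborel. B)"
    unfolding set_lebesgue_integral_def
    by (rule norm_integral_le)
       (use set_integrable_bounded_Icc[OF f B] B in \<open>auto simp: set_integrable_def emeasure_lborel_Icc_eq split: split_indicator\<close>)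
  then show ?thesis using ab by (simp add: set_lebesgue_integral_def mult.commute)
qed

lemma set_integral_norm_mono:
  fixes f :: "real \<Rightarrow> 'b::{banach, second_countable_topology}"
  assumes "set_integrable lborel {a..b} f" "set_integrable lborel {a..b} g"
    and "\<And>x. x \<in> {a..b} \<Longrightarrow> norm (f x) \<le> g x"
  shows "norm (LINT x:{a..b}|lborel. f x) \<le> (LINT x:{a..b}|lborel. g x)"
  using assms unfolding set_lebesgue_integral_def set_integrable_def
  by (intro norm_integral_le) (auto split: split_indicator)

lemma set_integral_Icc_split:
  fixes f :: "real \<Rightarrow> 'b::{banach, second_countable_topology}"
  assumes f: "set_integrable lborel {a..b} f" and "a \<le> c" "c \<le> b"
  shows "(LINT x:{a..b}|lborel. f x) = (LINT x:{a..c}|lborel. f x) + (LINT x:{c..b}|lborel. f x)"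
proof -
  have "AE x in lborel. x \<noteq> c" by (rule AE_I[where N="{c}"]) auto
  then have "(LINT x:{a..c} \<union> {c..b}|lborel. f x) = (LINT x:{a..c}|lborel. f x) + (LINT x:{c..b}|lborel. f x)"
    by (intro set_integral_Un_AE) (use assms in \<open>auto intro: set_integrable_subset[OF f]\<close>)
  moreover have "{a..c} \<union> {c..b} = {a..b}" using assms by auto
  ultimately show ?thesis by simp
qed

text \<open>The square is cut along its diagonal, a null set, and the upper triangle is reflected by
  Fubini. In the result the inner variable always precedes the outer one, which is the order in
  which increments can be factored off.\<close>

lemma set_integral_pair_split:
  fixes f g :: "real \<Rightarrow> complex"
  assumes [measurable]: "f \<in> borel_measurable borel" "g \<in> borel_measurable borel"
    and B: "\<And>x. x \<in> {a..b} \<Longrightarrow> cmod (f x) \<le> B" "\<And>x. x \<in> {a..b} \<Longrightarrow> cmod (g x) \<le> B"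
  shows "(LINT y:{a..b}|lborel. f y) * (LINT x:{a..b}|lborel. g x) =
    (LINT y:{a..b}|lborel. LINT x:{a..y}|lborel. f y * g x + g y * f x)"
proof -
  define h where "h u v y x = (if x \<in> {a..b} \<and> y \<in> {a..b} \<and> x \<le> y then u y * v x else 0)"
    for u v :: "real \<Rightarrow> complex" and x y :: real
  have B0: "0 \<le> B" if "a \<le> b" using B(1)[of a] that by (meson atLeastAtMost_iff norm_ge_zero order_refl order_trans)
  have int: "integrable (lborel \<Otimes>\<^sub>M lborel) (case_prod k)"
    if [measurable]: "case_prod k \<in> borel_measurable (lborel \<Otimes>\<^sub>M lborel)"
      and k: "\<And>x y. x \<in> {a..b} \<Longrightarrow> y \<in> {a..b} \<Longrightarrow> cmod (k y x) \<le> B * B"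
        "\<And>x y. \<not> (x \<in> {a..b} \<and> y \<in> {a..b}) \<Longrightarrow> k y x = 0" for k
  proof (rule integrableI_bounded_set[where A="{a..b} \<times> {a..b}" and B="B * B"])
    show "emeasure (lborel \<Otimes>\<^sub>M lborel) ({a..b} \<times> {a..b}) < \<infinity>"
      by (subst lborel.emeasure_pair_measure_Times) (auto simp: emeasure_lborel_Icc_eq ennreal_mult_less_top)
  qed (use k in \<open>auto split: prod.splits\<close>)
  have hm: "case_prod (h u v) \<in> borel_measurable (lborel \<Otimes>\<^sub>M lborel)"
    if [measurable]: "u \<in> borel_measurable borel" "v \<in> borel_measurable borel" for u v
    unfolding h_def by measurable
  have hb: "cmod (h u v y x) \<le> B * B" if "\<And>x. x \<in> {a..b} \<Longrightarrow> cmod (u x) \<le> B" "\<And>x. x \<in> {a..b} \<Longrightarrow> cmod (v x) \<le> B"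
    "x \<in> {a..b}" "y \<in> {a..b}" for u v x y
    using that B0 by (auto simp: h_def norm_mult intro!: mult_mono)
  have ih: "integrable (lborel \<Otimes>\<^sub>M lborel) (case_prod (h f g))" "integrable (lborel \<Otimes>\<^sub>M lborel) (case_prod (h g f))"
    by (rule int[OF hm]; (rule hb)?; (use B in \<open>auto simp: h_def\<close>)?)+
  have ih': "integrable (lborel \<Otimes>\<^sub>M lborel) (\<lambda>(x, y). h g f y x)"
    using lborel_pair.integrable_product_swap[OF ih(2)] by (simp add: case_prod_unfold)
  have null: "AE x in lborel. x \<noteq> y" for y :: real
    by (rule AE_I[where N="{y}"]) auto
  have "(LINT y:{a..b}|lborel. f y) * (LINT x:{a..b}|lborel. g x) =
      (\<integral>y. (\<integral>x. (indicator {a..b} y *\<^sub>R f y) * (indicator {a..b} x *\<^sub>R g x) \<partial>lborel) \<partial>lborel)"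
    unfolding set_lebesgue_integral_def by (simp only: integral_mult_right_zero integral_mult_left_zero)
  also have "\<dots> = (\<integral>y. (\<integral>x. h f g y x + h g f x y \<partial>lborel) \<partial>lborel)"
  proof (rule Bochner_Integration.integral_cong[OF refl])
    fix y
    show "(\<integral>x. (indicator {a..b} y *\<^sub>R f y) * (indicator {a..b} x *\<^sub>R g x) \<partial>lborel) = (\<integral>x. h f g y x + h g f x y \<partial>lborel)"
    proof (rule integral_cong_AE)
      show "AE x in lborel. (indicator {a..b} y *\<^sub>R f y) * (indicator {a..b} x *\<^sub>R g x) = h f g y x + h g f x y"
        using null[of y] by eventually_elim (auto simp: h_def split: split_indicator)
    qed (simp_all add: h_def)
  qed
  also have "\<dots> = (\<integral>y. (\<integral>x. h f g y x \<partial>lborel) \<partial>lborel) + (\<integral>y. (\<integral>x. h g f x y \<partial>lborel) \<partial>lborel)"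
    using lborel_pair.integral_fst'[OF Bochner_Integration.integrable_add[OF ih(1) ih']] 
    using lborel_pair.integral_fst'[OF ih(1)] lborel_pair.integral_fst'[OF ih'] ih(1) ih' 
    by (simp add: case_prod_unfold)
  also have "(\<integral>y. (\<integral>x. h g f x y \<partial>lborel) \<partial>lborel) = (\<integral>y. (\<integral>x. h g f y x \<partial>lborel) \<partial>lborel)"
    using lborel_pair.Fubini_integral[OF ih(2)] by simp
  also have "(\<integral>y. (\<integral>x. h f g y x \<partial>lborel) \<partial>lborel) + \<dots> =
     (\<integral>y. (\<integral>x. h f g y x \<partial>lborel) + (\<integral>x. h g f y x \<partial>lborel) \<partial>lborel)"
    using lborel_pair.integrable_fst'[OF ih(1)] lborel_pair.integrable_fst'[OF ih(2)] by simp
  also have "\<dots> = (LINT y:{a..b}|lborel. LINT x:{a..y}|lborel. f y * g x + g y * f x)"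
    unfolding set_lebesgue_integral_def[of lborel "{a..b}"]
  proof (rule Bochner_Integration.integral_cong[OF refl])
    fix y
    show "(\<integral>x. h f g y x \<partial>lborel) + (\<integral>x. h g f y x \<partial>lborel) =
      indicator {a..b} y *\<^sub>R (LINT x:{a..y}|lborel. f y * g x + g y * f x)"
    proof (cases "y \<in> {a..b}")
      case True
      then have eq: "h u v y x = indicator {a..y} x *\<^sub>R (u y * v x)" for u v x
        by (auto simp: h_def split: split_indicator)
      have si: "set_integrable lborel {a..y} (\<lambda>x. f y * g x)" "set_integrable lborel {a..y} (\<lambda>x. g y * f x)"
        using True B B0 by (intro set_integrable_bounded_Icc[where B="B*B"]; auto simp: norm_mult intro!: mult_mono)+
      show ?thesis
        using True si unfolding eq by (simp add: set_integral_add set_lebesgue_integral_def[symmetric])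
    next
      case False
      then have "h u v y x = 0" for u v x by (auto simp: h_def)
      with False show ?thesis by simp
    qed
  qed
  finally show ?thesis .
qed

subsection \<open>Oscillatory integrals of a process with independent increments\<close>

text \<open>Joint measurability is asked for on the whole real line, so that Fubini applies to
  \<open>borel\<close> itself; independence still concerns nonnegative times only.\<close>

locale osc_process = prob_space M for M :: "'a measure" +
  fixes X :: "real \<Rightarrow> 'a \<Rightarrow> real"
  assumes joint: "(\<lambda>p. X (fst p) (snd p)) \<in> borel_measurable (borel \<Otimes>\<^sub>M M)"
    and ind: "independent_increments M X"
begin

definition e :: "real \<Rightarrow> real \<Rightarrow> 'a \<Rightarrow> complex" where "e \<alpha> r \<omega> = iexp (\<alpha> * X r \<omega>)"

definition G :: "real \<Rightarrow> real \<Rightarrow> real \<Rightarrow> 'a \<Rightarrow> complex" where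
  "G \<alpha> a b \<omega> = (LINT r:{a..b}|lborel. e \<alpha> r \<omega>)"

definition ph :: "real \<Rightarrow> real \<Rightarrow> real \<Rightarrow> complex" where "ph \<alpha> y x = char_incr M X y x \<alpha>"

lemma joint_compose [measurable (raw)]:
  assumes "f \<in> N \<rightarrow>\<^sub>M borel" "g \<in> N \<rightarrow>\<^sub>M M" shows "(\<lambda>z. X (f z) (g z)) \<in> borel_measurable N"
  using measurable_compose[OF measurable_Pair[OF assms] joint] by simp

lemma e_joint [measurable (raw)]:
  assumes [measurable]: "f \<in> N \<rightarrow>\<^sub>M borel" "g \<in> N \<rightarrow>\<^sub>M M" shows "(\<lambda>z. e \<alpha> (f z) (g z)) \<in> borel_measurable N"
  unfolding e_def by measurable

lemma G_joint [measurable (raw)]: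
  assumes [measurable]: "f \<in> borel_measurable N" "h \<in> borel_measurable N" "g \<in> N \<rightarrow>\<^sub>M M"
  shows "(\<lambda>z. G \<alpha> (f z) (h z) (g z)) \<in> borel_measurable N"
proof -
  \<comment> \<open>Variable endpoints become inequalities in the integrand of an integral over the
    whole line.\<close>
  have "(\<lambda>(z, r). if f z \<le> r \<and> r \<le> h z then e \<alpha> r (g z) else 0) \<in> borel_measurable (N \<Otimes>\<^sub>M lborel)"
    by measurable
  then have "(\<lambda>z. \<integral>r. (if f z \<le> r \<and> r \<le> h z then e \<alpha> r (g z) else 0) \<partial>lborel) \<in> borel_measurable N"
    by (rule lborel.borel_measurable_lebesgue_integral)
  moreover have "(\<lambda>z. \<integral>r. (if f z \<le> r \<and> r \<le> h z then e \<alpha> r (g z) else 0) \<partial>lborel) = (\<lambda>z. G \<alpha> (f z) (h z) (g z))"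
    unfolding G_def set_lebesgue_integral_def
    by (intro ext Bochner_Integration.integral_cong) (auto split: split_indicator)
  ultimately show ?thesis by simp
qed

lemma ph_eq: "ph \<alpha> y x = expectation (\<lambda>\<omega>. iexp (\<alpha> * (X y \<omega> - X x \<omega>)))"
  unfolding ph_def by (rule char_incr_eq) measurable

lemma ph_joint [measurable (raw)]:
  assumes [measurable]: "f \<in> borel_measurable N" "g \<in> borel_measurable N"
  shows "(\<lambda>z. ph \<alpha> (f z) (g z)) \<in> borel_measurable N"
proof -
  have "(\<lambda>(z, \<omega>). iexp (\<alpha> * (X (f z) \<omega> - X (g z) \<omega>))) \<in> borel_measurable (N \<Otimes>\<^sub>M M)"
    by measurable
  then show ?thesis unfolding ph_eq by (rule borel_measurable_lebesgue_integral)
qed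

lemma cmod_e [simp]: "cmod (e \<alpha> r \<omega>) = 1"
  by (simp add: e_def)

lemma e_mult: "e \<alpha> r \<omega> * e \<beta> r \<omega> = e (\<alpha> + \<beta>) r \<omega>"
  by (simp add: e_def exp_add[symmetric] algebra_simps)

lemma e_0 [simp]: "e 0 r \<omega> = 1"
  by (simp add: e_def)

lemma cnj_e: "cnj (e \<alpha> r \<omega>) = e (- \<alpha>) r \<omega>"
  by (simp add: e_def exp_cnj)

lemma cmod_ph_le: "cmod (ph \<alpha> y x) \<le> 1"
proof -
  have "cmod (ph \<alpha> y x) \<le> (\<integral>\<omega>. 1 \<partial>M)"
    unfolding ph_eq by (intro norm_integral_le integrable_const_bound[where B=1]) auto
  then show ?thesis by (simp add: prob_space)
qed

lemma ph_0 [simp]: "ph 0 y x = 1"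
  by (simp add: ph_eq prob_space)

lemma ph_minus: "ph (- \<alpha>) y x = cnj (ph \<alpha> y x)"
proof -
  show ?thesis
    unfolding ph_eq Bochner_Integration.integral_cnj[symmetric]
    by (intro Bochner_Integration.integral_cong) (simp_all add: exp_cnj)
qed

lemma cmod_G_le: "\<omega> \<in> space M \<Longrightarrow> a \<le> b \<Longrightarrow> cmod (G \<alpha> a b \<omega>) \<le> b - a"
  unfolding G_def using norm_set_integral_Icc_le[of "\<lambda>r. e \<alpha> r \<omega>" a b 1] by simp

lemma G_split: "\<omega> \<in> space M \<Longrightarrow> a \<le> c \<Longrightarrow> c \<le> b \<Longrightarrow> G \<alpha> a b \<omega> = G \<alpha> a c \<omega> + G \<alpha> c b \<omega>"
  unfolding G_def by (rule set_integral_Icc_split) (auto intro: set_integrable_bounded_Icc[where B=1])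

lemma cnj_G: "cnj (G \<alpha> a b \<omega>) = G (- \<alpha>) a b \<omega>"
  unfolding G_def set_lebesgue_integral_def
  by (subst Bochner_Integration.integral_cnj[symmetric]) (auto simp: cnj_e intro!: Bochner_Integration.integral_cong)

lemma expectation_set_integral:
  fixes h :: "real \<Rightarrow> 'a \<Rightarrow> complex"
  assumes [measurable]: "(\<lambda>p. h (fst p) (snd p)) \<in> borel_measurable (borel \<Otimes>\<^sub>M M)"
    and B: "\<And>r \<omega>. r \<in> {a..b} \<Longrightarrow> \<omega> \<in> space M \<Longrightarrow> cmod (h r \<omega>) \<le> B"
  shows "expectation (\<lambda>\<omega>. LINT r:{a..b}|lborel. h r \<omega>) = (LINT r:{a..b}|lborel. expectation (h r))"
    and "(\<lambda>\<omega>. LINT r:{a..b}|lborel. h r \<omega>) \<in> borel_measurable M"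
proof -
  interpret P: pair_sigma_finite lborel M ..
  have [measurable]: "(\<lambda>(r, \<omega>). indicator {a..b} r *\<^sub>R h r \<omega>) \<in> borel_measurable (lborel \<Otimes>\<^sub>M M)"
  proof -
    have "sets (lborel \<Otimes>\<^sub>M M) = sets (borel \<Otimes>\<^sub>M M)" by (intro sets_pair_measure_cong) auto
    moreover have "(\<lambda>(r, \<omega>). indicator {a..b} r *\<^sub>R h r \<omega>) \<in> borel_measurable (borel \<Otimes>\<^sub>M M)"
      unfolding case_prod_unfold by measurable
    ultimately show ?thesis by (simp cong: measurable_cong_sets)
  qed
  have int: "integrable (lborel \<Otimes>\<^sub>M M) (\<lambda>(r, \<omega>). indicator {a..b} r *\<^sub>R h r \<omega>)"
  proof (rule integrableI_bounded_set[where A="{a..b} \<times> space M" and B=B])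
    show "emeasure (lborel \<Otimes>\<^sub>M M) ({a..b} \<times> space M) < \<infinity>"
      by (subst emeasure_pair_measure_Times) (auto simp: emeasure_lborel_Icc_eq emeasure_space_1)
  qed (use B in \<open>auto simp: space_pair_measure indicator_def intro!: AE_I2\<close>)
  have "expectation (\<lambda>\<omega>. LINT r:{a..b}|lborel. h r \<omega>) = (\<integral>r. expectation (\<lambda>\<omega>. indicator {a..b} r *\<^sub>R h r \<omega>) \<partial>lborel)"
    unfolding set_lebesgue_integral_def by (rule P.Fubini_integral[OF int])
  also have "\<dots> = (LINT r:{a..b}|lborel. expectation (h r))"
    unfolding set_lebesgue_integral_def by (intro Bochner_Integration.integral_cong) (auto split: split_indicator)
  finally show "expectation (\<lambda>\<omega>. LINT r:{a..b}|lborel. h r \<omega>) = (LINT r:{a..b}|lborel. expectation (h r))" .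
  have "(\<lambda>(\<omega>, r). indicator {a..b} r *\<^sub>R h r \<omega>) \<in> borel_measurable (M \<Otimes>\<^sub>M lborel)"
  proof -
    have "sets (M \<Otimes>\<^sub>M lborel) = sets (M \<Otimes>\<^sub>M borel)" by (intro sets_pair_measure_cong) auto
    moreover have [measurable]: "(\<lambda>q. h (snd q) (fst q)) \<in> borel_measurable (M \<Otimes>\<^sub>M borel)"
      using measurable_compose[OF measurable_pair_swap' assms(1)] by (simp add: case_prod_unfold)
    moreover have "(\<lambda>(\<omega>, r). indicator {a..b} r *\<^sub>R h r \<omega>) \<in> borel_measurable (M \<Otimes>\<^sub>M borel)"
      unfolding case_prod_unfold by measurable
    ultimately show ?thesis by (simp cong: measurable_cong_sets)
  qed
  then show "(\<lambda>\<omega>. LINT r:{a..b}|lborel. h r \<omega>) \<in> borel_measurable M"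
    unfolding set_lebesgue_integral_def by (rule lborel.borel_measurable_lebesgue_integral)
qed

end

section \<open>Bounded random variables and functionals of the past\<close>

context osc_process
begin

definition bounded_rv :: "('a \<Rightarrow> complex) \<Rightarrow> bool" where
  "bounded_rv V \<longleftrightarrow> V \<in> borel_measurable M \<and> (\<exists>B. \<forall>\<omega>\<in>space M. cmod (V \<omega>) \<le> B)"

lemma bounded_rvI: "V \<in> borel_measurable M \<Longrightarrow> (\<And>\<omega>. \<omega> \<in> space M \<Longrightarrow> cmod (V \<omega>) \<le> B) \<Longrightarrow> bounded_rv V"
  by (auto simp: bounded_rv_def)

lemma bounded_rv_integrable: "bounded_rv V \<Longrightarrow> integrable M V"
  unfolding bounded_rv_def by (auto intro!: integrable_const_bound AE_I2)

lemma bounded_rv_measurable: "bounded_rv V \<Longrightarrow> V \<in> borel_measurable M"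
  by (simp add: bounded_rv_def)

lemma bounded_rv_mult:
  assumes "bounded_rv V" "bounded_rv W" shows "bounded_rv (\<lambda>\<omega>. V \<omega> * W \<omega>)"
proof -
  obtain B C where *: "\<And>\<omega>. \<omega> \<in> space M \<Longrightarrow> cmod (V \<omega>) \<le> B" "\<And>\<omega>. \<omega> \<in> space M \<Longrightarrow> cmod (W \<omega>) \<le> C"
    using assms by (auto simp: bounded_rv_def)
  show ?thesis
  proof (rule bounded_rvI)
    show "(\<lambda>\<omega>. V \<omega> * W \<omega>) \<in> borel_measurable M" using assms by (auto simp: bounded_rv_def)
    show "cmod (V \<omega> * W \<omega>) \<le> B * C" if "\<omega> \<in> space M" for \<omega>
      unfolding norm_mult using *[OF that] by (intro mult_mono) (auto intro: order_trans[OF norm_ge_zero])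
  qed
qed

lemma bounded_rv_add:
  assumes "bounded_rv V" "bounded_rv W" shows "bounded_rv (\<lambda>\<omega>. V \<omega> + W \<omega>)"
proof -
  obtain B C where *: "\<And>\<omega>. \<omega> \<in> space M \<Longrightarrow> cmod (V \<omega>) \<le> B" "\<And>\<omega>. \<omega> \<in> space M \<Longrightarrow> cmod (W \<omega>) \<le> C"
    using assms by (auto simp: bounded_rv_def)
  show ?thesis
    by (rule bounded_rvI[where B="B + C"])
       (use assms * in \<open>auto simp: bounded_rv_def intro!: norm_triangle_le add_mono\<close>)
qed

lemma bounded_rv_const: "bounded_rv (\<lambda>_. c)"
  by (rule bounded_rvI) auto

lemma bounded_rv_e: "bounded_rv (e \<alpha> r)"
  by (rule bounded_rvI[where B=1]) auto

lemma bounded_rv_iexp: "f \<in> borel_measurable M \<Longrightarrow> bounded_rv (\<lambda>\<omega>. iexp (f \<omega>))"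
  by (rule bounded_rvI[where B=1]) auto

lemma bounded_rv_G: "a \<le> b \<Longrightarrow> bounded_rv (G \<alpha> a b)"
  by (rule bounded_rvI[OF _ cmod_G_le]) auto

lemmas bounded_rv_intros = bounded_rv_mult bounded_rv_add bounded_rv_const bounded_rv_e bounded_rv_G

definition trig :: "(real \<times> real) list \<Rightarrow> 'a \<Rightarrow> complex" where
  "trig ps \<omega> = iexp (\<Sum>(r, \<beta>)\<leftarrow>ps. \<beta> * X r \<omega>)"

definition incr :: "real \<Rightarrow> real \<Rightarrow> real \<Rightarrow> 'a \<Rightarrow> complex" where
  "incr u t s \<omega> = iexp (u * (X t \<omega> - X s \<omega>))"

lemma measurable_trig [measurable]: "trig ps \<in> borel_measurable M"
proof -
  have [measurable]: "(\<lambda>\<omega>. \<Sum>(r, \<beta>)\<leftarrow>ps. \<beta> * X r \<omega>) \<in> borel_measurable M"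
    by (induction ps) (auto simp: case_prod_unfold)
  show ?thesis unfolding trig_def by measurable
qed

lemma measurable_incr [measurable]: "incr u t s \<in> borel_measurable M"
  unfolding incr_def by measurable

lemma cmod_trig [simp]: "cmod (trig ps \<omega>) = 1"
  by (simp add: trig_def)

lemma cmod_incr [simp]: "cmod (incr u t s \<omega>) = 1"
  by (simp add: incr_def)

lemma trig_Nil [simp]: "trig [] \<omega> = 1"
  by (simp add: trig_def)

lemma bounded_rv_trig: "bounded_rv (trig ps)" and bounded_rv_incr: "bounded_rv (incr u t s)"
  by (rule bounded_rvI[where B=1]; simp)+

lemma expectation_incr: "expectation (incr u t s) = ph u t s"
  unfolding ph_eq incr_def ..

text \<open>
  The integrals \<open>G \<alpha> 0 a\<close> need not be measurable with respect to the \<open>\<sigma>\<close>-algebra generated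
  by \<open>X u\<close> for \<open>u \<le> a\<close>, since \<open>X\<close> is only jointly measurable with respect to the whole of \<open>M\<close>.
  The past at time \<open>a\<close> is therefore described by the factorization of expectations that it
  has to satisfy; this class is closed under integration and under uniform limits.
\<close>

definition past :: "real \<Rightarrow> ('a \<Rightarrow> complex) \<Rightarrow> bool" where
  "past a V \<longleftrightarrow> bounded_rv V \<and>
     (\<forall>s t u ps. a \<le> s \<longrightarrow> s \<le> t \<longrightarrow> (\<forall>(r, \<beta>)\<in>set ps. 0 \<le> r \<and> r \<le> s) \<longrightarrow>
       expectation (\<lambda>\<omega>. V \<omega> * trig ps \<omega> * incr u t s \<omega>) =
       expectation (\<lambda>\<omega>. V \<omega> * trig ps \<omega>) * ph u t s)"

lemma pastD:
  fixes ps :: "(real \<times> real) list"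
  assumes "past a V" "a \<le> s" "s \<le> t" "\<And>r \<beta>. (r, \<beta>) \<in> set ps \<Longrightarrow> 0 \<le> r \<and> r \<le> s"
  shows "expectation (\<lambda>\<omega>. V \<omega> * trig ps \<omega> * incr u t s \<omega>) =
       expectation (\<lambda>\<omega>. V \<omega> * trig ps \<omega>) * ph u t s"
proof -
  have "\<forall>(r, \<beta>)\<in>set ps. 0 \<le> r \<and> r \<le> s" using assms(4) by auto
  then show ?thesis using assms(1-3) unfolding past_def by blast
qed

lemma pastI:
  assumes "bounded_rv V"
    and "\<And>s t u (ps :: (real \<times> real) list). a \<le> s \<Longrightarrow> s \<le> t \<Longrightarrow> (\<And>r \<beta>. (r, \<beta>) \<in> set ps \<Longrightarrow> 0 \<le> r \<and> r \<le> s) \<Longrightarrow>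
      expectation (\<lambda>\<omega>. V \<omega> * trig ps \<omega> * incr u t s \<omega>) =
       expectation (\<lambda>\<omega>. V \<omega> * trig ps \<omega>) * ph u t s"
  shows "past a V"
  unfolding past_def
proof (intro conjI allI impI assms(1))
  fix s t u and ps :: "(real \<times> real) list" assume "a \<le> s" "s \<le> t" "\<forall>(r, \<beta>)\<in>set ps. 0 \<le> r \<and> r \<le> s"
  then show "expectation (\<lambda>\<omega>. V \<omega> * trig ps \<omega> * incr u t s \<omega>) =
       expectation (\<lambda>\<omega>. V \<omega> * trig ps \<omega>) * ph u t s"
    by (intro assms(2)) auto
qed

lemma past_bounded: "past a V \<Longrightarrow> bounded_rv V"
  by (simp add: past_def)

text \<open>The place where the independence of the increments of \<open>X\<close> enters:
  \<open>trig ps\<close> with times up to \<open>s\<close> is measurable for the natural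
  \<sigma>-algebra at \<open>s\<close>. All other members of the class are generated from this
  one.\<close>

lemma past_one:
  assumes a: "0 \<le> a" shows "past a (\<lambda>_. 1)"
proof (rule pastI)
  fix s t u :: real and ps :: "(real \<times> real) list"
  assume st: "a \<le> s" "s \<le> t" and ps: "\<And>r \<beta>. (r, \<beta>) \<in> set ps \<Longrightarrow> 0 \<le> r \<and> r \<le> s"
  have "(\<lambda>\<omega>. \<Sum>(r, \<beta>)\<leftarrow>ps. \<beta> * X r \<omega>) \<in> borel_measurable (process_algebra M X {0..s})"
    using ps
  proof (induction ps)
    case (Cons p ps)
    have "X (fst p) \<in> borel_measurable (process_algebra M X {0..s})"
      by (rule measurable_process_algebra) (use Cons.prems[of "fst p" "snd p"] in auto)
    moreover have "(\<lambda>\<omega>. \<Sum>(r, \<beta>)\<leftarrow>ps. \<beta> * X r \<omega>) \<in> borel_measurable (process_algebra M X {0..s})"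
      using Cons by auto
    ultimately show ?case by (simp add: case_prod_unfold)
  qed simp
  then have "trig ps \<in> borel_measurable (process_algebra M X {0..s})"
    unfolding trig_def by measurable
  then have "expectation (\<lambda>\<omega>. trig ps \<omega> * iexp (u * (X t \<omega> - X s \<omega>))) = expectation (trig ps) * char_incr M X t s u"
    using st a by (intro integral_mult_increment ind bounded_rv_integrable[OF bounded_rv_trig]) auto
  then show "expectation (\<lambda>\<omega>. 1 * trig ps \<omega> * incr u t s \<omega>) = expectation (\<lambda>\<omega>. 1 * trig ps \<omega>) * ph u t s"
    by (simp add: ph_def incr_def)
qed (rule bounded_rv_const)

lemma past_mono: "past a V \<Longrightarrow> a \<le> b \<Longrightarrow> past b V"
proof -
  assume V: "past a V" and ab: "a \<le> b"
  show "past b V"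
  proof (rule pastI[OF past_bounded[OF V]])
    fix s t u and ps :: "(real \<times> real) list"
    assume st: "b \<le> s" "s \<le> t" and ps: "\<And>r \<beta>. (r, \<beta>) \<in> set ps \<Longrightarrow> 0 \<le> r \<and> r \<le> s"
    show "expectation (\<lambda>\<omega>. V \<omega> * trig ps \<omega> * incr u t s \<omega>) = expectation (\<lambda>\<omega>. V \<omega> * trig ps \<omega>) * ph u t s"
      using ab st by (intro pastD[where ps=ps, OF V _ _ ps]) auto
  qed
qed

lemma past_increment: "past a V \<Longrightarrow> a \<le> s \<Longrightarrow> s \<le> t \<Longrightarrow>
    expectation (\<lambda>\<omega>. V \<omega> * incr u t s \<omega>) = expectation V * ph u t s"
  using pastD[of a V s t "[]" u] by simp

text \<open>The new exponential is just one more entry of the list \<open>ps\<close>; this stability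
  is the reason for the quantification over \<open>trig ps\<close> in \<open>past\<close>.\<close>

lemma past_e:
  assumes V: "past a V" and "a \<le> b" "0 \<le> r" "r \<le> b"
  shows "past b (\<lambda>\<omega>. V \<omega> * e \<gamma> r \<omega>)"
proof (rule pastI)
  show "bounded_rv (\<lambda>\<omega>. V \<omega> * e \<gamma> r \<omega>)" by (intro bounded_rv_intros past_bounded[OF V])
  fix s t u and ps :: "(real \<times> real) list"
  assume st: "b \<le> s" "s \<le> t" and ps: "\<And>r \<beta>. (r, \<beta>) \<in> set ps \<Longrightarrow> 0 \<le> r \<and> r \<le> s"
  have eq: "V \<omega> * e \<gamma> r \<omega> * trig ps \<omega> = V \<omega> * trig ((r, \<gamma>) # ps) \<omega>" for \<omega>
    by (simp add: e_def trig_def distrib_left exp_add mult.assoc)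
  show "expectation (\<lambda>\<omega>. V \<omega> * e \<gamma> r \<omega> * trig ps \<omega> * incr u t s \<omega>) =
      expectation (\<lambda>\<omega>. V \<omega> * e \<gamma> r \<omega> * trig ps \<omega>) * ph u t s"
    unfolding eq by (rule pastD[OF V]) (use st ps assms in auto)
qed

lemma past_cmult:
  assumes V: "past a V" shows "past a (\<lambda>\<omega>. c * V \<omega>)"
proof (rule pastI)
  show "bounded_rv (\<lambda>\<omega>. c * V \<omega>)" by (intro bounded_rv_intros past_bounded[OF V])
  fix s t u and ps :: "(real \<times> real) list"
  assume "a \<le> s" "s \<le> t" "\<And>r \<beta>. (r, \<beta>) \<in> set ps \<Longrightarrow> 0 \<le> r \<and> r \<le> s"
  from pastD[where ps=ps and u=u, OF V this]
  show "expectation (\<lambda>\<omega>. c * V \<omega> * trig ps \<omega> * incr u t s \<omega>) = expectation (\<lambda>\<omega>. c * V \<omega> * trig ps \<omega>) * ph u t s"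
    by (simp add: mult.assoc)
qed

lemma past_add:
  assumes V: "past a V" and W: "past a W" shows "past a (\<lambda>\<omega>. V \<omega> + W \<omega>)"
proof (rule pastI)
  show "bounded_rv (\<lambda>\<omega>. V \<omega> + W \<omega>)" by (intro bounded_rv_intros past_bounded[OF V] past_bounded[OF W])
  fix s t u and ps :: "(real \<times> real) list"
  assume st: "a \<le> s" "s \<le> t" and ps: "\<And>r \<beta>. (r, \<beta>) \<in> set ps \<Longrightarrow> 0 \<le> r \<and> r \<le> s"
  have i: "integrable M (\<lambda>\<omega>. Z \<omega> * trig ps \<omega>)"
     "integrable M (\<lambda>\<omega>. Z \<omega> * trig ps \<omega> * incr u t s \<omega>)"
    if "past a Z" for Z
    by (intro bounded_rv_integrable bounded_rv_mult bounded_rv_trig bounded_rv_incr past_bounded[OF that])+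
  show "expectation (\<lambda>\<omega>. (V \<omega> + W \<omega>) * trig ps \<omega> * incr u t s \<omega>) =
      expectation (\<lambda>\<omega>. (V \<omega> + W \<omega>) * trig ps \<omega>) * ph u t s"
    unfolding distrib_right Bochner_Integration.integral_add[OF i(1)[OF V] i(1)[OF W]]
      Bochner_Integration.integral_add[OF i(2)[OF V] i(2)[OF W]]
    by (intro arg_cong2[where f="(+)"] pastD[where ps=ps, OF V st ps] pastD[where ps=ps, OF W st ps])
qed

lemma past_integral:
  fixes h :: "real \<Rightarrow> 'a \<Rightarrow> complex"
  assumes h: "(\<lambda>p. h (fst p) (snd p)) \<in> borel_measurable (borel \<Otimes>\<^sub>M M)"
    and B: "\<And>r \<omega>. r \<in> {c..d} \<Longrightarrow> \<omega> \<in> space M \<Longrightarrow> cmod (h r \<omega>) \<le> B" and cd: "c \<le> d"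
    and P: "\<And>r. r \<in> {c..d} \<Longrightarrow> past a (h r)"
  shows "past a (\<lambda>\<omega>. LINT r:{c..d}|lborel. h r \<omega>)"
proof (rule pastI)
  have sec: "(\<lambda>r. h r \<omega>) \<in> borel_measurable borel" if "\<omega> \<in> space M" for \<omega>
    using measurable_compose[OF measurable_Pair[OF measurable_ident measurable_const[OF that]] h] by simp
  show "bounded_rv (\<lambda>\<omega>. LINT r:{c..d}|lborel. h r \<omega>)"
    by (rule bounded_rvI, rule expectation_set_integral(2)[OF h], rule B, assumption, assumption,
        rule norm_set_integral_Icc_le[OF sec _ cd], assumption, rule B)
  fix s t u and ps :: "(real \<times> real) list"
  assume st: "a \<le> s" "s \<le> t" and ps: "\<And>r \<beta>. (r, \<beta>) \<in> set ps \<Longrightarrow> 0 \<le> r \<and> r \<le> s"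
  have sw: "expectation (\<lambda>\<omega>. (LINT r:{c..d}|lborel. h r \<omega>) * f \<omega>) = (LINT r:{c..d}|lborel. expectation (\<lambda>\<omega>. h r \<omega> * f \<omega>))"
    if [measurable]: "f \<in> borel_measurable M" and f: "\<And>\<omega>. cmod (f \<omega>) \<le> 1" for f
  proof -
    note [measurable] = h
    have "cmod (h r \<omega> * f \<omega>) \<le> B" if "r \<in> {c..d}" "\<omega> \<in> space M" for r \<omega>
    proof -
      have "cmod (h r \<omega>) * cmod (f \<omega>) \<le> B * 1"
        using B[OF that] f by (intro mult_mono) (auto intro: order_trans[OF norm_ge_zero])
      then show ?thesis by (simp add: norm_mult)
    qed
    then have "expectation (\<lambda>\<omega>. LINT r:{c..d}|lborel. h r \<omega> * f \<omega>) = (LINT r:{c..d}|lborel. expectation (\<lambda>\<omega>. h r \<omega> * f \<omega>))"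
      by (intro expectation_set_integral(1)) auto
    then show ?thesis by simp
  qed
  have "expectation (\<lambda>\<omega>. (LINT r:{c..d}|lborel. h r \<omega>) * (trig ps \<omega> * incr u t s \<omega>)) =
      (LINT r:{c..d}|lborel. expectation (\<lambda>\<omega>. h r \<omega> * (trig ps \<omega> * incr u t s \<omega>)))"
    by (rule sw) (simp_all add: norm_mult)
  also have "\<dots> = (LINT r:{c..d}|lborel. expectation (\<lambda>\<omega>. h r \<omega> * trig ps \<omega>) * ph u t s)"
    by (rule set_lebesgue_integral_cong) (auto simp: mult.assoc[symmetric] intro!: pastD[where ps=ps, OF P st ps])
  also have "\<dots> = (LINT r:{c..d}|lborel. expectation (\<lambda>\<omega>. h r \<omega> * trig ps \<omega>)) * ph u t s"
    by simp
  also have "(LINT r:{c..d}|lborel. expectation (\<lambda>\<omega>. h r \<omega> * trig ps \<omega>)) =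
      expectation (\<lambda>\<omega>. (LINT r:{c..d}|lborel. h r \<omega>) * trig ps \<omega>)"
    by (rule sw[symmetric]) simp_all
  finally show "expectation (\<lambda>\<omega>. (LINT r:{c..d}|lborel. h r \<omega>) * trig ps \<omega> * incr u t s \<omega>) =
      expectation (\<lambda>\<omega>. (LINT r:{c..d}|lborel. h r \<omega>) * trig ps \<omega>) * ph u t s"
    by (simp only: mult.assoc)
qed

lemma past_G:
  assumes V: "past a V" and cd: "0 \<le> c" "c \<le> d" "d \<le> a"
  shows "past a (\<lambda>\<omega>. V \<omega> * G \<alpha> c d \<omega>)"
proof -
  note [measurable] = bounded_rv_measurable[OF past_bounded[OF V]]
  obtain B where B: "\<And>\<omega>. \<omega> \<in> space M \<Longrightarrow> cmod (V \<omega>) \<le> B" using past_bounded[OF V] by (auto simp: bounded_rv_def)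
  have "past a (\<lambda>\<omega>. LINT r:{c..d}|lborel. V \<omega> * e \<alpha> r \<omega>)"
    by (rule past_integral[where B=B]) (use cd B in \<open>auto simp: norm_mult intro!: past_e[OF V]\<close>)
  then show ?thesis by (simp add: G_def)
qed

lemma past_uniform_limit:
  assumes P: "\<And>n. past a (V n)" and W: "bounded_rv W"
    and lim: "\<And>n \<omega>. \<omega> \<in> space M \<Longrightarrow> cmod (V n \<omega> - W \<omega>) \<le> r n" and r: "r \<longlonglongrightarrow> 0"
  shows "past a W"
proof (rule pastI[OF W])
  fix s t u and ps :: "(real \<times> real) list"
  assume st: "a \<le> s" "s \<le> t" and ps: "\<And>r \<beta>. (r, \<beta>) \<in> set ps \<Longrightarrow> 0 \<le> r \<and> r \<le> s"
  have l: "(\<lambda>n. expectation (\<lambda>\<omega>. V n \<omega> * f \<omega>)) \<longlonglongrightarrow> expectation (\<lambda>\<omega>. W \<omega> * f \<omega>)"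
    if f: "f \<in> borel_measurable M" "\<And>\<omega>. cmod (f \<omega>) \<le> 1" for f
  proof -
    have bf: "bounded_rv f" using f by (intro bounded_rvI) auto
    note iV = bounded_rv_integrable[OF bounded_rv_mult[OF past_bounded[OF P] bf]]
    note iW = bounded_rv_integrable[OF bounded_rv_mult[OF W bf]]
    have "cmod (expectation (\<lambda>\<omega>. V n \<omega> * f \<omega>) - expectation (\<lambda>\<omega>. W \<omega> * f \<omega>)) \<le> r n" for n
    proof -
      have "cmod (expectation (\<lambda>\<omega>. V n \<omega> * f \<omega> - W \<omega> * f \<omega>)) \<le> (\<integral>\<omega>. r n \<partial>M)"
      proof (rule norm_integral_le)
        fix \<omega> assume \<omega>: "\<omega> \<in> space M"
        have "cmod (V n \<omega> - W \<omega>) * cmod (f \<omega>) \<le> r n * 1"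
          using lim[OF \<omega>, of n] f by (intro mult_mono) (auto intro: order_trans[OF norm_ge_zero])
        then show "cmod (V n \<omega> * f \<omega> - W \<omega> * f \<omega>) \<le> r n" by (simp add: left_diff_distrib[symmetric] norm_mult)
      qed (use iV iW in auto)
      then show ?thesis using iV iW by (simp add: prob_space)
    qed
    then have "(\<lambda>n. expectation (\<lambda>\<omega>. V n \<omega> * f \<omega>) - expectation (\<lambda>\<omega>. W \<omega> * f \<omega>)) \<longlonglongrightarrow> 0"
      by (intro Lim_null_comparison[OF always_eventually r] allI)
    then show ?thesis by (simp add: LIM_zero_iff)
  qed
  have "(\<lambda>n. expectation (\<lambda>\<omega>. V n \<omega> * (trig ps \<omega> * incr u t s \<omega>)))
     \<longlonglongrightarrow> expectation (\<lambda>\<omega>. W \<omega> * (trig ps \<omega> * incr u t s \<omega>))"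
    by (rule l) (simp_all add: norm_mult)
  moreover have "(\<lambda>n. expectation (\<lambda>\<omega>. V n \<omega> * trig ps \<omega>) * ph u t s)
     \<longlonglongrightarrow> expectation (\<lambda>\<omega>. W \<omega> * trig ps \<omega>) * ph u t s"
    by (intro tendsto_mult tendsto_const l) simp_all
  moreover have "expectation (\<lambda>\<omega>. V n \<omega> * (trig ps \<omega> * incr u t s \<omega>)) =
      expectation (\<lambda>\<omega>. V n \<omega> * trig ps \<omega>) * ph u t s" for n
    using pastD[where ps=ps, OF P st ps] by (simp only: mult.assoc)
  ultimately show "expectation (\<lambda>\<omega>. W \<omega> * trig ps \<omega> * incr u t s \<omega>) =
      expectation (\<lambda>\<omega>. W \<omega> * trig ps \<omega>) * ph u t s"
    using LIMSEQ_unique by (simp only: mult.assoc) blast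
qed

text \<open>\<open>G\<close> is bounded by the length of its interval, so the exponential series
  converges uniformly, and its partial sums are polynomials in \<open>G\<close>. This makes
  exponentials of increments of the limit process admissible multipliers.\<close>

lemma past_exp_G:
  assumes V: "past a V" and cd: "0 \<le> c" "c \<le> d" "d \<le> a"
  shows "past a (\<lambda>\<omega>. V \<omega> * exp (z * G \<alpha> c d \<omega>))"
proof -
  obtain B where B: "\<And>\<omega>. \<omega> \<in> space M \<Longrightarrow> cmod (V \<omega>) \<le> B" using past_bounded[OF V] by (auto simp: bounded_rv_def)
  have B0: "0 \<le> B" using B not_empty by (meson all_not_in_conv norm_ge_zero order_trans)
  \<comment> \<open>A bound for the exponent on the whole sample space; the tail of the series at R
    dominates all remainders.\<close>
  define R where "R = cmod z * (d - c)"
  have R: "cmod (z * G \<alpha> c d \<omega>) \<le> R" if "\<omega> \<in> space M" for \<omega>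
    unfolding norm_mult R_def using cmod_G_le[OF that cd(2)] by (rule mult_left_mono) simp
  have pow: "past a (\<lambda>\<omega>. V \<omega> * (z * G \<alpha> c d \<omega>) ^ n)" for n
  proof (induction n)
    case (Suc n)
    have "past a (\<lambda>\<omega>. z * (V \<omega> * (z * G \<alpha> c d \<omega>) ^ n * G \<alpha> c d \<omega>))"
      by (intro past_cmult past_G Suc cd)
    then show ?case by (simp add: ac_simps)
  qed (use V in simp)
  have part: "past a (\<lambda>\<omega>. V \<omega> * (\<Sum>k<n. (z * G \<alpha> c d \<omega>) ^ k /\<^sub>R fact k))" for n
  proof (induction n)
    case 0
    show ?case using past_cmult[OF V, of 0] by simp
  next
    case (Suc n)
    have "past a (\<lambda>\<omega>. V \<omega> * (\<Sum>k<n. (z * G \<alpha> c d \<omega>) ^ k /\<^sub>R fact k) + of_real (inverse (fact n)) * (V \<omega> * (z * G \<alpha> c d \<omega>) ^ n))"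
      by (intro past_add past_cmult pow Suc)
    then show ?case by (simp add: distrib_left scaleR_conv_of_real mult.left_commute)
  qed
  show ?thesis
  proof (rule past_uniform_limit[OF part])
    note [measurable] = bounded_rv_measurable[OF past_bounded[OF V]]
    show "bounded_rv (\<lambda>\<omega>. V \<omega> * exp (z * G \<alpha> c d \<omega>))"
    proof (intro bounded_rv_mult past_bounded[OF V] bounded_rvI[where B="exp R"])
      show "cmod (exp (z * G \<alpha> c d \<omega>)) \<le> exp R" if "\<omega> \<in> space M" for \<omega>
        using norm_exp[of "z * G \<alpha> c d \<omega>"] R[OF that] by (meson exp_le_cancel_iff order_trans)
    qed measurable
    have sums: "(\<lambda>k. R ^ k /\<^sub>R fact k) sums exp R" by (rule exp_converges)
    show "(\<lambda>n. B * (exp R - (\<Sum>k<n. R ^ k /\<^sub>R fact k))) \<longlonglongrightarrow> 0"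
      using tendsto_mult[OF tendsto_const tendsto_diff[OF tendsto_const sums[unfolded sums_def]], of B "exp R"] by simp
    fix n \<omega> assume \<omega>: "\<omega> \<in> space M"
    let ?x = "z * G \<alpha> c d \<omega>"
    have s1: "(\<lambda>k. ?x ^ (k + n) /\<^sub>R fact (k + n)) sums (exp ?x - (\<Sum>k<n. ?x ^ k /\<^sub>R fact k))"
      by (rule sums_split_initial_segment[OF exp_converges])
    have s2: "(\<lambda>k. R ^ (k + n) /\<^sub>R fact (k + n)) sums (exp R - (\<Sum>k<n. R ^ k /\<^sub>R fact k))"
      by (rule sums_split_initial_segment[OF exp_converges])
    have le: "cmod (?x ^ k /\<^sub>R fact k) \<le> R ^ k /\<^sub>R fact k" for k
      using R[OF \<omega>] by (simp add: norm_power norm_mult[symmetric] divide_right_mono power_mono)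
    have "cmod (exp ?x - (\<Sum>k<n. ?x ^ k /\<^sub>R fact k)) \<le> exp R - (\<Sum>k<n. R ^ k /\<^sub>R fact k)"
      using norm_suminf_le[of "\<lambda>k. ?x ^ (k + n) /\<^sub>R fact (k + n)" "\<lambda>k. R ^ (k + n) /\<^sub>R fact (k + n)"] le s1 s2
      by (simp add: sums_iff)
    then have "cmod (V \<omega>) * cmod (exp ?x - (\<Sum>k<n. ?x ^ k /\<^sub>R fact k)) \<le> B * (exp R - (\<Sum>k<n. R ^ k /\<^sub>R fact k))"
      using B[OF \<omega>] B0 by (intro mult_mono) auto
    then show "cmod (V \<omega> * (\<Sum>k<n. ?x ^ k /\<^sub>R fact k) - V \<omega> * exp ?x) \<le> B * (exp R - (\<Sum>k<n. R ^ k /\<^sub>R fact k))"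
      by (simp only: right_diff_distrib[symmetric] norm_mult norm_minus_commute)
  qed
qed

subsection \<open>First and second moments\<close>

lemma e_eq_increment: "e \<gamma> x \<omega> = e \<gamma> a \<omega> * incr \<gamma> x a \<omega>"
  by (simp add: e_def incr_def exp_add[symmetric] algebra_simps)

text \<open>The rotation at time \<open>a\<close> belongs to the past; what remains is an increment,
  which factors off.\<close>

lemma expectation_past_e:
  assumes V: "past a V" and a: "0 \<le> a" "a \<le> x"
  shows "expectation (\<lambda>\<omega>. V \<omega> * e \<gamma> x \<omega>) = expectation (\<lambda>\<omega>. V \<omega> * e \<gamma> a \<omega>) * ph \<gamma> x a"
proof -
  have "past a (\<lambda>\<omega>. V \<omega> * e \<gamma> a \<omega>)" using a by (intro past_e[OF V]) auto
  from past_increment[OF this order_refl a(2), of \<gamma>] show ?thesis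
    by (subst e_eq_increment[of _ _ _ a]) (simp add: mult.assoc)
qed

lemma cmod_expectation_le:
  assumes "bounded_rv V" "\<And>\<omega>. \<omega> \<in> space M \<Longrightarrow> cmod (V \<omega>) \<le> B" shows "cmod (expectation V) \<le> B"
proof -
  have "cmod (expectation V) \<le> (\<integral>\<omega>. B \<partial>M)"
    using assms by (intro norm_integral_le bounded_rv_integrable) auto
  then show ?thesis by (simp add: prob_space)
qed

lemma cmod_expectation_past_e:
  assumes V: "past a V" "\<And>\<omega>. \<omega> \<in> space M \<Longrightarrow> cmod (V \<omega>) \<le> 1" and a: "0 \<le> a" "a \<le> x"
  shows "cmod (expectation (\<lambda>\<omega>. V \<omega> * e \<gamma> x \<omega>)) \<le> cmod (ph \<gamma> x a)"
proof -
  have "cmod (expectation (\<lambda>\<omega>. V \<omega> * e \<gamma> a \<omega>)) \<le> 1"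
    using V by (intro cmod_expectation_le bounded_rv_intros past_bounded) (auto simp: norm_mult)
  then show ?thesis
    unfolding expectation_past_e[OF V(1) a] norm_mult by (intro mult_left_le_one_le) auto
qed

text \<open>Characteristic functions of consecutive independent increments multiply. The rotation by
  \<open>- \<gamma>\<close> at \<open>a\<close> turns \<open>e \<gamma> x\<close> into an increment
  and is itself in the past at \<open>x\<close>.\<close>

lemma ph_mult:
  assumes "0 \<le> a" "a \<le> x" "x \<le> y" shows "ph \<gamma> y a = ph \<gamma> x a * ph \<gamma> y x"
proof -
  have "past x (\<lambda>\<omega>. 1 * e (- \<gamma>) a \<omega>)" using assms by (intro past_e[OF past_one[OF order_refl]]) auto
  then have P: "past x (\<lambda>\<omega>. 1 * e (- \<gamma>) a \<omega> * e \<gamma> x \<omega>)" using assms by (intro past_e[of x "\<lambda>\<omega>. 1 * e (- \<gamma>) a \<omega>"]) auto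
  have e2: "1 * e (- \<gamma>) a \<omega> * e \<gamma> x \<omega> = incr \<gamma> x a \<omega>" for x \<omega>
    by (simp add: e_def incr_def exp_add[symmetric] algebra_simps)
  have "ph \<gamma> y a = expectation (\<lambda>\<omega>. (1 * e (- \<gamma>) a \<omega> * e \<gamma> x \<omega>) * incr \<gamma> y x \<omega>)"
    unfolding ph_eq by (intro Bochner_Integration.integral_cong) (auto simp: e_def incr_def exp_add[symmetric] algebra_simps)
  also have "\<dots> = expectation (\<lambda>\<omega>. 1 * e (- \<gamma>) a \<omega> * e \<gamma> x \<omega>) * ph \<gamma> y x"
    using assms by (intro past_increment[OF P]) auto
  also have "expectation (\<lambda>\<omega>. 1 * e (- \<gamma>) a \<omega> * e \<gamma> x \<omega>) = ph \<gamma> x a"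
    unfolding e2 expectation_incr ..
  finally show ?thesis .
qed

text \<open>Enlarging the interval multiplies by further characteristic functions, of modulus at
  most 1.\<close>

lemma cmod_ph_antimono:
  assumes "0 \<le> w" "w \<le> x" "x \<le> y" "y \<le> z" shows "cmod (ph \<gamma> z w) \<le> cmod (ph \<gamma> y x)"
proof -
  have "cmod (ph \<gamma> z w) = cmod (ph \<gamma> x w) * (cmod (ph \<gamma> y x) * cmod (ph \<gamma> z y))"
    using assms ph_mult[of w x z \<gamma>] ph_mult[of x y z \<gamma>] by (simp add: norm_mult)
  also have "\<dots> \<le> 1 * (cmod (ph \<gamma> y x) * 1)"
    by (intro mult_mono cmod_ph_le) auto
  finally show ?thesis by simp
qed

text \<open>For x before y, the product of \<open>e \<alpha> y\<close> and
  \<open>e \<beta> x\<close> is \<open>e (\<alpha> + \<beta>) x\<close> times an increment of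
  frequency \<alpha>, which factors off as \<open>ph \<alpha> y x\<close>. The reflected triangle
  gives the term with \<beta>. A rotation of frequency \<alpha> + \<beta> stays with the
  past.\<close>

lemma expectation_G_G:
  assumes V: "past a V" and ab: "0 \<le> a" "a \<le> b"
  shows "expectation (\<lambda>\<omega>. V \<omega> * G \<alpha> a b \<omega> * G \<beta> a b \<omega>) =
    (LINT y:{a..b}|lborel. LINT x:{a..y}|lborel. expectation (\<lambda>\<omega>. V \<omega> * e (\<alpha> + \<beta>) x \<omega>) * (ph \<alpha> y x + ph \<beta> y x))"
proof -
  note [measurable] = bounded_rv_measurable[OF past_bounded[OF V]]
  obtain B where B: "\<And>\<omega>. \<omega> \<in> space M \<Longrightarrow> cmod (V \<omega>) \<le> B" using past_bounded[OF V] by (auto simp: bounded_rv_def)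
  have B0: "0 \<le> B" using B not_empty by (meson all_not_in_conv norm_ge_zero order_trans)
  define k where "k y x \<omega> = V \<omega> * (e \<alpha> y \<omega> * e \<beta> x \<omega> + e \<beta> y \<omega> * e \<alpha> x \<omega>)" for y x \<omega>
  define h where "h y \<omega> = V \<omega> * (e \<alpha> y \<omega> * G \<beta> a y \<omega> + e \<beta> y \<omega> * G \<alpha> a y \<omega>)" for y \<omega>
  have k_bound: "cmod (k y x \<omega>) \<le> B * 2" if "\<omega> \<in> space M" for y x \<omega>
    unfolding k_def norm_mult using B[OF that] B0
    by (intro mult_mono order_trans[OF norm_triangle_ineq]) (auto simp: norm_mult)
  have si: "set_integrable lborel {a..y} (\<lambda>x. e \<gamma> x \<omega>)" if "\<omega> \<in> space M" for y \<gamma> \<omega>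
    using that by (intro set_integrable_bounded_Icc[where B=1]) auto
  have h_eq: "h y \<omega> = (LINT x:{a..y}|lborel. k y x \<omega>)" if "\<omega> \<in> space M" for y \<omega>
    unfolding h_def k_def G_def using si[OF that] by (simp add: set_integral_add)
  have prod: "V \<omega> * G \<alpha> a b \<omega> * G \<beta> a b \<omega> = (LINT y:{a..b}|lborel. h y \<omega>)" if "\<omega> \<in> space M" for \<omega>
  proof -
    have "V \<omega> * (G \<alpha> a b \<omega> * G \<beta> a b \<omega>) = V \<omega> * (LINT y:{a..b}|lborel. LINT x:{a..y}|lborel. e \<alpha> y \<omega> * e \<beta> x \<omega> + e \<beta> y \<omega> * e \<alpha> x \<omega>)"
      unfolding G_def by (subst set_integral_pair_split[where B=1]) (use that in auto)
    also have "\<dots> = (LINT y:{a..b}|lborel. LINT x:{a..y}|lborel. k y x \<omega>)" by (simp add: k_def)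
    finally show ?thesis by (simp only: h_eq[OF that] mult.assoc)
  qed
  have "expectation (\<lambda>\<omega>. V \<omega> * G \<alpha> a b \<omega> * G \<beta> a b \<omega>) = expectation (\<lambda>\<omega>. LINT y:{a..b}|lborel. h y \<omega>)"
    by (intro Bochner_Integration.integral_cong refl prod)
  also have "\<dots> = (LINT y:{a..b}|lborel. expectation (h y))"
  proof (rule expectation_set_integral(1))
    show "(\<lambda>p. h (fst p) (snd p)) \<in> borel_measurable (borel \<Otimes>\<^sub>M M)" unfolding h_def by measurable
    fix y \<omega> assume y: "y \<in> {a..b}" and \<omega>: "\<omega> \<in> space M"
    have "cmod (h y \<omega>) \<le> (B * 2) * (y - a)"
      unfolding h_eq[OF \<omega>]
    proof (rule norm_set_integral_Icc_le)
      show "(\<lambda>x. k y x \<omega>) \<in> borel_measurable borel" unfolding k_def using \<omega> by measurable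
    qed (use y k_bound[OF \<omega>] in auto)
    also have "\<dots> \<le> (B * 2) * (b - a)" using y B0 by (intro mult_left_mono) auto
    finally show "cmod (h y \<omega>) \<le> (B * 2) * (b - a)" .
  qed
  also have "\<dots> = (LINT y:{a..b}|lborel. LINT x:{a..y}|lborel. expectation (\<lambda>\<omega>. V \<omega> * e (\<alpha> + \<beta>) x \<omega>) * (ph \<alpha> y x + ph \<beta> y x))"
  proof (rule set_lebesgue_integral_cong)
    show "\<forall>y. y \<in> {a..b} \<longrightarrow> expectation (h y) = (LINT x:{a..y}|lborel. expectation (\<lambda>\<omega>. V \<omega> * e (\<alpha> + \<beta>) x \<omega>) * (ph \<alpha> y x + ph \<beta> y x))"
    proof (intro allI impI)
      fix y assume y: "y \<in> {a..b}"
      have "expectation (h y) = expectation (\<lambda>\<omega>. LINT x:{a..y}|lborel. k y x \<omega>)"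
        by (intro Bochner_Integration.integral_cong refl h_eq)
      also have "\<dots> = (LINT x:{a..y}|lborel. expectation (k y x))"
        by (rule expectation_set_integral(1)[where B="B * 2"]) (use k_bound in \<open>auto simp: k_def\<close>)
      also have "\<dots> = (LINT x:{a..y}|lborel. expectation (\<lambda>\<omega>. V \<omega> * e (\<alpha> + \<beta>) x \<omega>) * (ph \<alpha> y x + ph \<beta> y x))"
      proof (rule set_lebesgue_integral_cong)
        show "\<forall>x. x \<in> {a..y} \<longrightarrow> expectation (k y x) = expectation (\<lambda>\<omega>. V \<omega> * e (\<alpha> + \<beta>) x \<omega>) * (ph \<alpha> y x + ph \<beta> y x)"
        proof (intro allI impI)
          fix x assume x: "x \<in> {a..y}"
          have P: "past x (\<lambda>\<omega>. V \<omega> * e (\<alpha> + \<beta>) x \<omega>)" using x ab by (intro past_e[OF V]) auto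
          have b1: "bounded_rv (\<lambda>\<omega>. (V \<omega> * e (\<alpha> + \<beta>) x \<omega>) * incr \<gamma> y x \<omega>)" for \<gamma>
            by (intro bounded_rv_mult bounded_rv_incr bounded_rv_e past_bounded[OF V])
          have "k y x \<omega> = (V \<omega> * e (\<alpha> + \<beta>) x \<omega>) * incr \<alpha> y x \<omega> + (V \<omega> * e (\<alpha> + \<beta>) x \<omega>) * incr \<beta> y x \<omega>" for \<omega>
            unfolding k_def e_eq_increment[of \<alpha> y \<omega> x] e_eq_increment[of \<beta> y \<omega> x] e_mult[symmetric]
            by (simp add: algebra_simps)
          then have "expectation (k y x) = expectation (\<lambda>\<omega>. (V \<omega> * e (\<alpha> + \<beta>) x \<omega>) * incr \<alpha> y x \<omega> + (V \<omega> * e (\<alpha> + \<beta>) x \<omega>) * incr \<beta> y x \<omega>)"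
            by (intro Bochner_Integration.integral_cong) auto
          also have "\<dots> = expectation (\<lambda>\<omega>. (V \<omega> * e (\<alpha> + \<beta>) x \<omega>) * incr \<alpha> y x \<omega>)
              + expectation (\<lambda>\<omega>. (V \<omega> * e (\<alpha> + \<beta>) x \<omega>) * incr \<beta> y x \<omega>)"
            by (rule Bochner_Integration.integral_add[OF bounded_rv_integrable[OF b1] bounded_rv_integrable[OF b1]])
          finally show "expectation (k y x) = expectation (\<lambda>\<omega>. V \<omega> * e (\<alpha> + \<beta>) x \<omega>) * (ph \<alpha> y x + ph \<beta> y x)"
            using x by (simp add: past_increment[OF P] distrib_left)
        qed
      qed simp
      finally show "expectation (h y) = (LINT x:{a..y}|lborel. expectation (\<lambda>\<omega>. V \<omega> * e (\<alpha> + \<beta>) x \<omega>) * (ph \<alpha> y x + ph \<beta> y x))" .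
    qed
  qed simp
  finally show ?thesis .
qed

end

section \<open>Integrals over the triangle a <= x <= y <= b\<close>

lemma measurable_iterated_integral:
  fixes k :: "real \<Rightarrow> real \<Rightarrow> 'b::{banach, second_countable_topology}"
  assumes [measurable]: "(\<lambda>p. k (fst p) (snd p)) \<in> borel_measurable (borel \<Otimes>\<^sub>M borel)"
  shows "(\<lambda>y. LINT x:{a..y}|lborel. k y x) \<in> borel_measurable borel"
proof -
  have "sets (borel \<Otimes>\<^sub>M lborel) = sets (borel \<Otimes>\<^sub>M (borel :: real measure))" by (intro sets_pair_measure_cong) auto
  moreover have "(\<lambda>(y, x). (if a \<le> x \<and> x \<le> y then 1 else 0) *\<^sub>R k y x) \<in> borel_measurable (borel \<Otimes>\<^sub>M borel)"
    unfolding case_prod_unfold by measurable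
  ultimately have "(\<lambda>(y, x). (if a \<le> x \<and> x \<le> y then 1 else 0) *\<^sub>R k y x) \<in> borel_measurable (borel \<Otimes>\<^sub>M lborel)"
    by (simp cong: measurable_cong_sets)
  then have "(\<lambda>y. \<integral>x. (if a \<le> x \<and> x \<le> y then 1 else 0) *\<^sub>R k y x \<partial>lborel) \<in> borel_measurable borel"
    by (rule lborel.borel_measurable_lebesgue_integral)
  moreover have "(\<lambda>y. \<integral>x. (if a \<le> x \<and> x \<le> y then 1 else 0) *\<^sub>R k y x \<partial>lborel) = (\<lambda>y. LINT x:{a..y}|lborel. k y x)"
    unfolding set_lebesgue_integral_def by (intro ext Bochner_Integration.integral_cong) (auto split: split_indicator)
  ultimately show ?thesis by simp
qed

lemma iterated_integrable:
  fixes k :: "real \<Rightarrow> real \<Rightarrow> 'b::{banach, second_countable_topology}"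
  assumes m: "(\<lambda>p. k (fst p) (snd p)) \<in> borel_measurable (borel \<Otimes>\<^sub>M borel)"
    and B: "\<And>x y. x \<in> {a..y} \<Longrightarrow> y \<in> {a..b} \<Longrightarrow> norm (k y x) \<le> B"
  shows "y \<in> {a..b} \<Longrightarrow> set_integrable lborel {a..y} (k y)"
    and "set_integrable lborel {a..b} (\<lambda>y. LINT x:{a..y}|lborel. k y x)"
proof -
  have sec: "k y \<in> borel_measurable borel" for y
    using measurable_compose[OF measurable_Pair[OF measurable_const[of y borel borel] measurable_ident] m] by simp
  show "y \<in> {a..b} \<Longrightarrow> set_integrable lborel {a..y} (k y)"
    by (rule set_integrable_bounded_Icc[OF sec B]) auto
  show "set_integrable lborel {a..b} (\<lambda>y. LINT x:{a..y}|lborel. k y x)"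
  proof (rule set_integrable_bounded_Icc[OF measurable_iterated_integral[OF m]])
    fix y assume y: "y \<in> {a..b}"
    have B0: "0 \<le> B" using B[of a a] y by (auto intro: order_trans[OF norm_ge_zero])
    have "norm (LINT x:{a..y}|lborel. k y x) \<le> B * (y - a)"
      by (rule norm_set_integral_Icc_le[OF sec B]) (use y in auto)
    also have "\<dots> \<le> B * (b - a)" using y B0 by (intro mult_left_mono) auto
    finally show "norm (LINT x:{a..y}|lborel. k y x) \<le> B * (b - a)" .
  qed
qed

lemma iterated_integral_mono:
  fixes k :: "real \<Rightarrow> real \<Rightarrow> 'b::{banach, second_countable_topology}"
  assumes "(\<lambda>p. k (fst p) (snd p)) \<in> borel_measurable (borel \<Otimes>\<^sub>M borel)"
    and "(\<lambda>p. g (fst p) (snd p)) \<in> borel_measurable (borel \<Otimes>\<^sub>M borel)"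
    and B: "\<And>x y. x \<in> {a..y} \<Longrightarrow> y \<in> {a..b} \<Longrightarrow> g y x \<le> B"
    and le: "\<And>x y. x \<in> {a..y} \<Longrightarrow> y \<in> {a..b} \<Longrightarrow> norm (k y x) \<le> g y x"
  shows "norm (LINT y:{a..b}|lborel. LINT x:{a..y}|lborel. k y x) \<le> (LINT y:{a..b}|lborel. LINT x:{a..y}|lborel. g y x)"
proof -
  have kB: "norm (k y x) \<le> B" and gB: "norm (g y x) \<le> B" if "x \<in> {a..y}" "y \<in> {a..b}" for x y
    using le[OF that] B[OF that] order_trans[OF norm_ge_zero le[OF that]] by auto
  note ki = iterated_integrable[OF assms(1) kB] and gi = iterated_integrable[OF assms(2) gB]
  show ?thesis
    by (intro set_integral_norm_mono ki gi le) auto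
qed

lemma iterated_integral_add:
  fixes k g :: "real \<Rightarrow> real \<Rightarrow> 'b::{banach, second_countable_topology}"
  assumes "(\<lambda>p. k (fst p) (snd p)) \<in> borel_measurable (borel \<Otimes>\<^sub>M borel)"
    and "(\<lambda>p. g (fst p) (snd p)) \<in> borel_measurable (borel \<Otimes>\<^sub>M borel)"
    and B: "\<And>x y. norm (k y x) \<le> B" "\<And>x y. norm (g y x) \<le> B"
  shows "(LINT y:{a..b}|lborel. LINT x:{a..y}|lborel. k y x + g y x) =
    (LINT y:{a..b}|lborel. LINT x:{a..y}|lborel. k y x) + (LINT y:{a..b}|lborel. LINT x:{a..y}|lborel. g y x)"
proof -
  note ki = iterated_integrable[OF assms(1) B(1)] and gi = iterated_integrable[OF assms(2) B(2)]
  have "(LINT y:{a..b}|lborel. LINT x:{a..y}|lborel. k y x + g y x) =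
     (LINT y:{a..b}|lborel. (LINT x:{a..y}|lborel. k y x) + (LINT x:{a..y}|lborel. g y x))"
    by (intro set_lebesgue_integral_cong) (auto intro!: set_integral_add ki gi)
  also have "\<dots> = (LINT y:{a..b}|lborel. LINT x:{a..y}|lborel. k y x) + (LINT y:{a..b}|lborel. LINT x:{a..y}|lborel. g y x)"
    by (intro set_integral_add ki gi)
  finally show ?thesis .
qed

lemma set_integral_Icc_FTC:
  fixes F :: "real \<Rightarrow> real"
  assumes "a \<le> b" "\<And>x. a \<le> x \<Longrightarrow> x \<le> b \<Longrightarrow> DERIV F x :> f x" "\<And>x. a \<le> x \<Longrightarrow> x \<le> b \<Longrightarrow> isCont f x"
  shows "(LINT x:{a..b}|lborel. f x) = F b - F a"
  using integral_FTC_Icc_real[of a b F f] assms by (simp add: set_lebesgue_integral_def mult.commute)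

section \<open>Second moments and decay of the characteristic function\<close>

context osc_process
begin

text \<open>\<gamma> is the frequency of the rotation left with the past: 0 gives the integral of
  condition (A), twice \<alpha> that of (C), and a sum or difference of two components of \<theta>
  that of (D).\<close>

definition J :: "real \<Rightarrow> real \<Rightarrow> real \<Rightarrow> real \<Rightarrow> real" where
  "J \<alpha> \<gamma> a b = (LINT y:{a..b}|lborel. LINT x:{a..y}|lborel. cmod (ph \<alpha> y x) * cmod (ph \<gamma> x a))"

definition S :: "real \<Rightarrow> real \<Rightarrow> real \<Rightarrow> complex" where
  "S \<alpha> a b = (LINT y:{a..b}|lborel. LINT x:{a..y}|lborel. ph \<alpha> y x + ph (- \<alpha>) y x)"

lemma J_minus: "J (- \<alpha>) (- \<gamma>) a b = J \<alpha> \<gamma> a b"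
  by (simp add: J_def ph_minus)

lemma J_minus_left: "J (- \<alpha>) 0 a b = J \<alpha> 0 a b"
  by (simp add: J_def ph_minus)

text \<open>The residual rotation has to travel from the end \<open>a\<close> of the past to x,
  which costs the factor \<open>cmod (ph (\<alpha> + \<beta>) x a)\<close>; this factor makes the
  mixed moments small.\<close>

lemma cmod_expectation_G_G:
  assumes V: "past a V" "\<And>\<omega>. \<omega> \<in> space M \<Longrightarrow> cmod (V \<omega>) \<le> 1" and ab: "0 \<le> a" "a \<le> b"
  shows "cmod (expectation (\<lambda>\<omega>. V \<omega> * G \<alpha> a b \<omega> * G \<beta> a b \<omega>)) \<le> J \<alpha> (\<alpha> + \<beta>) a b + J \<beta> (\<alpha> + \<beta>) a b"
proof -
  note [measurable] = bounded_rv_measurable[OF past_bounded[OF V(1)]]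
  let ?g = "\<lambda>\<gamma> y x. cmod (ph \<gamma> y x) * cmod (ph (\<alpha> + \<beta>) x a)"
  have g_le: "?g \<gamma> y x \<le> 1" for \<gamma> y x
    using cmod_ph_le by (simp add: mult_le_one)
  have [measurable]: "(\<lambda>x. expectation (\<lambda>\<omega>. V \<omega> * e (\<alpha> + \<beta>) x \<omega>)) \<in> borel_measurable borel"
  proof -
    have "(\<lambda>(x, \<omega>). V \<omega> * e (\<alpha> + \<beta>) x \<omega>) \<in> borel_measurable (borel \<Otimes>\<^sub>M M)" by measurable
    then show ?thesis by (rule borel_measurable_lebesgue_integral)
  qed
  have "cmod (expectation (\<lambda>\<omega>. V \<omega> * G \<alpha> a b \<omega> * G \<beta> a b \<omega>)) \<le>
     (LINT y:{a..b}|lborel. LINT x:{a..y}|lborel. ?g \<alpha> y x + ?g \<beta> y x)"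
    unfolding expectation_G_G[OF V(1) ab]
  proof (rule iterated_integral_mono)
    fix x y assume xy: "x \<in> {a..y}" "y \<in> {a..b}"
    show "?g \<alpha> y x + ?g \<beta> y x \<le> 2" using g_le[of \<alpha> y x] g_le[of \<beta> y x] by linarith
    have "cmod (expectation (\<lambda>\<omega>. V \<omega> * e (\<alpha> + \<beta>) x \<omega>) * (ph \<alpha> y x + ph \<beta> y x)) \<le>
        cmod (ph (\<alpha> + \<beta>) x a) * (cmod (ph \<alpha> y x) + cmod (ph \<beta> y x))"
      unfolding norm_mult using xy ab
      by (intro mult_mono cmod_expectation_past_e[OF V] norm_triangle_ineq) auto
    then show "cmod (expectation (\<lambda>\<omega>. V \<omega> * e (\<alpha> + \<beta>) x \<omega>) * (ph \<alpha> y x + ph \<beta> y x)) \<le> ?g \<alpha> y x + ?g \<beta> y x"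
      by (simp add: algebra_simps)
  qed measurable
  also have "\<dots> = J \<alpha> (\<alpha> + \<beta>) a b + J \<beta> (\<alpha> + \<beta>) a b"
    unfolding J_def by (rule iterated_integral_add[where B=1]) (use g_le in \<open>auto simp: abs_mult\<close>)
  finally show ?thesis .
qed

text \<open>Opposite frequencies leave no rotation, so the past decouples exactly; this is the only
  second moment that survives in the limit.\<close>

lemma expectation_G_G_opposite:
  assumes V: "past a V" and ab: "0 \<le> a" "a \<le> b"
  shows "expectation (\<lambda>\<omega>. V \<omega> * G \<alpha> a b \<omega> * G (- \<alpha>) a b \<omega>) = expectation V * S \<alpha> a b"
  unfolding expectation_G_G[OF V ab] S_def by simp

lemma cmod_G_sq: "complex_of_real ((cmod (G \<alpha> a b \<omega>))\<^sup>2) = G \<alpha> a b \<omega> * G (- \<alpha>) a b \<omega>"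
  unfolding cnj_G[symmetric] complex_norm_square ..

text \<open>Condition (A) with the scaling removed: one constant for all intervals of the half
  line.\<close>

definition mean_decay :: "real \<Rightarrow> real \<Rightarrow> bool" where
  "mean_decay \<alpha> K \<longleftrightarrow> 0 \<le> K \<and> (\<forall>a b. 0 \<le> a \<longrightarrow> a < b \<longrightarrow> J \<alpha> 0 a b \<le> K * (b - a))"

lemma mean_decay_minus: "mean_decay (- \<alpha>) K \<longleftrightarrow> mean_decay \<alpha> K"
  by (simp add: mean_decay_def J_minus_left)

lemma J_trivial: "J \<alpha> \<gamma> a a = 0"
proof -
  have "AE x in lborel. x \<noteq> a" by (rule AE_I[where N="{a}"]) auto
  then show ?thesis
    unfolding J_def set_lebesgue_integral_def[of lborel "{a..a}"] by (intro integral_eq_zero_AE) (auto elim: eventually_mono)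
qed

lemma J_le: "mean_decay \<alpha> K \<Longrightarrow> 0 \<le> a \<Longrightarrow> a \<le> b \<Longrightarrow> J \<alpha> 0 a b \<le> K * (b - a)"
  by (cases "a = b") (auto simp: mean_decay_def J_trivial)

lemma second_moment:
  assumes K: "mean_decay \<alpha> K" and ab: "0 \<le> a" "a \<le> b"
  shows "expectation (\<lambda>\<omega>. (cmod (G \<alpha> a b \<omega>))\<^sup>2) \<le> 2 * K * (b - a)"
proof -
  have "complex_of_real (expectation (\<lambda>\<omega>. (cmod (G \<alpha> a b \<omega>))\<^sup>2)) = expectation (\<lambda>\<omega>. 1 * G \<alpha> a b \<omega> * G (- \<alpha>) a b \<omega>)"
    unfolding integral_complex_of_real[symmetric] cmod_G_sq by simp
  also have "cmod \<dots> \<le> J \<alpha> (\<alpha> + - \<alpha>) a b + J (- \<alpha>) (\<alpha> + - \<alpha>) a b"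
    using ab by (intro cmod_expectation_G_G past_one) auto
  also have "\<dots> \<le> 2 * K * (b - a)" using J_le[OF K ab] by (simp add: J_minus_left)
  finally show ?thesis by simp
qed

text \<open>By monotonicity the corner (b, a) has the smallest modulus on the triangle, whose area
  is half of (b - a)^2. Comparison with the linear bound on \<open>J\<close> leaves decay of order 1
  / (b - a).\<close>

lemma cmod_ph_decay:
  assumes K: "mean_decay \<alpha> K" and ab: "0 \<le> a" "a \<le> b"
  shows "cmod (ph \<alpha> b a) * (b - a) \<le> 2 * K"
proof (cases "a = b")
  case True
  then show ?thesis using K by (simp add: mean_decay_def)
next
  case False
  let ?c = "cmod (ph \<alpha> b a)"
  have "(LINT y:{a..b}|lborel. LINT x:{a..y}|lborel. ?c) = (LINT y:{a..b}|lborel. ?c * (y - a))"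
    by (rule set_lebesgue_integral_cong) (auto simp: set_lebesgue_integral_def)
  also have "\<dots> = ?c * (b - a)\<^sup>2 / 2 - ?c * (a - a)\<^sup>2 / 2"
    using ab by (intro set_integral_Icc_FTC) (auto intro!: derivative_eq_intros simp: field_simps)
  finally have eq: "(LINT y:{a..b}|lborel. LINT x:{a..y}|lborel. ?c) = ?c * (b - a)\<^sup>2 / 2" by simp
  have "norm (LINT y:{a..b}|lborel. LINT x:{a..y}|lborel. ?c) \<le> J \<alpha> 0 a b"
    unfolding J_def
  proof (rule iterated_integral_mono[where B=1])
    fix x y assume xy: "x \<in> {a..y}" "y \<in> {a..b}"
    show "norm ?c \<le> cmod (ph \<alpha> y x) * cmod (ph 0 x a)" using xy ab cmod_ph_antimono[of a x y b \<alpha>] by simp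
    show "cmod (ph \<alpha> y x) * cmod (ph 0 x a) \<le> 1" using cmod_ph_le by simp
  qed measurable
  also have "\<dots> \<le> K * (b - a)" by (rule J_le[OF K ab])
  finally have "?c * (b - a)\<^sup>2 / 2 \<le> K * (b - a)" unfolding eq by simp
  moreover have "?c * (b - a)\<^sup>2 / 2 = (?c * (b - a)) * (b - a) / 2" by (simp only: power2_eq_square mult.assoc)
  ultimately have "(?c * (b - a)) * (b - a) \<le> (2 * K) * (b - a)" by linarith
  then show ?thesis using ab False by simp
qed

definition log_bound :: "real \<Rightarrow> real \<Rightarrow> real" where "log_bound K L = (1 + 2 * K) * ln (1 + L)"

text \<open>The trivial bound 1 and the decay bound are added, so that the result stays integrable
  near length 0; its integral is \<open>log_bound\<close>.\<close>

lemma cmod_ph_le_inverse: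
  assumes K: "mean_decay \<alpha> K" and ab: "0 \<le> a" "a \<le> b"
  shows "cmod (ph \<alpha> b a) \<le> (1 + 2 * K) / (1 + (b - a))"
  using cmod_ph_decay[OF assms] cmod_ph_le[of \<alpha> b a] ab by (simp add: field_simps)

lemma integral_ph_forward:
  assumes K: "mean_decay \<alpha> K" and ab: "0 \<le> a" "a \<le> b"
  shows "(LINT r:{a..b}|lborel. cmod (ph \<alpha> r a)) \<le> log_bound K (b - a)"
proof -
  have "norm (LINT r:{a..b}|lborel. cmod (ph \<alpha> r a)) \<le> (LINT r:{a..b}|lborel. (1 + 2 * K) / (1 + (r - a)))"
  proof (rule set_integral_norm_mono)
    show "set_integrable lborel {a..b} (\<lambda>r. cmod (ph \<alpha> r a))"
      by (rule set_integrable_bounded_Icc[where B=1]) (auto simp: cmod_ph_le)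
    show "set_integrable lborel {a..b} (\<lambda>r. (1 + 2 * K) / (1 + (r - a)))"
      by (rule borel_integrable_atLeastAtMost') (auto intro!: continuous_intros)
  qed (use K ab in \<open>auto intro: cmod_ph_le_inverse\<close>)
  also have "(LINT r:{a..b}|lborel. (1 + 2 * K) / (1 + (r - a))) = (1 + 2 * K) * ln (1 + (b - a)) - (1 + 2 * K) * ln (1 + (a - a))"
    using ab by (intro set_integral_Icc_FTC) (auto intro!: derivative_eq_intros continuous_intros)
  finally show ?thesis by (simp add: log_bound_def)
qed

lemma integral_ph_backward:
  assumes K: "mean_decay \<alpha> K" and ab: "0 \<le> a" "a \<le> b"
  shows "(LINT r:{a..b}|lborel. cmod (ph \<alpha> b r)) \<le> log_bound K (b - a)"
proof -
  have "norm (LINT r:{a..b}|lborel. cmod (ph \<alpha> b r)) \<le> (LINT r:{a..b}|lborel. (1 + 2 * K) / (1 + (b - r)))"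
  proof (rule set_integral_norm_mono)
    show "set_integrable lborel {a..b} (\<lambda>r. cmod (ph \<alpha> b r))"
      by (rule set_integrable_bounded_Icc[where B=1]) (auto simp: cmod_ph_le)
    show "set_integrable lborel {a..b} (\<lambda>r. (1 + 2 * K) / (1 + (b - r)))"
      by (rule borel_integrable_atLeastAtMost') (auto intro!: continuous_intros)
  qed (use K ab in \<open>auto intro: cmod_ph_le_inverse\<close>)
  also have "(LINT r:{a..b}|lborel. (1 + 2 * K) / (1 + (b - r))) = - ((1 + 2 * K) * ln (1 + (b - b))) - - ((1 + 2 * K) * ln (1 + (b - a)))"
    using ab by (intro set_integral_Icc_FTC[where F="\<lambda>r. - ((1 + 2 * K) * ln (1 + (b - r)))"])
      (auto intro!: derivative_eq_intros continuous_intros)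
  finally show ?thesis by (simp add: log_bound_def)
qed

lemma expectation_past_G:
  assumes V: "past a V" and ab: "0 \<le> a" "a \<le> b"
  shows "expectation (\<lambda>\<omega>. V \<omega> * G \<alpha> a b \<omega>) = (LINT r:{a..b}|lborel. expectation (\<lambda>\<omega>. V \<omega> * e \<alpha> r \<omega>))"
proof -
  note [measurable] = bounded_rv_measurable[OF past_bounded[OF V]]
  obtain B where B: "\<And>\<omega>. \<omega> \<in> space M \<Longrightarrow> cmod (V \<omega>) \<le> B" using past_bounded[OF V] by (auto simp: bounded_rv_def)
  have "expectation (\<lambda>\<omega>. LINT r:{a..b}|lborel. V \<omega> * e \<alpha> r \<omega>) = (LINT r:{a..b}|lborel. expectation (\<lambda>\<omega>. V \<omega> * e \<alpha> r \<omega>))"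
    by (rule expectation_set_integral(1)[where B=B]) (use B in \<open>auto simp: norm_mult\<close>)
  then show ?thesis by (simp add: G_def)
qed

text \<open>The mean of \<open>V\<close>, not its supremum, stands on the right: in the fourth
  moment argument \<open>V\<close> is cubic in \<open>G\<close>, and only its L1 norm has the right
  order.\<close>

lemma first_moment_L1:
  assumes K: "mean_decay \<alpha> K" and V: "past a V" and ab: "0 \<le> a" "a \<le> b"
  shows "cmod (expectation (\<lambda>\<omega>. V \<omega> * G \<alpha> a b \<omega>)) \<le> expectation (\<lambda>\<omega>. cmod (V \<omega>)) * log_bound K (b - a)"
proof -
  note [measurable] = bounded_rv_measurable[OF past_bounded[OF V]]
  have "(\<lambda>(x, \<omega>). V \<omega> * e \<alpha> x \<omega>) \<in> borel_measurable (borel \<Otimes>\<^sub>M M)" by measurable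
  then have m: "(\<lambda>x. expectation (\<lambda>\<omega>. V \<omega> * e \<alpha> x \<omega>)) \<in> borel_measurable borel" by (rule borel_measurable_lebesgue_integral)
  let ?N = "expectation (\<lambda>\<omega>. cmod (V \<omega>))"
  have e: "cmod (expectation (\<lambda>\<omega>. V \<omega> * e \<alpha> x \<omega>)) \<le> ?N" for x
    by (rule order_trans[OF integral_norm_bound]) (simp add: norm_mult)
  have N0: "0 \<le> ?N" by simp
  have le: "cmod (expectation (\<lambda>\<omega>. V \<omega> * e \<alpha> x \<omega>)) \<le> ?N * cmod (ph \<alpha> x a)" if "x \<in> {a..b}" for x
  proof -
    have "expectation (\<lambda>\<omega>. V \<omega> * e \<alpha> x \<omega>) = expectation (\<lambda>\<omega>. V \<omega> * e \<alpha> a \<omega>) * ph \<alpha> x a"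
      by (rule expectation_past_e[OF V]) (use that ab in auto)
    then show ?thesis using e[of a] by (simp only: norm_mult) (intro mult_right_mono norm_ge_zero)
  qed
  have "cmod (expectation (\<lambda>\<omega>. V \<omega> * G \<alpha> a b \<omega>)) \<le> (LINT r:{a..b}|lborel. ?N * cmod (ph \<alpha> r a))"
    unfolding expectation_past_G[OF V ab]
  proof (rule set_integral_norm_mono)
    show "set_integrable lborel {a..b} (\<lambda>r. expectation (\<lambda>\<omega>. V \<omega> * e \<alpha> r \<omega>))"
      by (rule set_integrable_bounded_Icc[OF m, where B="?N"]) (rule e)
    show "set_integrable lborel {a..b} (\<lambda>r. ?N * cmod (ph \<alpha> r a))"
    proof (rule set_integrable_bounded_Icc[where B="?N * 1"])
      show "norm (?N * cmod (ph \<alpha> r a)) \<le> ?N * 1" for r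
        unfolding norm_mult using N0 by (intro mult_mono) (simp_all add: cmod_ph_le)
    qed measurable
  qed (rule le)
  also have "\<dots> = ?N * (LINT r:{a..b}|lborel. cmod (ph \<alpha> r a))" by simp
  also have "\<dots> \<le> ?N * log_bound K (b - a)" by (intro mult_left_mono integral_ph_forward[OF K ab] N0)
  finally show ?thesis .
qed

lemma log_bound_nonneg: "0 \<le> K \<Longrightarrow> 0 \<le> L \<Longrightarrow> 0 \<le> log_bound K L"
  by (simp add: log_bound_def)

lemma first_moment:
  assumes K: "mean_decay \<alpha> K" and V: "past a V" "\<And>\<omega>. \<omega> \<in> space M \<Longrightarrow> cmod (V \<omega>) \<le> 1" and ab: "0 \<le> a" "a \<le> b"
  shows "cmod (expectation (\<lambda>\<omega>. V \<omega> * G \<alpha> a b \<omega>)) \<le> log_bound K (b - a)"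
proof -
  have "expectation (\<lambda>\<omega>. cmod (V \<omega>)) \<le> expectation (\<lambda>\<omega>. 1)"
    using V(2) bounded_rv_integrable[OF past_bounded[OF V(1)]] by (intro integral_mono integrable_norm) simp_all
  then have "expectation (\<lambda>\<omega>. cmod (V \<omega>)) * log_bound K (b - a) \<le> 1 * log_bound K (b - a)"
    using K ab by (intro mult_right_mono log_bound_nonneg) (auto simp: prob_space mean_decay_def)
  then show ?thesis using first_moment_L1[OF K V(1) ab] by simp
qed

text \<open>The time-reversed estimate, with the rotation taken at the right end. It serves the
  mixed term in which the earlier block is the factor of degree one.\<close>

lemma first_moment_backward:
  assumes K: "mean_decay \<alpha> K" and ab: "0 \<le> a" "a \<le> b"
  shows "cmod (expectation (\<lambda>\<omega>. G \<alpha> a b \<omega> * e (- \<alpha>) b \<omega>)) \<le> log_bound K (b - a)"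
proof -
  have ph: "expectation (\<lambda>\<omega>. e \<alpha> r \<omega> * e (- \<alpha>) b \<omega>) = ph (- \<alpha>) b r" for r
    unfolding expectation_incr[symmetric] 
    by (intro Bochner_Integration.integral_cong) (auto simp: e_def incr_def exp_add[symmetric] algebra_simps)
  have "expectation (\<lambda>\<omega>. G \<alpha> a b \<omega> * e (- \<alpha>) b \<omega>) = expectation (\<lambda>\<omega>. LINT r:{a..b}|lborel. e \<alpha> r \<omega> * e (- \<alpha>) b \<omega>)"
    by (simp add: G_def)
  also have "\<dots> = (LINT r:{a..b}|lborel. ph (- \<alpha>) b r)"
    unfolding ph[symmetric] by (rule expectation_set_integral(1)[where B=1]) (auto simp: norm_mult)
  also have "cmod \<dots> \<le> (LINT r:{a..b}|lborel. cmod (ph \<alpha> b r))"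
  proof (rule set_integral_norm_mono)
    show "set_integrable lborel {a..b} (ph (- \<alpha>) b)" "set_integrable lborel {a..b} (\<lambda>r. cmod (ph \<alpha> b r))"
      by (rule set_integrable_bounded_Icc[where B=1]; simp add: cmod_ph_le)+
  qed (simp add: ph_minus)
  also have "\<dots> \<le> log_bound K (b - a)" by (rule integral_ph_backward[OF K ab])
  finally show ?thesis .
qed

subsection \<open>Functionals of future increments\<close>

text \<open>The dual of \<open>past\<close>: independence of everything before \<open>c\<close>,
  again expressed by factorization of expectations instead of a \<sigma>-algebra.\<close>

definition future :: "real \<Rightarrow> ('a \<Rightarrow> complex) \<Rightarrow> bool" where
  "future c H \<longleftrightarrow> bounded_rv H \<and> (\<forall>V. past c V \<longrightarrow> expectation (\<lambda>\<omega>. V \<omega> * H \<omega>) = expectation V * expectation H)"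

definition incrs :: "real \<Rightarrow> (real \<times> real) list \<Rightarrow> 'a \<Rightarrow> complex" where
  "incrs c ps \<omega> = iexp (\<Sum>(r, \<beta>)\<leftarrow>ps. \<beta> * (X r \<omega> - X c \<omega>))"

lemma incrs_eq_trig: "incrs c ps \<omega> = trig ps \<omega> * e (- (\<Sum>(r, \<beta>)\<leftarrow>ps. \<beta>)) c \<omega>"
proof -
  have "(\<Sum>(r, \<beta>)\<leftarrow>ps. \<beta> * (X r \<omega> - X c \<omega>)) = (\<Sum>(r, \<beta>)\<leftarrow>ps. \<beta> * X r \<omega>) - (\<Sum>(r, \<beta>)\<leftarrow>ps. \<beta>) * X c \<omega>"
    by (induction ps) (auto simp: algebra_simps)
  note eq = this
  show ?thesis unfolding incrs_def trig_def e_def exp_add[symmetric] eq by (simp add: algebra_simps)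
qed

lemma bounded_rv_incrs: "bounded_rv (incrs c ps)"
  unfolding incrs_eq_trig[abs_def] by (intro bounded_rv_intros bounded_rv_trig)

text \<open>In time order, all frequencies travel together from \<open>c\<close> to the first time
  \<open>r\<close>, giving one increment of their total frequency; the rest starts anew at
  \<open>r\<close>.\<close>

lemma future_sorted:
  assumes "0 \<le> c" "sorted (map fst ps)" "\<And>p. p \<in> set ps \<Longrightarrow> c \<le> fst p"
  shows "future c (incrs c ps)"
  using assms
proof (induction ps arbitrary: c)
  case Nil
  then show ?case by (auto simp: future_def incrs_def bounded_rv_const prob_space)
next
  case (Cons p ps)
  define r where "r = fst p"
  \<comment> \<open>The total frequency carried by the first increment, from \<open>c\<close> to
    \<open>r\<close>.\<close>
  define s where "s = (\<Sum>(r, \<beta>)\<leftarrow>p # ps. \<beta>)"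
  have r: "c \<le> r" using Cons.prems(3)[of p] by (simp add: r_def)
  have IH: "future r (incrs r ps)"
    using Cons.prems order_trans[OF Cons.prems(1) r] by (intro Cons.IH) (auto simp: r_def)
  have split: "incrs c (p # ps) \<omega> = e (- s) c \<omega> * e s r \<omega> * incrs r ps \<omega>" for \<omega>
    unfolding incrs_eq_trig s_def
    by (cases p) (simp add: r_def trig_def e_def exp_add[symmetric] algebra_simps)
  have fact: "expectation (\<lambda>\<omega>. V \<omega> * incrs c (p # ps) \<omega>) = expectation V * ph s r c * expectation (incrs r ps)"
    if V: "past c V" for V
  proof -
    have P: "past r (\<lambda>\<omega>. V \<omega> * e (- s) c \<omega> * e s r \<omega>)"
      using r Cons.prems(1) by (intro past_e[of r] past_e[OF V]) auto
    have "expectation (\<lambda>\<omega>. V \<omega> * incrs c (p # ps) \<omega>) = expectation (\<lambda>\<omega>. (V \<omega> * e (- s) c \<omega> * e s r \<omega>) * incrs r ps \<omega>)"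
      by (simp add: split mult.assoc)
    also have "\<dots> = expectation (\<lambda>\<omega>. V \<omega> * e (- s) c \<omega> * e s r \<omega>) * expectation (incrs r ps)"
      using IH P unfolding future_def by blast
    also have "expectation (\<lambda>\<omega>. V \<omega> * e (- s) c \<omega> * e s r \<omega>) = expectation (\<lambda>\<omega>. V \<omega> * incr s r c \<omega>)"
      by (intro Bochner_Integration.integral_cong) (auto simp: e_def incr_def exp_add[symmetric] algebra_simps)
    also have "\<dots> = expectation V * ph s r c" by (rule past_increment[OF V order_refl r])
    finally show ?thesis .
  qed
  have "expectation (incrs c (p # ps)) = ph s r c * expectation (incrs r ps)"
    using fact[OF past_one[OF Cons.prems(1)]] by (simp add: prob_space)
  then show ?case using fact by (auto simp: future_def bounded_rv_incrs)
qed

text \<open>The exponent is a sum over the entries of the list, so the list may be sorted by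
  time.\<close>

lemma future_incrs:
  assumes "0 \<le> c" "\<And>p. p \<in> set ps \<Longrightarrow> c \<le> fst p"
  shows "future c (incrs c ps)"
proof -
  let ?qs = "sort_key fst ps"
  have "incrs c ?qs = incrs c ps"
    unfolding incrs_def by (intro ext arg_cong[where f="\<lambda>x. iexp x"])
      (simp flip: sum_mset_sum_list)
  moreover have "future c (incrs c ?qs)" using assms by (intro future_sorted) auto
  ultimately show ?thesis by simp
qed

lemma future_integral:
  fixes h :: "real \<Rightarrow> 'a \<Rightarrow> complex"
  assumes h: "(\<lambda>p. h (fst p) (snd p)) \<in> borel_measurable (borel \<Otimes>\<^sub>M M)"
    and B: "\<And>r \<omega>. r \<in> {a..b} \<Longrightarrow> \<omega> \<in> space M \<Longrightarrow> cmod (h r \<omega>) \<le> B" and ab: "a \<le> b"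
    and F: "\<And>r. r \<in> {a..b} \<Longrightarrow> future c (h r)"
  shows "future c (\<lambda>\<omega>. LINT r:{a..b}|lborel. h r \<omega>)"
  unfolding future_def
proof (intro conjI allI impI)
  have sec: "(\<lambda>r. h r \<omega>) \<in> borel_measurable borel" if "\<omega> \<in> space M" for \<omega>
    using measurable_compose[OF measurable_Pair[OF measurable_ident measurable_const[OF that]] h] by simp
  show "bounded_rv (\<lambda>\<omega>. LINT r:{a..b}|lborel. h r \<omega>)"
    by (rule bounded_rvI, rule expectation_set_integral(2)[OF h], rule B, assumption, assumption,
        rule norm_set_integral_Icc_le[OF sec _ ab], assumption, rule B)
  fix V assume V: "past c V"
  note [measurable] = bounded_rv_measurable[OF past_bounded[OF V]] h
  obtain C where C: "\<And>\<omega>. \<omega> \<in> space M \<Longrightarrow> cmod (V \<omega>) \<le> C" using past_bounded[OF V] by (auto simp: bounded_rv_def)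
  have "expectation (\<lambda>\<omega>. V \<omega> * (LINT r:{a..b}|lborel. h r \<omega>)) = expectation (\<lambda>\<omega>. LINT r:{a..b}|lborel. V \<omega> * h r \<omega>)" by simp
  also have "\<dots> = (LINT r:{a..b}|lborel. expectation (\<lambda>\<omega>. V \<omega> * h r \<omega>))"
  proof (rule expectation_set_integral(1)[where B="C * B"])
    show "cmod (V \<omega> * h r \<omega>) \<le> C * B" if "r \<in> {a..b}" "\<omega> \<in> space M" for r \<omega>
      unfolding norm_mult using C[OF that(2)] B[OF that] by (intro mult_mono) (auto intro: order_trans[OF norm_ge_zero])
  qed measurable
  also have "\<dots> = (LINT r:{a..b}|lborel. expectation V * expectation (h r))"
    by (rule set_lebesgue_integral_cong) (use F V in \<open>auto simp: future_def\<close>)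
  also have "\<dots> = expectation V * (LINT r:{a..b}|lborel. expectation (h r))" by simp
  also have "(LINT r:{a..b}|lborel. expectation (h r)) = expectation (\<lambda>\<omega>. LINT r:{a..b}|lborel. h r \<omega>)"
    by (rule expectation_set_integral(1)[OF h B, symmetric])
  finally show "expectation (\<lambda>\<omega>. V \<omega> * (LINT r:{a..b}|lborel. h r \<omega>)) = expectation V * expectation (\<lambda>\<omega>. LINT r:{a..b}|lborel. h r \<omega>)" .
qed

text \<open>The frequencies \<alpha>, -\<alpha>, \<alpha>, -\<alpha> add up to zero, so the product
  depends only on increments from \<open>c\<close>. The three integrations are performed one after
  the other.\<close>

lemma future_cubic:
  assumes c: "0 \<le> c" "c \<le> b"
  shows "future c (\<lambda>\<omega>. e \<alpha> c \<omega> * G (- \<alpha>) c b \<omega> * G \<alpha> c b \<omega> * G (- \<alpha>) c b \<omega>)"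
proof -
  have 0: "future c (\<lambda>\<omega>. e \<alpha> c \<omega> * e (- \<alpha>) x \<omega> * e \<alpha> y \<omega> * e (- \<alpha>) z \<omega>)"
    if "x \<in> {c..b}" "y \<in> {c..b}" "z \<in> {c..b}" for x y z
  proof -
    have "incrs c [(x, - \<alpha>), (y, \<alpha>), (z, - \<alpha>)] = (\<lambda>\<omega>. e \<alpha> c \<omega> * e (- \<alpha>) x \<omega> * e \<alpha> y \<omega> * e (- \<alpha>) z \<omega>)"
      by (intro ext) (simp add: incrs_def e_def exp_add[symmetric] algebra_simps)
    moreover have "future c (incrs c [(x, - \<alpha>), (y, \<alpha>), (z, - \<alpha>)])"
      using c that by (intro future_incrs) auto
    ultimately show ?thesis by simp
  qed
  have 1: "future c (\<lambda>\<omega>. e \<alpha> c \<omega> * e (- \<alpha>) x \<omega> * e \<alpha> y \<omega> * G (- \<alpha>) c b \<omega>)" if "x \<in> {c..b}" "y \<in> {c..b}" for x y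
  proof -
    have "future c (\<lambda>\<omega>. LINT z:{c..b}|lborel. e \<alpha> c \<omega> * e (- \<alpha>) x \<omega> * e \<alpha> y \<omega> * e (- \<alpha>) z \<omega>)"
      using c that by (intro future_integral[where B=1] 0) (auto simp: norm_mult)
    then show ?thesis by (simp add: G_def)
  qed
  have 2: "future c (\<lambda>\<omega>. e \<alpha> c \<omega> * e (- \<alpha>) x \<omega> * G \<alpha> c b \<omega> * G (- \<alpha>) c b \<omega>)" if "x \<in> {c..b}" for x
  proof -
    have "future c (\<lambda>\<omega>. LINT y:{c..b}|lborel. e \<alpha> c \<omega> * e (- \<alpha>) x \<omega> * e \<alpha> y \<omega> * G (- \<alpha>) c b \<omega>)"
      using c that by (intro future_integral[where B="b - c"] 1) (auto simp: norm_mult intro: cmod_G_le)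
    then show ?thesis by (simp add: G_def[of \<alpha>])
  qed
  have "future c (\<lambda>\<omega>. LINT x:{c..b}|lborel. e \<alpha> c \<omega> * e (- \<alpha>) x \<omega> * G \<alpha> c b \<omega> * G (- \<alpha>) c b \<omega>)"
    using c by (intro future_integral[where B="(b - c) * (b - c)"] 2)
      (auto simp: norm_mult intro!: mult_mono cmod_G_le)
  then show ?thesis by (simp add: G_def[of "- \<alpha>", symmetric])
qed

end

section \<open>Fourth moments\<close>

lemma ln_one_plus_le_sqrt:
  fixes h :: real assumes "0 \<le> h" shows "ln (1 + h) \<le> 2 * sqrt h"
proof -
  have "ln (1 + h) = 2 * ln (sqrt (1 + h))" using assms by (simp add: ln_sqrt)
  also have "ln (sqrt (1 + h)) \<le> sqrt (1 + h) - 1" using assms by (intro ln_le_minus_one) auto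
  also have "sqrt (1 + h) \<le> 1 + sqrt h" using sqrt_add_le_add_sqrt[of 1 h] assms by simp
  finally show ?thesis by simp
qed

text \<open>The square of Re (A * cnj B) is absorbed into |A|^2 |B|^2, but the terms linear in it
  keep their sign, because the gain comes from cancellation in their expectation.\<close>

lemma cmod_add_pow4_le:
  "cmod (A + B) ^ 4 \<le> cmod A ^ 4 + cmod B ^ 4 + 6 * ((cmod A)\<^sup>2 * (cmod B)\<^sup>2)
     + 4 * ((cmod A)\<^sup>2 * Re (A * cnj B)) + 4 * ((cmod B)\<^sup>2 * Re (A * cnj B))"
proof -
  define p q u where "p = (cmod A)\<^sup>2" and "q = (cmod B)\<^sup>2" and "u = Re (A * cnj B)"
  have "\<bar>u\<bar> \<le> cmod A * cmod B"
    unfolding u_def using abs_Re_le_cmod[of "A * cnj B"] by (simp add: norm_mult)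
  then have "u\<^sup>2 \<le> (cmod A * cmod B)\<^sup>2" by (metis abs_le_square_iff abs_of_nonneg norm_ge_zero mult_nonneg_nonneg)
  then have u: "u\<^sup>2 \<le> p * q" by (simp add: p_def q_def power_mult_distrib)
  have "(cmod (A + B))\<^sup>2 = p + q + 2 * u"
    unfolding p_def q_def u_def cmod_power2 by (simp add: power2_eq_square algebra_simps)
  moreover have "cmod (A + B) ^ 4 = ((cmod (A + B))\<^sup>2)\<^sup>2" by (simp flip: power_mult)
  ultimately have "cmod (A + B) ^ 4 = (p + q + 2 * u)\<^sup>2" by simp
  also have "\<dots> = p\<^sup>2 + q\<^sup>2 + 2 * (p * q) + 4 * u\<^sup>2 + 4 * (p * u) + 4 * (q * u)"
    by (simp add: power2_eq_square algebra_simps)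
  also have "\<dots> \<le> p\<^sup>2 + q\<^sup>2 + 6 * (p * q) + 4 * (p * u) + 4 * (q * u)" using u by linarith
  also have "p\<^sup>2 = cmod A ^ 4" by (simp add: p_def flip: power_mult)
  also have "q\<^sup>2 = cmod B ^ 4" by (simp add: q_def flip: power_mult)
  finally show ?thesis by (simp add: p_def q_def u_def)
qed

context osc_process
begin

lemma integrable_cmod_G_power: "a \<le> b \<Longrightarrow> integrable M (\<lambda>\<omega>. cmod (G \<alpha> a b \<omega>) ^ n)"
  by (rule integrable_const_bound[where B="(b - a) ^ n"]) (auto intro!: AE_I2 power_mono cmod_G_le)

text \<open>Young's inequality in the form of the perfect square (x * (x - 4 * \<eta>))^2 / 2. The
  fourth moment returns with factor 1/2, which is the source of the factor 3/2 in the doubling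
  step.\<close>

lemma cubic_absorb:
  fixes \<eta> :: real assumes "a \<le> b"
  shows "4 * (expectation (\<lambda>\<omega>. cmod (G \<alpha> a b \<omega>) ^ 3) * \<eta>) \<le>
    expectation (\<lambda>\<omega>. cmod (G \<alpha> a b \<omega>) ^ 4) / 2 + 8 * \<eta>\<^sup>2 * expectation (\<lambda>\<omega>. (cmod (G \<alpha> a b \<omega>))\<^sup>2)"
proof -
  note i = integrable_cmod_G_power[OF assms]
  have "expectation (\<lambda>\<omega>. (4 * \<eta>) * cmod (G \<alpha> a b \<omega>) ^ 3) \<le>
     expectation (\<lambda>\<omega>. (1/2) * cmod (G \<alpha> a b \<omega>) ^ 4 + (8 * \<eta>\<^sup>2) * (cmod (G \<alpha> a b \<omega>))\<^sup>2)"
  proof (rule integral_mono)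
    fix \<omega>
    define x where "x = cmod (G \<alpha> a b \<omega>)"
    have "0 \<le> (1/2) * (x * (x - 4 * \<eta>))\<^sup>2" by simp
    also have "\<dots> = (1/2) * x ^ 4 + (8 * \<eta>\<^sup>2) * x\<^sup>2 - (4 * \<eta>) * x ^ 3"
      by (simp add: power2_eq_square power4_eq_xxxx power3_eq_cube algebra_simps)
    finally show "(4 * \<eta>) * cmod (G \<alpha> a b \<omega>) ^ 3 \<le> (1/2) * cmod (G \<alpha> a b \<omega>) ^ 4 + (8 * \<eta>\<^sup>2) * (cmod (G \<alpha> a b \<omega>))\<^sup>2"
      unfolding x_def by linarith
  qed (intro integrable_mult_right Bochner_Integration.integrable_add i)+
  then show ?thesis using i by (simp add: mult.commute mult.left_commute)
qed

text \<open>|A|^2 and |B|^2 are uncorrelated, which gives 24 = 6 * 2 * 2 from the second moments.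
  Each of the two cubic mixed terms is a third moment times a mean of size
  \<open>log_bound K h\<close>; absorption leaves 8 * 2 = 16 for each, together 32.\<close>

lemma fourth_moment_doubling:
  assumes K: "mean_decay \<alpha> K" and ac: "0 \<le> a" "a \<le> c" "c \<le> b" and h: "c - a = h" "b - c = h"
  shows "expectation (\<lambda>\<omega>. cmod (G \<alpha> a b \<omega>) ^ 4) \<le>
    3/2 * (expectation (\<lambda>\<omega>. cmod (G \<alpha> a c \<omega>) ^ 4) + expectation (\<lambda>\<omega>. cmod (G \<alpha> c b \<omega>) ^ 4))
    + 24 * K\<^sup>2 * h\<^sup>2 + 32 * K * h * (log_bound K h)\<^sup>2"
proof -
  let ?A = "G \<alpha> a c" and ?B = "G \<alpha> c b" and ?A' = "G (- \<alpha>) a c" and ?B' = "G (- \<alpha>) c b"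
  let ?\<eta> = "log_bound K h"
  have K0: "0 \<le> K" and h0: "0 \<le> h" using K h ac by (auto simp: mean_decay_def)
  have K': "mean_decay (- \<alpha>) K" using K by (simp add: mean_decay_minus)
  have c0: "0 \<le> c" using ac by simp
  note iA = integrable_cmod_G_power[OF ac(2), of \<alpha>] and iB = integrable_cmod_G_power[OF ac(3), of \<alpha>]
  have bA: "bounded_rv ?A" "bounded_rv ?A'" and bB: "bounded_rv ?B" "bounded_rv ?B'"
    using ac by (auto intro: bounded_rv_G)
  have pA: "past c (\<lambda>\<omega>. 1 * ?A \<omega>)" and pA2: "past c (\<lambda>\<omega>. 1 * ?A \<omega> * ?A' \<omega>)" and pA3: "past c (\<lambda>\<omega>. 1 * ?A \<omega> * ?A' \<omega> * ?A \<omega>)"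
    by (intro past_G past_one c0 ac order_refl)+
  \<comment> \<open>In |A|^2 and |B|^2 opposite frequencies meet, so no rotation links the two
    blocks.\<close>
  have c2: "expectation (\<lambda>\<omega>. (cmod (?A \<omega>))\<^sup>2 * (cmod (?B \<omega>))\<^sup>2) = expectation (\<lambda>\<omega>. (cmod (?A \<omega>))\<^sup>2) * expectation (\<lambda>\<omega>. (cmod (?B \<omega>))\<^sup>2)"
  proof -
    have "complex_of_real (expectation (\<lambda>\<omega>. (cmod (?A \<omega>))\<^sup>2 * (cmod (?B \<omega>))\<^sup>2)) =
        expectation (\<lambda>\<omega>. (1 * ?A \<omega> * ?A' \<omega>) * ?B \<omega> * ?B' \<omega>)"
      unfolding integral_complex_of_real[symmetric] of_real_mult cmod_G_sq by (simp add: mult.assoc)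
    also have "\<dots> = expectation (\<lambda>\<omega>. 1 * ?A \<omega> * ?A' \<omega>) * S \<alpha> c b"
      by (rule expectation_G_G_opposite[OF pA2 c0 ac(3)])
    also have "S \<alpha> c b = expectation (\<lambda>\<omega>. 1 * ?B \<omega> * ?B' \<omega>)"
      using expectation_G_G_opposite[OF past_one[OF c0] c0 ac(3), of \<alpha>] by (simp add: prob_space)
    also have "expectation (\<lambda>\<omega>. 1 * ?A \<omega> * ?A' \<omega>) * expectation (\<lambda>\<omega>. 1 * ?B \<omega> * ?B' \<omega>) =
        complex_of_real (expectation (\<lambda>\<omega>. (cmod (?A \<omega>))\<^sup>2) * expectation (\<lambda>\<omega>. (cmod (?B \<omega>))\<^sup>2))"
      unfolding of_real_mult integral_complex_of_real[symmetric] cmod_G_sq by simp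
    finally show ?thesis unfolding of_real_eq_iff .
  qed
  have m2: "expectation (\<lambda>\<omega>. (cmod (?A \<omega>))\<^sup>2) \<le> 2 * K * h" "expectation (\<lambda>\<omega>. (cmod (?B \<omega>))\<^sup>2) \<le> 2 * K * h"
    using second_moment[OF K ac(1,2)] second_moment[OF K c0 ac(3)] h by auto
  have i22: "integrable M (\<lambda>\<omega>. (cmod (?A \<omega>))\<^sup>2 * (cmod (?B \<omega>))\<^sup>2)"
  proof -
    have "(\<lambda>\<omega>. (cmod (?A \<omega>))\<^sup>2 * (cmod (?B \<omega>))\<^sup>2) = (\<lambda>\<omega>. cmod (?A \<omega> * ?A \<omega> * (?B \<omega> * ?B \<omega>)))"
      by (auto simp: norm_mult power2_eq_square)
    then show ?thesis by (simp only:) (intro integrable_norm bounded_rv_integrable bounded_rv_mult bA bB)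
  qed
  have e2: "expectation (\<lambda>\<omega>. (cmod (?A \<omega>))\<^sup>2 * (cmod (?B \<omega>))\<^sup>2) \<le> (2 * K * h) * (2 * K * h)"
    unfolding c2 using m2 K0 h0 by (intro mult_mono) auto
  \<comment> \<open>Two groupings into a past and a later factor: in \<open>P1\<close> the later
    block has degree one. In \<open>P2\<close> the earlier one has, and inserting
    \<open>e (- \<alpha>) c \<omega> * e \<alpha> c \<omega> = 1\<close> turns its cubic partner
    into a functional of the future.\<close>
  define P1 where "P1 \<omega> = (1 * ?A \<omega> * ?A' \<omega> * ?A \<omega>) * ?B' \<omega>" for \<omega>
  define P2 where "P2 \<omega> = (1 * ?A \<omega> * e (- \<alpha>) c \<omega>) * (e \<alpha> c \<omega> * ?B' \<omega> * ?B \<omega> * ?B' \<omega>)" for \<omega>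
  have bP: "bounded_rv P1" "bounded_rv P2"
    unfolding P1_def P2_def by (intro bounded_rv_intros bA bB ac)+
  have P1: "(cmod (?A \<omega>))\<^sup>2 * Re (?A \<omega> * cnj (?B \<omega>)) = Re (P1 \<omega>)" for \<omega>
  proof -
    have "complex_of_real ((cmod (?A \<omega>))\<^sup>2) * (?A \<omega> * cnj (?B \<omega>)) = P1 \<omega>"
      unfolding cmod_G_sq cnj_G P1_def by (simp add: mult_ac)
    from arg_cong[OF this, of Re] show ?thesis by simp
  qed
  have e0: "e (- \<alpha>) c \<omega> * e \<alpha> c \<omega> = 1" for \<omega> by (simp add: e_mult)
  have P2: "(cmod (?B \<omega>))\<^sup>2 * Re (?A \<omega> * cnj (?B \<omega>)) = Re (P2 \<omega>)" for \<omega>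
  proof -
    have "P2 \<omega> = (e (- \<alpha>) c \<omega> * e \<alpha> c \<omega>) * ((?B \<omega> * ?B' \<omega>) * (?A \<omega> * ?B' \<omega>))"
      unfolding P2_def by (simp only: mult_ac mult_1_left mult_1_right)
    then have "complex_of_real ((cmod (?B \<omega>))\<^sup>2) * (?A \<omega> * cnj (?B \<omega>)) = P2 \<omega>"
      unfolding cmod_G_sq cnj_G e0 by simp
    from arg_cong[OF this, of Re] show ?thesis by simp
  qed
  have eP1: "expectation (\<lambda>\<omega>. Re (P1 \<omega>)) \<le> expectation (\<lambda>\<omega>. cmod (?A \<omega>) ^ 3) * ?\<eta>"
  proof -
    have "expectation (\<lambda>\<omega>. Re (P1 \<omega>)) \<le> cmod (expectation P1)"
      using bounded_rv_integrable[OF bP(1)] complex_Re_le_cmod[of "expectation P1"] by simp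
    also have "\<dots> \<le> expectation (\<lambda>\<omega>. cmod (1 * ?A \<omega> * ?A' \<omega> * ?A \<omega>)) * log_bound K (b - c)"
      unfolding P1_def by (rule first_moment_L1[OF K' pA3 c0 ac(3)])
    also have "(\<lambda>\<omega>. cmod (1 * ?A \<omega> * ?A' \<omega> * ?A \<omega>)) = (\<lambda>\<omega>. cmod (?A \<omega>) ^ 3)"
      by (auto simp: norm_mult power3_eq_cube cnj_G[symmetric])
    finally show ?thesis by (simp add: h)
  qed
  have eP2: "expectation (\<lambda>\<omega>. Re (P2 \<omega>)) \<le> expectation (\<lambda>\<omega>. cmod (?B \<omega>) ^ 3) * ?\<eta>"
  proof -
    let ?H = "\<lambda>\<omega>. e \<alpha> c \<omega> * ?B' \<omega> * ?B \<omega> * ?B' \<omega>"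
    have "past c (\<lambda>\<omega>. 1 * ?A \<omega> * e (- \<alpha>) c \<omega>)" by (intro past_e[OF pA] c0 order_refl)
    then have eq: "expectation P2 = expectation (\<lambda>\<omega>. 1 * ?A \<omega> * e (- \<alpha>) c \<omega>) * expectation ?H"
      using future_cubic[OF c0 ac(3), of \<alpha>] unfolding future_def P2_def by blast
    have "expectation (\<lambda>\<omega>. Re (P2 \<omega>)) \<le> cmod (expectation P2)"
      using bounded_rv_integrable[OF bP(2)] complex_Re_le_cmod[of "expectation P2"] by simp
    also have "\<dots> \<le> log_bound K (c - a) * expectation (\<lambda>\<omega>. cmod (?H \<omega>))"
      unfolding eq norm_mult[of "expectation _"]
    proof (rule mult_mono)
      show "cmod (expectation (\<lambda>\<omega>. 1 * ?A \<omega> * e (- \<alpha>) c \<omega>)) \<le> log_bound K (c - a)"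
        using first_moment_backward[OF K ac(1,2)] by simp
      show "cmod (expectation ?H) \<le> expectation (\<lambda>\<omega>. cmod (?H \<omega>))" by (rule integral_norm_bound)
    qed (use K0 h0 h in \<open>auto intro: log_bound_nonneg\<close>)
    also have "(\<lambda>\<omega>. cmod (?H \<omega>)) = (\<lambda>\<omega>. cmod (?B \<omega>) ^ 3)"
      by (auto simp: norm_mult power3_eq_cube cnj_G[symmetric])
    finally show ?thesis by (simp add: h mult.commute)
  qed
  have "expectation (\<lambda>\<omega>. cmod (G \<alpha> a b \<omega>) ^ 4) \<le> expectation (\<lambda>\<omega>. cmod (?A \<omega>) ^ 4 + cmod (?B \<omega>) ^ 4
     + 6 * ((cmod (?A \<omega>))\<^sup>2 * (cmod (?B \<omega>))\<^sup>2) + 4 * Re (P1 \<omega>) + 4 * Re (P2 \<omega>))"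
  proof (rule integral_mono)
    show "integrable M (\<lambda>\<omega>. cmod (G \<alpha> a b \<omega>) ^ 4)" using ac by (intro integrable_cmod_G_power) auto
    show "integrable M (\<lambda>\<omega>. cmod (?A \<omega>) ^ 4 + cmod (?B \<omega>) ^ 4
      + 6 * ((cmod (?A \<omega>))\<^sup>2 * (cmod (?B \<omega>))\<^sup>2) + 4 * Re (P1 \<omega>) + 4 * Re (P2 \<omega>))"
      by (intro Bochner_Integration.integrable_add integrable_mult_right iA iB i22 integrable_Re bounded_rv_integrable bP)
    fix \<omega> assume \<omega>: "\<omega> \<in> space M"
    show "cmod (G \<alpha> a b \<omega>) ^ 4 \<le> cmod (?A \<omega>) ^ 4 + cmod (?B \<omega>) ^ 4
      + 6 * ((cmod (?A \<omega>))\<^sup>2 * (cmod (?B \<omega>))\<^sup>2) + 4 * Re (P1 \<omega>) + 4 * Re (P2 \<omega>)"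
      unfolding G_split[OF \<omega> ac(2,3)] P1[symmetric] P2[symmetric] by (rule cmod_add_pow4_le)
  qed
  also have "\<dots> = expectation (\<lambda>\<omega>. cmod (?A \<omega>) ^ 4) + expectation (\<lambda>\<omega>. cmod (?B \<omega>) ^ 4)
     + 6 * expectation (\<lambda>\<omega>. (cmod (?A \<omega>))\<^sup>2 * (cmod (?B \<omega>))\<^sup>2) + 4 * expectation (\<lambda>\<omega>. Re (P1 \<omega>)) + 4 * expectation (\<lambda>\<omega>. Re (P2 \<omega>))"
    using iA[of 4] iB[of 4] i22 integrable_Re[OF bounded_rv_integrable[OF bP(1)]] integrable_Re[OF bounded_rv_integrable[OF bP(2)]]
    by simp
  also have "\<dots> \<le> expectation (\<lambda>\<omega>. cmod (?A \<omega>) ^ 4) + expectation (\<lambda>\<omega>. cmod (?B \<omega>) ^ 4)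
     + 6 * ((2 * K * h) * (2 * K * h))
     + (expectation (\<lambda>\<omega>. cmod (?A \<omega>) ^ 4) / 2 + 8 * ?\<eta>\<^sup>2 * (2 * K * h))
     + (expectation (\<lambda>\<omega>. cmod (?B \<omega>) ^ 4) / 2 + 8 * ?\<eta>\<^sup>2 * (2 * K * h))"
  proof (intro add_mono order_refl mult_left_mono e2)
    show "4 * expectation (\<lambda>\<omega>. Re (P1 \<omega>)) \<le> expectation (\<lambda>\<omega>. cmod (?A \<omega>) ^ 4) / 2 + 8 * ?\<eta>\<^sup>2 * (2 * K * h)"
    proof -
      have "8 * ?\<eta>\<^sup>2 * expectation (\<lambda>\<omega>. (cmod (?A \<omega>))\<^sup>2) \<le> 8 * ?\<eta>\<^sup>2 * (2 * K * h)"
        by (intro mult_left_mono m2) simp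
      then show ?thesis using eP1 cubic_absorb[OF ac(2), of \<alpha> ?\<eta>] by linarith
    qed
    show "4 * expectation (\<lambda>\<omega>. Re (P2 \<omega>)) \<le> expectation (\<lambda>\<omega>. cmod (?B \<omega>) ^ 4) / 2 + 8 * ?\<eta>\<^sup>2 * (2 * K * h)"
    proof -
      have "8 * ?\<eta>\<^sup>2 * expectation (\<lambda>\<omega>. (cmod (?B \<omega>))\<^sup>2) \<le> 8 * ?\<eta>\<^sup>2 * (2 * K * h)"
        by (intro mult_left_mono m2) simp
      then show ?thesis using eP2 cubic_absorb[OF ac(3), of \<alpha> ?\<eta>] by linarith
    qed
  qed simp
  also have "\<dots> = 3/2 * (expectation (\<lambda>\<omega>. cmod (?A \<omega>) ^ 4) + expectation (\<lambda>\<omega>. cmod (?B \<omega>) ^ 4))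
    + 24 * K\<^sup>2 * h\<^sup>2 + 32 * K * h * ?\<eta>\<^sup>2"
    by (simp add: power2_eq_square algebra_simps)
  finally show ?thesis .
qed

text \<open>Induction on the scale 2^n. Intervals of length at most 1 are covered by the trivial
  bound, since x^4 is at most x^2 there. A doubling gives 3 D h^2 + E h^2, which is at most 4 D h^2
  as soon as D is at least E.\<close>

lemma fourth_moment:
  assumes K: "mean_decay \<alpha> K"
  obtains D where "0 \<le> D" "\<And>a b. 0 \<le> a \<Longrightarrow> a \<le> b \<Longrightarrow> expectation (\<lambda>\<omega>. cmod (G \<alpha> a b \<omega>) ^ 4) \<le> D * (b - a)\<^sup>2"
proof
  have K0: "0 \<le> K" using K by (simp add: mean_decay_def)
  \<comment> \<open>24 K^2 comes from the second moments; 128 = 32 * 4, where the 4 is the square of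
    the constant in ln (1 + h) <= 2 sqrt h.\<close>
  define E where "E = 24 * K\<^sup>2 + 128 * K * (1 + 2 * K)\<^sup>2"
  define D where "D = 1 + E"
  have E0: "0 \<le> E" using K0 by (simp add: E_def)
  show "0 \<le> D" using E0 by (simp add: D_def)
  have step: "\<forall>a b. 0 \<le> a \<longrightarrow> a \<le> b \<longrightarrow> b - a \<le> 2 ^ n \<longrightarrow> expectation (\<lambda>\<omega>. cmod (G \<alpha> a b \<omega>) ^ 4) \<le> D * (b - a)\<^sup>2" for n
  proof (induction n)
    case 0
    show ?case
    proof (intro allI impI)
      fix a b :: real assume ab: "0 \<le> a" "a \<le> b" "b - a \<le> 2 ^ 0"
      have "expectation (\<lambda>\<omega>. cmod (G \<alpha> a b \<omega>) ^ 4) \<le> expectation (\<lambda>\<omega>. (b - a) ^ 4)"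
        using ab by (intro integral_mono integrable_cmod_G_power power_mono cmod_G_le) auto
      also have "\<dots> = (b - a)\<^sup>2 * (b - a)\<^sup>2" by (simp add: prob_space flip: power_add)
      also have "\<dots> \<le> D * (b - a)\<^sup>2"
        using ab E0 power_mono[of "b - a" 1 2] by (intro mult_right_mono) (auto simp: D_def)
      finally show "expectation (\<lambda>\<omega>. cmod (G \<alpha> a b \<omega>) ^ 4) \<le> D * (b - a)\<^sup>2" .
    qed
  next
    case (Suc n)
    show ?case
    proof (intro allI impI)
      fix a b :: real assume ab: "0 \<le> a" "a \<le> b" "b - a \<le> 2 ^ Suc n"
      define h where "h = (b - a) / 2"
      define c where "c = a + h"
      have c: "0 \<le> c" "a \<le> c" "c \<le> b" "c - a = h" "b - c = h" "h \<le> 2 ^ n" "0 \<le> h"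
        using ab by (auto simp: c_def h_def field_simps)
      have IH: "expectation (\<lambda>\<omega>. cmod (G \<alpha> a c \<omega>) ^ 4) \<le> D * h\<^sup>2" "expectation (\<lambda>\<omega>. cmod (G \<alpha> c b \<omega>) ^ 4) \<le> D * h\<^sup>2"
        using Suc.IH[rule_format, of a c] Suc.IH[rule_format, of c b] c ab by auto
      have "(log_bound K h)\<^sup>2 \<le> ((1 + 2 * K) * (2 * sqrt h))\<^sup>2"
        unfolding log_bound_def using c K0
        by (intro power_mono mult_left_mono ln_one_plus_le_sqrt) auto
      also have "\<dots> = 4 * (1 + 2 * K)\<^sup>2 * h" using c by (simp add: power_mult_distrib)
      finally have lb: "32 * K * h * (log_bound K h)\<^sup>2 \<le> 32 * K * h * (4 * (1 + 2 * K)\<^sup>2 * h)"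
        using K0 c by (intro mult_left_mono) auto
      have "expectation (\<lambda>\<omega>. cmod (G \<alpha> a b \<omega>) ^ 4) \<le> 3/2 * (D * h\<^sup>2 + D * h\<^sup>2) + 24 * K\<^sup>2 * h\<^sup>2 + 32 * K * h * (4 * (1 + 2 * K)\<^sup>2 * h)"
        by (rule order_trans[OF fourth_moment_doubling[OF K ab(1) c(2-5)]]) (intro add_mono mult_left_mono IH lb; simp)
      also have "\<dots> = 3 * D * h\<^sup>2 + E * h\<^sup>2" by (simp add: E_def power2_eq_square algebra_simps)
      also have "\<dots> \<le> 3 * D * h\<^sup>2 + D * h\<^sup>2" by (simp add: D_def mult_right_mono)
      also have "\<dots> = D * (b - a)\<^sup>2" by (simp add: h_def power_divide)
      finally show "expectation (\<lambda>\<omega>. cmod (G \<alpha> a b \<omega>) ^ 4) \<le> D * (b - a)\<^sup>2" .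
    qed
  qed
  fix a b :: real assume ab: "0 \<le> a" "a \<le> b"
  obtain n where "b - a < 2 ^ n" using real_arch_pow[of 2 "b - a"] by auto
  then show "expectation (\<lambda>\<omega>. cmod (G \<alpha> a b \<omega>) ^ 4) \<le> D * (b - a)\<^sup>2" using step[of n] ab by auto
qed

end

context osc_process
begin

lemma past_cong:
  assumes "past a V" "\<And>\<omega>. \<omega> \<in> space M \<Longrightarrow> W \<omega> = V \<omega>" shows "past a W"
proof (rule pastI)
  have "W \<in> borel_measurable M"
    using bounded_rv_measurable[OF past_bounded[OF assms(1)]] assms(2) by (simp cong: measurable_cong)
  then show "bounded_rv W" using past_bounded[OF assms(1)] assms(2) by (auto simp: bounded_rv_def)
  fix s t u and ps :: "(real \<times> real) list"
  assume "a \<le> s" "s \<le> t" "\<And>r \<beta>. (r, \<beta>) \<in> set ps \<Longrightarrow> 0 \<le> r \<and> r \<le> s"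
  from pastD[where ps=ps and u=u, OF assms(1) this]
  show "expectation (\<lambda>\<omega>. W \<omega> * trig ps \<omega> * incr u t s \<omega>) = expectation (\<lambda>\<omega>. W \<omega> * trig ps \<omega>) * ph u t s"
    using assms(2) by (simp cong: Bochner_Integration.integral_cong)
qed

lemma past_prod_exp_G:
  assumes V: "past a V" and cd: "0 \<le> c" "c \<le> d" "d \<le> a" and "finite P"
  shows "past a (\<lambda>\<omega>. V \<omega> * (\<Prod>p\<in>P. exp (z p * G (\<alpha> p) c d \<omega>)))"
  using \<open>finite P\<close>
proof (induction P)
  case empty
  then show ?case using V by simp
next
  case (insert p P)
  have "past a (\<lambda>\<omega>. V \<omega> * (\<Prod>p\<in>P. exp (z p * G (\<alpha> p) c d \<omega>)) * exp (z p * G (\<alpha> p) c d \<omega>))"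
    by (intro past_exp_G insert.IH cd)
  then show ?case using insert by (simp add: ac_simps)
qed

lemma G_singleton: "G \<alpha> a a \<omega> = 0"
proof -
  have "AE x in lborel. x \<noteq> a" by (rule AE_I[where N="{a}"]) auto
  then show ?thesis
    unfolding G_def set_lebesgue_integral_def by (intro integral_eq_zero_AE) (auto elim: eventually_mono)
qed

lemma G_continuous:
  assumes \<omega>: "\<omega> \<in> space M" shows "continuous_on {0..} (\<lambda>t. G \<alpha> 0 t \<omega>)"
proof -
  have le: "dist (G \<alpha> 0 t \<omega>) (G \<alpha> 0 s \<omega>) \<le> \<bar>t - s\<bar>" if "0 \<le> s" "0 \<le> t" for s t
  proof -
    have *: "cmod (G \<alpha> 0 t \<omega> - G \<alpha> 0 s \<omega>) \<le> t - s" if "0 \<le> s" "s \<le> t" for s t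
      using G_split[OF \<omega> that, of \<alpha>] cmod_G_le[OF \<omega> that(2), of \<alpha>] by simp
    show ?thesis using *[of s t] *[of t s] that by (cases "s \<le> t") (auto simp: dist_norm norm_minus_commute)
  qed
  show ?thesis
    unfolding continuous_on_iff
  proof (intro ballI allI impI)
    fix x \<epsilon> :: real assume "x \<in> {0..}" "0 < \<epsilon>"
    then show "\<exists>d>0. \<forall>x'\<in>{0..}. dist x' x < d \<longrightarrow> dist (G \<alpha> 0 x' \<omega>) (G \<alpha> 0 x \<omega>) < \<epsilon>"
      using le by (intro exI[of _ \<epsilon>]) (auto simp: dist_real_def intro: le_less_trans)
  qed
qed

end

text \<open>Young's inequality with a free scale: for \<open>\<kappa>\<close> of the size of
  \<open>u\<close>, both terms have the order of the cube, so third moments follow from fourth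
  ones.\<close>

lemma abs_cube_le:
  fixes u \<kappa> :: real assumes "0 < \<kappa>"
  shows "\<bar>u\<bar> ^ 3 \<le> \<kappa> ^ 3 / 4 + 3/4 * u ^ 4 / \<kappa>"
proof -
  define x where "x = \<bar>u\<bar>"
  have x: "0 \<le> x" by (simp add: x_def)
  have "4 * (\<kappa> * x ^ 3) \<le> \<kappa> ^ 4 + 3 * x ^ 4"
  proof -
    have "\<kappa> ^ 4 + 3 * x ^ 4 - 4 * (\<kappa> * x ^ 3) = (x - \<kappa>)\<^sup>2 * (2 * x\<^sup>2 + (x + \<kappa>)\<^sup>2)"
      by (simp add: power2_eq_square power3_eq_cube power4_eq_xxxx algebra_simps)
    also have "0 \<le> \<dots>" by simp
    finally show ?thesis by simp
  qed
  moreover have "u ^ 4 = x ^ 4" by (simp add: x_def power_even_abs)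
  ultimately show ?thesis
    using assms unfolding x_def[symmetric] by (simp add: field_simps power4_eq_xxxx power3_eq_cube)
qed

text \<open>A fourth root instead of a square root: for h of order \<epsilon>^(-2), multiplication
  by \<epsilon> then leaves sqrt \<epsilon>, whereas a square root would leave a constant.\<close>

lemma ln_one_plus_le_sqrt_sqrt:
  fixes h :: real assumes "0 \<le> h" shows "ln (1 + h) \<le> 4 * sqrt (sqrt h)"
proof -
  define x where "x = 1 + sqrt h"
  have x: "0 < x" using assms by (simp add: x_def add_pos_nonneg)
  have le: "1 + h \<le> x\<^sup>2" using assms by (simp add: x_def power2_eq_square algebra_simps)
  have pos: "0 < 1 + h" "0 < x\<^sup>2" using assms x by simp_all
  have "ln (1 + h) \<le> ln (x\<^sup>2)" by (rule iffD2[OF ln_le_cancel_iff[OF pos] le])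
  also have "\<dots> = 2 * ln (1 + sqrt h)" using x ln_realpow[of x 2] by (simp add: x_def)
  also have "\<dots> \<le> 2 * (2 * sqrt (sqrt h))" using ln_one_plus_le_sqrt[of "sqrt h"] assms by simp
  finally show ?thesis by simp
qed

lemma iexp_taylor2:
  fixes u :: real
  shows "cmod (iexp u - (1 + \<i> * of_real u - (of_real u)\<^sup>2 / 2)) \<le> \<bar>u\<bar> ^ 3 / 6"
proof -
  have set: "{..2} = {0, 1, 2 :: nat}" by auto
  have "(\<Sum>k\<le>2. (\<i> * complex_of_real u) ^ k / fact k) = 1 + \<i> * of_real u - (of_real u)\<^sup>2 / 2"
    unfolding set by (simp add: power_mult_distrib)
  moreover have "Suc 2 = 3" "fact (3::nat) = (6::real)" by (simp_all add: fact_numeral)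
  ultimately show ?thesis using iexp_approx1[of u 2] by simp
qed

lemma norm_vec_sq: "(norm (v :: complex ^ 'm))\<^sup>2 = (\<Sum>j\<in>UNIV. (cmod (v $ j))\<^sup>2)"
  by (simp add: norm_vec_def L2_set_def sum_nonneg)

lemma norm_vec_pow4_le: "norm (v :: complex ^ 'm) ^ 4 \<le> real CARD('m) * (\<Sum>j\<in>UNIV. cmod (v $ j) ^ 4)"
proof -
  have "norm v ^ 4 = ((norm v)\<^sup>2)\<^sup>2" by (simp flip: power_mult)
  also have "\<dots> = (\<Sum>j\<in>UNIV. 1 * (cmod (v $ j))\<^sup>2)\<^sup>2" by (simp add: norm_vec_sq)
  also have "\<dots> \<le> (\<Sum>j\<in>(UNIV::'m set). 1\<^sup>2) * (\<Sum>j\<in>UNIV. ((cmod (v $ j))\<^sup>2)\<^sup>2)"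
    by (rule Cauchy_Schwarz_ineq_sum)
  finally show ?thesis by (simp flip: power_mult)
qed

section \<open>The rescaled process and its increments\<close>

locale osc_clt = osc_process M X for M :: "'a measure" and X :: "real \<Rightarrow> 'a \<Rightarrow> real" +
  fixes \<theta> :: "real ^ 'm" and cc K :: "'m \<Rightarrow> real" and T :: real
  assumes T: "0 < T" and decay: "\<And>j. mean_decay (\<theta> $ j) (K j)"
    and lim_S: "\<And>j s t. 0 \<le> s \<Longrightarrow> s < t \<Longrightarrow> t \<le> T \<Longrightarrow>
      ((\<lambda>\<epsilon>. of_real (\<epsilon>\<^sup>2 * (cc j)\<^sup>2) * S (\<theta> $ j) (2 * s / \<epsilon>\<^sup>2) (2 * t / \<epsilon>\<^sup>2)) \<longlongrightarrow> of_real (2 * (t - s))) (at_right 0)"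
    and lim_C: "\<And>j s t. 0 \<le> s \<Longrightarrow> s < t \<Longrightarrow> t \<le> T \<Longrightarrow>
      ((\<lambda>\<epsilon>. \<epsilon>\<^sup>2 * J (\<theta> $ j) (2 * \<theta> $ j) (2 * s / \<epsilon>\<^sup>2) (2 * t / \<epsilon>\<^sup>2)) \<longlongrightarrow> 0) (at_right 0)"
    and lim_D: "\<And>j h \<sigma> s t. h \<noteq> j \<Longrightarrow> \<sigma> \<in> {-1, 1} \<Longrightarrow> 0 \<le> s \<Longrightarrow> s < t \<Longrightarrow> t \<le> T \<Longrightarrow>
      ((\<lambda>\<epsilon>. \<epsilon>\<^sup>2 * J (\<theta> $ j) (\<theta> $ j + \<sigma> * \<theta> $ h) (2 * s / \<epsilon>\<^sup>2) (2 * t / \<epsilon>\<^sup>2)) \<longlongrightarrow> 0) (at_right 0)"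
begin

text \<open>An arbitrary positive value replaces a nonpositive index, so that moment bounds and
  remainder estimates hold for every index and not just eventually; along \<open>at_right 0\<close>
  nothing changes.\<close>

definition pos :: "real \<Rightarrow> real" where "pos \<epsilon> = (if 0 < \<epsilon> then \<epsilon> else 1)"

definition tau :: "real \<Rightarrow> real \<Rightarrow> real" where "tau \<epsilon> t = 2 * t / (pos \<epsilon>)\<^sup>2"

definition Y :: "real \<Rightarrow> real \<Rightarrow> 'a \<Rightarrow> complex ^ 'm" where
  "Y \<epsilon> t \<omega> = (\<chi> j. of_real (pos \<epsilon> * cc j) * G (\<theta> $ j) 0 (tau \<epsilon> t) \<omega>)"

definition test :: "real \<Rightarrow> real \<Rightarrow> ('a \<Rightarrow> complex) set" where
  "test \<epsilon> s = {V. past (tau \<epsilon> s) V \<and> (\<forall>\<omega>\<in>space M. cmod (V \<omega>) \<le> 1)}"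

lemma pos [simp]: "0 < pos \<epsilon>"
  by (simp add: pos_def)

lemma pos_neq_0 [simp]: "pos \<epsilon> \<noteq> 0"
  by (simp add: pos_def)

lemma eventually_pos: "\<forall>\<^sub>F \<epsilon> in at_right 0. pos \<epsilon> = \<epsilon>"
  using eventually_at_right_less[of "0::real"] by eventually_elim (simp add: pos_def)

lemma tau_nonneg: "0 \<le> s \<Longrightarrow> 0 \<le> tau \<epsilon> s"
  by (simp add: tau_def)

lemma tau_mono: "s \<le> t \<Longrightarrow> tau \<epsilon> s \<le> tau \<epsilon> t"
  by (simp add: tau_def divide_right_mono)

lemma tau_diff: "tau \<epsilon> t - tau \<epsilon> s = 2 * (t - s) / (pos \<epsilon>)\<^sup>2"
  by (simp add: tau_def diff_divide_distrib)

lemma Y_0: "Y \<epsilon> 0 \<omega> = 0"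
  by (simp add: Y_def tau_def G_singleton vec_eq_iff)

lemma Y_incr:
  assumes "\<omega> \<in> space M" "0 \<le> s" "s \<le> t"
  shows "(Y \<epsilon> t \<omega> - Y \<epsilon> s \<omega>) $ j = of_real (pos \<epsilon> * cc j) * G (\<theta> $ j) (tau \<epsilon> s) (tau \<epsilon> t) \<omega>"
  using G_split[OF assms(1) tau_nonneg[OF assms(2)] tau_mono[OF assms(3)], of "\<theta> $ j" \<epsilon>]
  by (simp add: Y_def algebra_simps)

lemma Y_measurable: "0 \<le> t \<Longrightarrow> Y \<epsilon> t \<in> borel_measurable M"
proof -
  have "(\<lambda>\<omega>. Y \<epsilon> t \<omega> $ j) \<in> borel_measurable M" for j
    unfolding Y_def by simp
  then show ?thesis
    unfolding borel_measurable_euclidean_space[of "Y \<epsilon> t"]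
    by (auto simp: Basis_vec_def inner_axis intro!: borel_measurable_inner)
qed

lemma Y_continuous: "\<omega> \<in> space M \<Longrightarrow> continuous_on {0..T} (\<lambda>t. Y \<epsilon> t \<omega>)"
  unfolding Y_def
proof (intro continuous_on_vec_lambda continuous_on_mult continuous_on_const)
  fix j assume \<omega>: "\<omega> \<in> space M"
  show "continuous_on {0..T} (\<lambda>t. G (\<theta> $ j) 0 (tau \<epsilon> t) \<omega>)"
    by (rule continuous_on_compose2[OF G_continuous[OF \<omega>]])
      (auto simp: tau_def intro!: continuous_intros)
qed

text \<open>The fourth power of the factor \<open>pos \<epsilon>\<close> cancels the square of the
  rescaled length, 2 * (t - s) / (pos \<epsilon>)^2; what remains is the constant 4, independent of
  \<epsilon>.\<close>

lemma Y_moment: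
  obtains C where "0 \<le> C"
    "\<And>\<epsilon> s t. 0 \<le> s \<Longrightarrow> s \<le> t \<Longrightarrow> integrable M (\<lambda>\<omega>. norm (Y \<epsilon> t \<omega> - Y \<epsilon> s \<omega>) ^ 4)"
    "\<And>\<epsilon> s t. 0 \<le> s \<Longrightarrow> s \<le> t \<Longrightarrow> expectation (\<lambda>\<omega>. norm (Y \<epsilon> t \<omega> - Y \<epsilon> s \<omega>) ^ 4) \<le> C * (t - s)\<^sup>2"
proof -
  define P where "P j d \<longleftrightarrow> 0 \<le> d \<and> (\<forall>a b. 0 \<le> a \<longrightarrow> a \<le> b \<longrightarrow> expectation (\<lambda>\<omega>. cmod (G (\<theta> $ j) a b \<omega>) ^ 4) \<le> d * (b - a)\<^sup>2)" for j d
  have "\<exists>d. P j d" for j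
    unfolding P_def by (rule fourth_moment[OF decay[of j]]) blast
  then have "\<forall>j. \<exists>d. P j d" ..
  from choice[OF this] obtain D where "\<forall>j. P j (D j)" ..
  then have D: "\<And>j. 0 \<le> D j"
    "\<And>j a b. 0 \<le> a \<Longrightarrow> a \<le> b \<Longrightarrow> expectation (\<lambda>\<omega>. cmod (G (\<theta> $ j) a b \<omega>) ^ 4) \<le> D j * (b - a)\<^sup>2"
    unfolding P_def by auto
  define C where "C = real CARD('m) * (\<Sum>j\<in>UNIV. (cc j) ^ 4 * (D j * 4))"
  show ?thesis
  proof
    show "0 \<le> C" using D by (auto simp: C_def intro!: mult_nonneg_nonneg sum_nonneg)
    fix \<epsilon> s t :: real assume st: "0 \<le> s" "s \<le> t"
    let ?a = "tau \<epsilon> s" and ?b = "tau \<epsilon> t"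
    have ab: "0 \<le> ?a" "?a \<le> ?b" using st by (auto intro: tau_nonneg tau_mono)
    define g where "g \<omega> = real CARD('m) * (\<Sum>j\<in>UNIV. (pos \<epsilon> * cc j) ^ 4 * cmod (G (\<theta> $ j) ?a ?b \<omega>) ^ 4)" for \<omega>
    have le: "norm (Y \<epsilon> t \<omega> - Y \<epsilon> s \<omega>) ^ 4 \<le> g \<omega>" if "\<omega> \<in> space M" for \<omega>
      using norm_vec_pow4_le[of "Y \<epsilon> t \<omega> - Y \<epsilon> s \<omega>"] unfolding Y_incr[OF that st] g_def
      by (simp add: norm_mult power_mult_distrib power_even_abs abs_mult)
    have ig: "integrable M g" unfolding g_def
      by (intro integrable_mult_right Bochner_Integration.integrable_sum integrable_cmod_G_power ab)
    have [measurable]: "Y \<epsilon> t \<in> borel_measurable M" "Y \<epsilon> s \<in> borel_measurable M" using st by (auto intro: Y_measurable)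
    show int: "integrable M (\<lambda>\<omega>. norm (Y \<epsilon> t \<omega> - Y \<epsilon> s \<omega>) ^ 4)"
      by (rule Bochner_Integration.integrable_bound[OF ig]) (auto intro!: AE_I2 order_trans[OF le abs_ge_self])
    have "expectation (\<lambda>\<omega>. norm (Y \<epsilon> t \<omega> - Y \<epsilon> s \<omega>) ^ 4) \<le> expectation g"
      by (intro integral_mono int ig le)
    also have "\<dots> = real CARD('m) * (\<Sum>j\<in>UNIV. (pos \<epsilon> * cc j) ^ 4 * expectation (\<lambda>\<omega>. cmod (G (\<theta> $ j) ?a ?b \<omega>) ^ 4))"
      unfolding g_def by (simp add: Bochner_Integration.integral_sum integrable_cmod_G_power ab)
    also have "\<dots> \<le> real CARD('m) * (\<Sum>j\<in>UNIV. (pos \<epsilon> * cc j) ^ 4 * (D j * (?b - ?a)\<^sup>2))"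
      by (intro mult_left_mono sum_mono D ab) auto
    also have "\<dots> = real CARD('m) * (\<Sum>j\<in>UNIV. (cc j) ^ 4 * (D j * 4) * (t - s)\<^sup>2)"
    proof -
      have "(pos \<epsilon> * cc j) ^ 4 * (D j * (?b - ?a)\<^sup>2) = (cc j) ^ 4 * (D j * 4) * (t - s)\<^sup>2" for j
      proof -
        have p: "pos \<epsilon> ^ 4 = ((pos \<epsilon>)\<^sup>2)\<^sup>2" by (simp flip: power_mult)
        have "(pos \<epsilon>)\<^sup>2 \<noteq> 0" using pos[of \<epsilon>] by simp
        then show ?thesis unfolding tau_diff power_mult_distrib power_divide p by (simp add: field_simps)
      qed
      then show ?thesis by (simp only:)
    qed
    also have "\<dots> = C * (t - s)\<^sup>2" by (simp add: C_def sum_distrib_right mult.assoc)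
    finally show "expectation (\<lambda>\<omega>. norm (Y \<epsilon> t \<omega> - Y \<epsilon> s \<omega>) ^ 4) \<le> C * (t - s)\<^sup>2" .
  qed
qed

subsection \<open>The local estimate\<close>

text \<open>
  The index \<open>(j, True)\<close> stands for \<open>G \<theta>\<^sub>j\<close> and \<open>(j, False)\<close> for its complex conjugate
  \<open>G (- \<theta>\<^sub>j)\<close>.
\<close>

definition fr :: "'m \<times> bool \<Rightarrow> real" where "fr p = (if snd p then \<theta> $ fst p else - \<theta> $ fst p)"

text \<open>The coefficients in 2 Re (conj(l) z) = conj(l) z + l conj(z), by which the real inner
  product becomes linear in the integrals \<open>G\<close> and their conjugates.\<close>

definition wt :: "complex ^ 'm \<Rightarrow> 'm \<times> bool \<Rightarrow> complex" where
  "wt l p = (if snd p then cnj (l $ fst p) else l $ fst p)"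

definition conj_index :: "'m \<times> bool \<Rightarrow> 'm \<times> bool" where "conj_index p = (fst p, \<not> snd p)"

lemma fr_conj_index: "fr (conj_index p) = - fr p"
  by (simp add: fr_def conj_index_def)

lemma cmod_wt: "cmod (wt l p) = cmod (l $ fst p)"
  by (simp add: wt_def)

lemma wt_conj_index: "wt l p * wt l (conj_index p) = of_real ((cmod (l $ fst p))\<^sup>2)"
  unfolding complex_norm_square by (simp add: wt_def conj_index_def mult.commute)

lemma inner_Y_incr:
  assumes \<omega>: "\<omega> \<in> space M" and st: "0 \<le> s" "s \<le> t"
  shows "complex_of_real (l \<bullet> (Y \<epsilon> t \<omega> - Y \<epsilon> s \<omega>)) =
    (\<Sum>p\<in>UNIV. (of_real (pos \<epsilon> * cc (fst p)) * wt l p / 2) * G (fr p) (tau \<epsilon> s) (tau \<epsilon> t) \<omega>)"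
proof -
  let ?g = "\<lambda>p. (of_real (pos \<epsilon> * cc (fst p)) * wt l p / 2) * G (fr p) (tau \<epsilon> s) (tau \<epsilon> t) \<omega>"
  have "complex_of_real (l $ j \<bullet> (Y \<epsilon> t \<omega> - Y \<epsilon> s \<omega>) $ j) = ?g (j, True) + ?g (j, False)" for j
  proof -
    define z where "z = G (\<theta> $ j) (tau \<epsilon> s) (tau \<epsilon> t) \<omega>"
    have z': "G (- (\<theta> $ j)) (tau \<epsilon> s) (tau \<epsilon> t) \<omega> = cnj z" unfolding z_def by (simp add: cnj_G)
    show ?thesis
      unfolding Y_incr[OF \<omega> st]
      by (simp add: fr_def wt_def z' z_def[symmetric] inner_complex_def complex_eq_iff)
         (simp add: field_simps)
  qed
  then have "complex_of_real (l \<bullet> (Y \<epsilon> t \<omega> - Y \<epsilon> s \<omega>)) = (\<Sum>j\<in>UNIV. \<Sum>b\<in>UNIV. ?g (j, b))"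
    by (simp add: inner_vec_def UNIV_bool add.commute)
  also have "\<dots> = (\<Sum>p\<in>UNIV. ?g p)"
    by (simp add: sum.cartesian_product case_prod_unfold flip: UNIV_Times_UNIV)
  finally show ?thesis .
qed

text \<open>The exponential of the inner product is a finite product of exponentials of multiples of
  \<open>G\<close>, each of which preserves \<open>past\<close>.\<close>

lemma test_process_Y: "test_process M (test \<epsilon>) (Y \<epsilon>) T"
proof
  fix s :: real assume s: "0 \<le> s"
  show "(\<lambda>_. 1) \<in> test \<epsilon> s" using past_one[OF tau_nonneg[OF s]] by (simp add: test_def)
  fix V assume V: "V \<in> test \<epsilon> s"
  then show "V \<in> borel_measurable M" by (auto simp: test_def dest: past_bounded bounded_rv_measurable)
  show "cmod (V \<omega>) \<le> 1" if "\<omega> \<in> space M" for \<omega> using V that by (auto simp: test_def)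
  fix t l assume t: "s \<le> t"
  have V': "past (tau \<epsilon> t) V" using V tau_mono[OF t] by (auto simp: test_def intro: past_mono)
  let ?z = "\<lambda>p. \<i> * (of_real (pos \<epsilon> * cc (fst p)) * wt l p / 2)"
  have "past (tau \<epsilon> t) (\<lambda>\<omega>. V \<omega> * (\<Prod>p\<in>UNIV. exp (?z p * G (fr p) (tau \<epsilon> s) (tau \<epsilon> t) \<omega>)))"
    by (rule past_prod_exp_G[OF V' tau_nonneg[OF s] tau_mono[OF t] order_refl]) simp
  then have "past (tau \<epsilon> t) (\<lambda>\<omega>. V \<omega> * iexp (l \<bullet> (Y \<epsilon> t \<omega> - Y \<epsilon> s \<omega>)))"
  proof (rule past_cong)
    fix \<omega> assume \<omega>: "\<omega> \<in> space M"
    show "V \<omega> * iexp (l \<bullet> (Y \<epsilon> t \<omega> - Y \<epsilon> s \<omega>)) = V \<omega> * (\<Prod>p\<in>UNIV. exp (?z p * G (fr p) (tau \<epsilon> s) (tau \<epsilon> t) \<omega>))"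
      unfolding inner_Y_incr[OF \<omega> s t] exp_sum[OF finite, symmetric] sum_distrib_left by (simp add: mult.assoc)
  qed
  then show "(\<lambda>\<omega>. V \<omega> * iexp (l \<bullet> (Y \<epsilon> t \<omega> - Y \<epsilon> s \<omega>))) \<in> test \<epsilon> t"
    using V by (auto simp: test_def norm_mult)
qed

text \<open>Pairs that are conjugate to each other carry the variance and are excluded; for all
  others this is the bound on the mixed second moment, scaled.\<close>

definition cross :: "'m \<times> bool \<Rightarrow> 'm \<times> bool \<Rightarrow> real \<Rightarrow> real \<Rightarrow> real \<Rightarrow> real" where
  "cross p q s t \<epsilon> = (if q = conj_index p then 0 else
     (pos \<epsilon>)\<^sup>2 * (J (fr p) (fr p + fr q) (tau \<epsilon> s) (tau \<epsilon> t) + J (fr q) (fr p + fr q) (tau \<epsilon> s) (tau \<epsilon> t)))"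

text \<open>A pair that is not conjugate either repeats an index, with total frequency plus or minus
  twice a component of \<theta>, which is condition (C); or it joins two components, which is (D).
  An overall sign is removed by conjugation.\<close>

lemma J_limit:
  assumes st: "0 \<le> s" "s < t" "t \<le> T" and pq: "q \<noteq> conj_index p"
  shows "((\<lambda>\<epsilon>. (pos \<epsilon>)\<^sup>2 * J (fr p) (fr p + fr q) (tau \<epsilon> s) (tau \<epsilon> t)) \<longlongrightarrow> 0) (at_right 0)"
proof -
  obtain j \<sigma> h \<rho> where p: "p = (j, \<sigma>)" and q: "q = (h, \<rho>)" by (cases p, cases q)
  have "\<exists>\<gamma>. (\<forall>a b. J (fr p) (fr p + fr q) a b = J (\<theta> $ j) \<gamma> a b) \<and>
    ((\<lambda>\<epsilon>. \<epsilon>\<^sup>2 * J (\<theta> $ j) \<gamma> (2 * s / \<epsilon>\<^sup>2) (2 * t / \<epsilon>\<^sup>2)) \<longlongrightarrow> 0) (at_right 0)"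
  proof (cases "h = j")
    case True
    then have "\<rho> = \<sigma>" using pq by (auto simp: p q conj_index_def)
    then have "J (fr p) (fr p + fr q) a b = J (\<theta> $ j) (2 * \<theta> $ j) a b" for a b
      using True J_minus[of "\<theta> $ j" "2 * \<theta> $ j" a b] by (simp add: p q fr_def)
    then show ?thesis using lim_C[OF st] by blast
  next
    case False
    define \<kappa> :: real where "\<kappa> = (if \<sigma> = \<rho> then 1 else -1)"
    have sum: "fr p + fr q = (if \<sigma> then \<theta> $ j + \<kappa> * \<theta> $ h else - (\<theta> $ j + \<kappa> * \<theta> $ h))"
      by (auto simp: p q fr_def \<kappa>_def)
    have "J (fr p) (fr p + fr q) a b = J (\<theta> $ j) (\<theta> $ j + \<kappa> * \<theta> $ h) a b" for a b
      unfolding sum using J_minus[of "\<theta> $ j" "\<theta> $ j + \<kappa> * \<theta> $ h" a b] by (simp add: p fr_def)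
    moreover have "\<kappa> \<in> {-1, 1}" by (simp add: \<kappa>_def)
    ultimately show ?thesis using lim_D[OF False _ st] by blast
  qed
  then obtain \<gamma> where \<gamma>: "\<And>a b. J (fr p) (fr p + fr q) a b = J (\<theta> $ j) \<gamma> a b"
    "((\<lambda>\<epsilon>. \<epsilon>\<^sup>2 * J (\<theta> $ j) \<gamma> (2 * s / \<epsilon>\<^sup>2) (2 * t / \<epsilon>\<^sup>2)) \<longlongrightarrow> 0) (at_right 0)"
    by blast
  have "\<forall>\<^sub>F \<epsilon> in at_right 0. \<epsilon>\<^sup>2 * J (\<theta> $ j) \<gamma> (2 * s / \<epsilon>\<^sup>2) (2 * t / \<epsilon>\<^sup>2) =
      (pos \<epsilon>)\<^sup>2 * J (fr p) (fr p + fr q) (tau \<epsilon> s) (tau \<epsilon> t)"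
    using eventually_pos by eventually_elim (simp add: \<gamma>(1) tau_def)
  from Lim_transform_eventually[OF \<gamma>(2) this] show ?thesis .
qed

lemma cross_limit:
  assumes st: "0 \<le> s" "s < t" "t \<le> T"
  shows "((\<lambda>\<epsilon>. cross p q s t \<epsilon>) \<longlongrightarrow> 0) (at_right 0)"
proof (cases "q = conj_index p")
  case True
  then show ?thesis by (simp add: cross_def)
next
  case False
  then have "p \<noteq> conj_index q" by (auto simp: conj_index_def)
  from tendsto_add[OF J_limit[OF st False] J_limit[OF st this]] False
  show ?thesis by (simp add: cross_def distrib_left add.commute)
qed

text \<open>Means grow only like the logarithm of 1 / \<epsilon>^2, so the factor \<epsilon> makes
  them vanish.\<close>

lemma log_bound_limit:
  assumes "s < t"
  shows "((\<lambda>\<epsilon>. pos \<epsilon> * log_bound k (tau \<epsilon> t - tau \<epsilon> s)) \<longlongrightarrow> 0) (at_right 0)"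
proof -
  define d where "d = 2 * (t - s)"
  have d: "0 < d" using assms by (simp add: d_def)
  have "((\<lambda>\<epsilon>. \<epsilon> * ln (1 + d / \<epsilon>\<^sup>2)) \<longlongrightarrow> 0) (at_right 0)"
  proof (rule Lim_null_comparison)
    have "((\<lambda>\<epsilon>. 4 * sqrt (sqrt d) * sqrt \<epsilon>) \<longlongrightarrow> 4 * sqrt (sqrt d) * sqrt 0) (at_right 0)" by (intro tendsto_intros)
    then show "((\<lambda>\<epsilon>. 4 * sqrt (sqrt d) * sqrt \<epsilon>) \<longlongrightarrow> 0) (at_right 0)" by simp
    show "\<forall>\<^sub>F \<epsilon> in at_right 0. norm (\<epsilon> * ln (1 + d / \<epsilon>\<^sup>2)) \<le> 4 * sqrt (sqrt d) * sqrt \<epsilon>"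
      using eventually_at_right_less[of "0::real"]
    proof eventually_elim
      case (elim \<epsilon>)
      have "ln (1 + d / \<epsilon>\<^sup>2) \<le> 4 * sqrt (sqrt (d / \<epsilon>\<^sup>2))" using d by (intro ln_one_plus_le_sqrt_sqrt) simp
      also have "sqrt (d / \<epsilon>\<^sup>2) = sqrt d / \<epsilon>" using elim by (simp add: real_sqrt_divide)
      also have "sqrt (sqrt d / \<epsilon>) = sqrt (sqrt d) / sqrt \<epsilon>" by (simp add: real_sqrt_divide)
      finally have "\<epsilon> * ln (1 + d / \<epsilon>\<^sup>2) \<le> \<epsilon> * (4 * (sqrt (sqrt d) / sqrt \<epsilon>))" using elim by (intro mult_left_mono) auto
      also have "\<dots> = 4 * sqrt (sqrt d) * (\<epsilon> / sqrt \<epsilon>)" by simp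
      also have "\<epsilon> / sqrt \<epsilon> = sqrt \<epsilon>" using elim by (intro real_div_sqrt) simp
      finally show ?case using elim d by (simp add: abs_mult)
    qed
  qed
  then have "((\<lambda>\<epsilon>. (1 + 2 * k) * (\<epsilon> * ln (1 + d / \<epsilon>\<^sup>2))) \<longlongrightarrow> (1 + 2 * k) * 0) (at_right 0)"
    by (intro tendsto_mult tendsto_const)
  then have l: "((\<lambda>\<epsilon>. (1 + 2 * k) * (\<epsilon> * ln (1 + d / \<epsilon>\<^sup>2))) \<longlongrightarrow> 0) (at_right 0)" by simp
  have "\<forall>\<^sub>F \<epsilon> in at_right 0. (1 + 2 * k) * (\<epsilon> * ln (1 + d / \<epsilon>\<^sup>2)) = pos \<epsilon> * log_bound k (tau \<epsilon> t - tau \<epsilon> s)"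
    using eventually_pos by eventually_elim (simp add: log_bound_def tau_diff d_def)
  from Lim_transform_eventually[OF l this] show ?thesis .
qed

lemma S_limit:
  assumes st: "0 \<le> s" "s < t" "t \<le> T"
  shows "((\<lambda>\<epsilon>. cmod (of_real ((pos \<epsilon> * cc j)\<^sup>2) * S (\<theta> $ j) (tau \<epsilon> s) (tau \<epsilon> t) / 2 - of_real (t - s))) \<longlongrightarrow> 0) (at_right 0)"
proof -
  have "((\<lambda>\<epsilon>. cmod (of_real (\<epsilon>\<^sup>2 * (cc j)\<^sup>2) * S (\<theta> $ j) (2 * s / \<epsilon>\<^sup>2) (2 * t / \<epsilon>\<^sup>2) / 2 - of_real (t - s))) \<longlongrightarrow>
     cmod (of_real (2 * (t - s)) / 2 - of_real (t - s))) (at_right 0)"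
    by (intro tendsto_intros lim_S[OF st]) simp
  moreover have "complex_of_real (2 * (t - s)) / 2 - of_real (t - s) = 0" by (simp add: diff_divide_distrib)
  ultimately have l: "((\<lambda>\<epsilon>. cmod (of_real (\<epsilon>\<^sup>2 * (cc j)\<^sup>2) * S (\<theta> $ j) (2 * s / \<epsilon>\<^sup>2) (2 * t / \<epsilon>\<^sup>2) / 2 - of_real (t - s))) \<longlongrightarrow> 0) (at_right 0)"
    by (simp only: norm_zero)
  have "\<forall>\<^sub>F \<epsilon> in at_right 0. cmod (of_real (\<epsilon>\<^sup>2 * (cc j)\<^sup>2) * S (\<theta> $ j) (2 * s / \<epsilon>\<^sup>2) (2 * t / \<epsilon>\<^sup>2) / 2 - of_real (t - s)) =
      cmod (of_real ((pos \<epsilon> * cc j)\<^sup>2) * S (\<theta> $ j) (tau \<epsilon> s) (tau \<epsilon> t) / 2 - of_real (t - s))"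
    using eventually_pos by eventually_elim (simp add: tau_def power_mult_distrib)
  from Lim_transform_eventually[OF l this] show ?thesis .
qed

end

context osc_process
begin

lemma bounded_rv_sum: "(\<And>p. p \<in> P \<Longrightarrow> bounded_rv (f p)) \<Longrightarrow> bounded_rv (\<lambda>\<omega>. \<Sum>p\<in>P. f p \<omega>)"
  by (induction P rule: infinite_finite_induct) (auto intro: bounded_rv_const bounded_rv_add)

lemma expectation_sum_mult:
  assumes "\<And>p. p \<in> P \<Longrightarrow> bounded_rv (f p)"
  shows "expectation (\<lambda>\<omega>. \<Sum>p\<in>P. f p \<omega>) = (\<Sum>p\<in>P. expectation (f p))"
  using assms by (intro Bochner_Integration.integral_sum bounded_rv_integrable)

lemma S_minus: "S (- \<alpha>) a b = S \<alpha> a b"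
  by (simp add: S_def add.commute)

end

context osc_clt
begin

lemma S_fr: "S (fr p) a b = S (\<theta> $ fst p) a b"
  by (simp add: fr_def S_minus)

text \<open>Means of the increments, deviation of the conjugate pairs from the Brownian variance,
  and mixed second moments. It depends on no multiplier, as the limit argument for increments
  requires.\<close>

definition err_bound :: "complex ^ 'm \<Rightarrow> real \<Rightarrow> real \<Rightarrow> real \<Rightarrow> real" where
  "err_bound l s t \<epsilon> =
     (\<Sum>p\<in>(UNIV :: ('m \<times> bool) set). (\<bar>cc (fst p)\<bar> * cmod (l $ fst p) / 2) * (pos \<epsilon> * log_bound (K (fst p)) (tau \<epsilon> t - tau \<epsilon> s)))
     + ((\<Sum>j\<in>UNIV. (cmod (l $ j))\<^sup>2 *
          cmod (of_real ((pos \<epsilon> * cc j)\<^sup>2) * S (\<theta> $ j) (tau \<epsilon> s) (tau \<epsilon> t) / 2 - of_real (t - s)))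
       + (\<Sum>p\<in>UNIV. \<Sum>q\<in>UNIV. (\<bar>cc (fst p)\<bar> * cmod (l $ fst p) * (\<bar>cc (fst q)\<bar> * cmod (l $ fst q)) / 4) * cross p q s t \<epsilon>)) / 2"

lemma err_bound_limit:
  assumes "0 \<le> s" "s < t" "t \<le> T" shows "(err_bound l s t \<longlongrightarrow> 0) (at_right 0)"
proof -
  have "(err_bound l s t \<longlongrightarrow>
     (\<Sum>p\<in>(UNIV :: ('m \<times> bool) set). (\<bar>cc (fst p)\<bar> * cmod (l $ fst p) / 2) * 0)
     + ((\<Sum>j\<in>UNIV. (cmod (l $ j))\<^sup>2 * 0)
       + (\<Sum>p\<in>(UNIV :: ('m \<times> bool) set). \<Sum>q\<in>(UNIV :: ('m \<times> bool) set). (\<bar>cc (fst p)\<bar> * cmod (l $ fst p) * (\<bar>cc (fst q)\<bar> * cmod (l $ fst q)) / 4) * 0)) / 2) (at_right 0)"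
    unfolding err_bound_def
    by (intro tendsto_add tendsto_divide tendsto_sum tendsto_mult tendsto_const cross_limit assms S_limit log_bound_limit) simp
  then show ?thesis by simp
qed

text \<open>The cubic Taylor remainder is traded for the fourth moment, which is of order (t -
  s)^2.\<close>

lemma taylor_remainder:
  assumes V: "V \<in> test \<epsilon> s" and st: "0 \<le> s" "s < t"
    and C: "0 \<le> C" "integrable M (\<lambda>\<omega>. norm (Y \<epsilon> t \<omega> - Y \<epsilon> s \<omega>) ^ 4)"
      "expectation (\<lambda>\<omega>. norm (Y \<epsilon> t \<omega> - Y \<epsilon> s \<omega>) ^ 4) \<le> C * (t - s)\<^sup>2"
    and u: "\<And>\<omega>. u \<omega> = l \<bullet> (Y \<epsilon> t \<omega> - Y \<epsilon> s \<omega>)"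
    and R: "bounded_rv (\<lambda>\<omega>. V \<omega> * (iexp (u \<omega>) - (1 + \<i> * of_real (u \<omega>) - (of_real (u \<omega>))\<^sup>2 / 2)))"
  shows "cmod (expectation (\<lambda>\<omega>. V \<omega> * (iexp (u \<omega>) - (1 + \<i> * of_real (u \<omega>) - (of_real (u \<omega>))\<^sup>2 / 2))))
    \<le> (1/4 + 3/4 * norm l ^ 4 * C) / 6 * ((t - s) * sqrt (t - s))"
proof -
  \<comment> \<open>The standard deviation of an increment: it balances \<open>\<kappa> ^ 3\<close>
    against (t - s)^2 / \<open>\<kappa>\<close>, both equal to (t - s)^(3/2).\<close>
  define \<kappa> where "\<kappa> = sqrt (t - s)"
  have \<kappa>: "0 < \<kappa>" using st by (simp add: \<kappa>_def)
  have \<kappa>2: "t - s = \<kappa>\<^sup>2" using st by (simp add: \<kappa>_def)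
  let ?Z = "\<lambda>\<omega>. norm (Y \<epsilon> t \<omega> - Y \<epsilon> s \<omega>) ^ 4"
  have "cmod (expectation (\<lambda>\<omega>. V \<omega> * (iexp (u \<omega>) - (1 + \<i> * of_real (u \<omega>) - (of_real (u \<omega>))\<^sup>2 / 2))))
     \<le> expectation (\<lambda>\<omega>. (\<kappa> ^ 3 / 4) / 6 + (3/4 * norm l ^ 4 / \<kappa> / 6) * ?Z \<omega>)"
  proof (rule norm_integral_le)
    fix \<omega> assume \<omega>: "\<omega> \<in> space M"
    have "\<bar>u \<omega>\<bar> \<le> norm l * norm (Y \<epsilon> t \<omega> - Y \<epsilon> s \<omega>)" unfolding u by (rule Cauchy_Schwarz_ineq2)
    then have "\<bar>u \<omega>\<bar> ^ 4 \<le> (norm l * norm (Y \<epsilon> t \<omega> - Y \<epsilon> s \<omega>)) ^ 4" by (rule power_mono) simp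
    then have u4: "u \<omega> ^ 4 \<le> norm l ^ 4 * ?Z \<omega>" by (simp add: power_mult_distrib power_even_abs)
    have "cmod (V \<omega> * (iexp (u \<omega>) - (1 + \<i> * of_real (u \<omega>) - (of_real (u \<omega>))\<^sup>2 / 2))) \<le> 1 * (\<bar>u \<omega>\<bar> ^ 3 / 6)"
      unfolding norm_mult using V \<omega> by (intro mult_mono iexp_taylor2) (auto simp: test_def)
    also have "\<dots> \<le> (\<kappa> ^ 3 / 4 + 3/4 * u \<omega> ^ 4 / \<kappa>) / 6" using abs_cube_le[OF \<kappa>, of "u \<omega>"] by simp
    also have "\<dots> \<le> (\<kappa> ^ 3 / 4 + 3/4 * (norm l ^ 4 * ?Z \<omega>) / \<kappa>) / 6"
      using u4 \<kappa> by (intro divide_right_mono add_left_mono mult_left_mono) auto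
    finally show "cmod (V \<omega> * (iexp (u \<omega>) - (1 + \<i> * of_real (u \<omega>) - (of_real (u \<omega>))\<^sup>2 / 2)))
      \<le> (\<kappa> ^ 3 / 4) / 6 + (3/4 * norm l ^ 4 / \<kappa> / 6) * ?Z \<omega>" by (simp add: add_divide_distrib)
  qed (use C R bounded_rv_integrable in auto)
  also have "\<dots> = (\<kappa> ^ 3 / 4) / 6 + (3/4 * norm l ^ 4 / \<kappa> / 6) * expectation ?Z"
    using C(2) by (simp add: prob_space)
  also have "\<dots> \<le> (\<kappa> ^ 3 / 4) / 6 + (3/4 * norm l ^ 4 / \<kappa> / 6) * (C * (t - s)\<^sup>2)"
    using C(3) \<kappa> by (intro add_left_mono mult_left_mono) auto
  also have "\<dots> = (1/4 + 3/4 * norm l ^ 4 * C) / 6 * ((t - s) * \<kappa>)"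
    unfolding \<kappa>2 using \<kappa> by (simp add: field_simps power2_eq_square power3_eq_cube)
  finally show ?thesis by (simp add: \<kappa>_def)
qed

text \<open>Taylor expansion of the exponential to second order inside the expectation with a
  multiplier from the past. The constant is obtained before \<epsilon>, the times and the
  multiplier, so it serves all steps of a partition at once.\<close>

lemma local_estimate:
  obtains C where "\<And>\<epsilon> s t V. 0 \<le> s \<Longrightarrow> s < t \<Longrightarrow> t \<le> T \<Longrightarrow> V \<in> test \<epsilon> s \<Longrightarrow>
    cmod (expectation (\<lambda>\<omega>. V \<omega> * iexp (l \<bullet> (Y \<epsilon> t \<omega> - Y \<epsilon> s \<omega>))) - expectation V * of_real (1 - (norm l)\<^sup>2 * (t - s) / 2))
      \<le> err_bound l s t \<epsilon> + C * ((t - s) * sqrt (t - s))"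
proof -
  obtain C where C: "0 \<le> C"
    "\<And>\<epsilon> s t. 0 \<le> s \<Longrightarrow> s \<le> t \<Longrightarrow> integrable M (\<lambda>\<omega>. norm (Y \<epsilon> t \<omega> - Y \<epsilon> s \<omega>) ^ 4)"
    "\<And>\<epsilon> s t. 0 \<le> s \<Longrightarrow> s \<le> t \<Longrightarrow> expectation (\<lambda>\<omega>. norm (Y \<epsilon> t \<omega> - Y \<epsilon> s \<omega>) ^ 4) \<le> C * (t - s)\<^sup>2"
    using Y_moment by blast
  show ?thesis
  proof
    fix \<epsilon> s t V assume st: "0 \<le> s" "s < t" "t \<le> T" and Vt: "V \<in> test \<epsilon> s"
    let ?a = "tau \<epsilon> s" and ?b = "tau \<epsilon> t"
    have ab: "0 \<le> ?a" "?a \<le> ?b" using st by (auto intro: tau_nonneg tau_mono)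
    have V: "past ?a V" "\<And>\<omega>. \<omega> \<in> space M \<Longrightarrow> cmod (V \<omega>) \<le> 1" using Vt by (auto simp: test_def)
    have bV: "bounded_rv V" by (rule past_bounded[OF V(1)])
    define g where "g p = G (fr p) ?a ?b" for p
    define w where "w p = of_real (pos \<epsilon> * cc (fst p)) * wt l p / 2" for p
    define u where "u \<omega> = l \<bullet> (Y \<epsilon> t \<omega> - Y \<epsilon> s \<omega>)" for \<omega>
    have u_eq: "complex_of_real (u \<omega>) = (\<Sum>p\<in>UNIV. w p * g p \<omega>)" if "\<omega> \<in> space M" for \<omega>
      unfolding u_def g_def w_def using st by (intro inner_Y_incr that) auto
    have bg: "bounded_rv (g p)" for p unfolding g_def by (rule bounded_rv_G[OF ab(2)])
    have um[measurable]: "u \<in> borel_measurable M"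
      unfolding u_def[abs_def] using st by (intro borel_measurable_inner measurable_const borel_measurable_diff Y_measurable) auto
    have bu: "bounded_rv (\<lambda>\<omega>. complex_of_real (u \<omega>))"
    proof -
      have "bounded_rv (\<lambda>\<omega>. \<Sum>p\<in>UNIV. w p * g p \<omega>)" by (intro bounded_rv_sum bounded_rv_mult bounded_rv_const bg)
      then obtain B where "\<And>\<omega>. \<omega> \<in> space M \<Longrightarrow> cmod (\<Sum>p\<in>UNIV. w p * g p \<omega>) \<le> B" by (auto simp: bounded_rv_def)
      then show ?thesis by (intro bounded_rvI[where B=B]) (auto simp: u_eq[symmetric])
    qed
    define R where "R \<omega> = iexp (u \<omega>) - (1 + \<i> * of_real (u \<omega>) - (of_real (u \<omega>))\<^sup>2 / 2)" for \<omega>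
    have bu2: "bounded_rv (\<lambda>\<omega>. (complex_of_real (u \<omega>))\<^sup>2)" unfolding power2_eq_square by (intro bounded_rv_mult bu)
    have bR: "bounded_rv R"
    proof -
      have "R = (\<lambda>\<omega>. iexp (u \<omega>) + ((-1) + (-\<i>) * of_real (u \<omega>) + (1/2) * (of_real (u \<omega>))\<^sup>2))" by (auto simp: R_def fun_eq_iff)
      then show ?thesis by (simp only:) (intro bounded_rv_add bounded_rv_mult bounded_rv_const bounded_rv_iexp um bu bu2)
    qed
    note [simp] = bounded_rv_integrable[OF bV] bounded_rv_integrable[OF bounded_rv_mult[OF bV bu]]
      bounded_rv_integrable[OF bounded_rv_mult[OF bV bu2]] bounded_rv_integrable[OF bounded_rv_mult[OF bV bR]]
    let ?E1 = "expectation (\<lambda>\<omega>. V \<omega> * of_real (u \<omega>))" and ?E2 = "expectation (\<lambda>\<omega>. V \<omega> * (of_real (u \<omega>))\<^sup>2)"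
      and ?ER = "expectation (\<lambda>\<omega>. V \<omega> * R \<omega>)" and ?v = "(norm l)\<^sup>2 * (t - s)"
    have "expectation (\<lambda>\<omega>. V \<omega> * iexp (u \<omega>)) = expectation (\<lambda>\<omega>. V \<omega> + \<i> * (V \<omega> * of_real (u \<omega>)) - (1/2) * (V \<omega> * (of_real (u \<omega>))\<^sup>2) + V \<omega> * R \<omega>)"
      by (intro Bochner_Integration.integral_cong) (auto simp: R_def algebra_simps)
    also have "\<dots> = expectation V + \<i> * ?E1 - (1/2) * ?E2 + ?ER" by simp
    finally have X: "expectation (\<lambda>\<omega>. V \<omega> * iexp (u \<omega>)) = expectation V + \<i> * ?E1 - (1/2) * ?E2 + ?ER" .
    have eq: "expectation (\<lambda>\<omega>. V \<omega> * iexp (u \<omega>)) - expectation V * of_real (1 - ?v / 2) =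
       \<i> * ?E1 - (?E2 - expectation V * of_real ?v) / 2 + ?ER"
      unfolding X by (simp add: right_diff_distrib diff_divide_distrib)
    have tri: "cmod (\<i> * x - y / 2 + z) \<le> cmod x + cmod y / 2 + cmod z" for x y z
      using norm_triangle_ineq[of "\<i> * x - y / 2" z] norm_triangle_ineq4[of "\<i> * x" "y / 2"]
      by (simp add: norm_mult norm_divide)
    \<comment> \<open>First order: every conditional mean is logarithmic in the rescaled
      length.\<close>
    have b1: "cmod ?E1 \<le> (\<Sum>p\<in>(UNIV :: ('m \<times> bool) set). (\<bar>cc (fst p)\<bar> * cmod (l $ fst p) / 2) * (pos \<epsilon> * log_bound (K (fst p)) (?b - ?a)))"
    proof -
      have "?E1 = expectation (\<lambda>\<omega>. \<Sum>p\<in>UNIV. w p * (V \<omega> * g p \<omega>))"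
        by (intro Bochner_Integration.integral_cong) (auto simp: u_eq sum_distrib_left mult_ac)
      also have "\<dots> = (\<Sum>p\<in>UNIV. w p * expectation (\<lambda>\<omega>. V \<omega> * g p \<omega>))"
        by (subst expectation_sum_mult) (auto intro!: bounded_rv_mult bounded_rv_const bV bg)
      also have "cmod \<dots> \<le> (\<Sum>p\<in>(UNIV :: ('m \<times> bool) set). (\<bar>cc (fst p)\<bar> * cmod (l $ fst p) / 2) * (pos \<epsilon> * log_bound (K (fst p)) (?b - ?a)))"
      proof (rule order_trans[OF norm_sum], rule sum_mono)
        fix p
        have "mean_decay (fr p) (K (fst p))" using decay[of "fst p"] by (simp add: fr_def mean_decay_minus)
        then have "cmod (expectation (\<lambda>\<omega>. V \<omega> * g p \<omega>)) \<le> log_bound (K (fst p)) (?b - ?a)"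
          unfolding g_def by (intro first_moment V ab)
        then have "cmod (w p) * cmod (expectation (\<lambda>\<omega>. V \<omega> * g p \<omega>)) \<le> cmod (w p) * log_bound (K (fst p)) (?b - ?a)"
          by (rule mult_left_mono) simp
        also have "\<dots> = (\<bar>cc (fst p)\<bar> * cmod (l $ fst p) / 2) * (pos \<epsilon> * log_bound (K (fst p)) (?b - ?a))"
          by (simp add: w_def norm_mult norm_divide cmod_wt abs_mult abs_of_pos)
        finally show "cmod (w p * expectation (\<lambda>\<omega>. V \<omega> * g p \<omega>)) \<le> (\<bar>cc (fst p)\<bar> * cmod (l $ fst p) / 2) * (pos \<epsilon> * log_bound (K (fst p)) (?b - ?a))"
          by (simp add: norm_mult)
      qed
      finally show ?thesis .
    qed
    \<comment> \<open>Second order: the square of the linear form is a double sum over the indices,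
      split into conjugate pairs and the rest.\<close>
    have b2: "cmod (?E2 - expectation V * of_real ?v) \<le>
      (\<Sum>j\<in>UNIV. (cmod (l $ j))\<^sup>2 * cmod (of_real ((pos \<epsilon> * cc j)\<^sup>2) * S (\<theta> $ j) ?a ?b / 2 - of_real (t - s)))
       + (\<Sum>p\<in>UNIV. \<Sum>q\<in>UNIV. (\<bar>cc (fst p)\<bar> * cmod (l $ fst p) * (\<bar>cc (fst q)\<bar> * cmod (l $ fst q)) / 4) * cross p q s t \<epsilon>)"
    proof -
      define A where "A p q = w p * w q * expectation (\<lambda>\<omega>. V \<omega> * g p \<omega> * g q \<omega>)" for p q
      define err where "err p q = (if q = conj_index p then 0 else A p q)" for p q
      have "?E2 = expectation (\<lambda>\<omega>. \<Sum>p\<in>UNIV. \<Sum>q\<in>UNIV. (w p * w q) * (V \<omega> * g p \<omega> * g q \<omega>))"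
        by (intro Bochner_Integration.integral_cong)
           (auto simp: u_eq power2_eq_square sum_product sum_distrib_left mult_ac)
      also have "\<dots> = (\<Sum>p\<in>UNIV. \<Sum>q\<in>UNIV. A p q)"
        by (subst expectation_sum_mult, intro bounded_rv_sum bounded_rv_mult bounded_rv_const bV bg,
            subst expectation_sum_mult, intro bounded_rv_mult bounded_rv_const bV bg) (simp add: A_def)
      also have "\<dots> = (\<Sum>p\<in>UNIV. A p (conj_index p) + (\<Sum>q\<in>UNIV. err p q))"
      proof (rule sum.cong[OF refl])
        fix p
        have "(\<Sum>q\<in>UNIV. A p q) = (\<Sum>q\<in>UNIV. (if q = conj_index p then A p (conj_index p) else 0) + err p q)"
          by (intro sum.cong) (auto simp: err_def)
        then show "(\<Sum>q\<in>UNIV. A p q) = A p (conj_index p) + (\<Sum>q\<in>UNIV. err p q)" by (simp add: sum.distrib)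
      qed
      also have "\<dots> = (\<Sum>p\<in>UNIV. A p (conj_index p)) + (\<Sum>p\<in>UNIV. \<Sum>q\<in>UNIV. err p q)" by (rule sum.distrib)
      \<comment> \<open>Each of the two indices over \<open>j\<close> contributes a quarter.
        Together they give half of the scaled \<open>S\<close>, and by (B) this half tends to
        \<open>t - s\<close>, the variance of one real coordinate.\<close>
      also have "(\<Sum>p\<in>UNIV. A p (conj_index p)) = expectation V * (\<Sum>j\<in>UNIV. of_real ((cmod (l $ j))\<^sup>2) * (of_real ((pos \<epsilon> * cc j)\<^sup>2) * S (\<theta> $ j) ?a ?b / 2))"
      proof -
        have A: "A p (conj_index p) = expectation V * (of_real ((cmod (l $ fst p))\<^sup>2) * (of_real ((pos \<epsilon> * cc (fst p))\<^sup>2) * S (\<theta> $ fst p) ?a ?b / 4))" for p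
        proof -
          have ww: "w p * w (conj_index p) = (of_real (pos \<epsilon> * cc (fst p)))\<^sup>2 * (wt l p * wt l (conj_index p)) / 4"
            by (simp add: w_def conj_index_def power2_eq_square)
          show ?thesis
            unfolding A_def ww wt_conj_index g_def fr_conj_index expectation_G_G_opposite[OF V(1) ab] S_fr
            by (simp add: mult_ac)
        qed
        have "(\<Sum>p\<in>UNIV. A p (conj_index p)) = (\<Sum>j\<in>UNIV. \<Sum>b\<in>UNIV. A (j, b) (conj_index (j, b)))"
          by (simp add: sum.cartesian_product case_prod_unfold flip: UNIV_Times_UNIV)
        then show ?thesis unfolding A by (simp add: UNIV_bool sum_distrib_left mult_ac)
      qed
      finally have E2: "?E2 - expectation V * of_real ?v =
        expectation V * (\<Sum>j\<in>UNIV. of_real ((cmod (l $ j))\<^sup>2) * (of_real ((pos \<epsilon> * cc j)\<^sup>2) * S (\<theta> $ j) ?a ?b / 2 - of_real (t - s)))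
        + (\<Sum>p\<in>UNIV. \<Sum>q\<in>UNIV. err p q)"
        unfolding norm_vec_sq by (simp add: right_diff_distrib sum_subtractf sum_distrib_right sum_distrib_left)
      show ?thesis
        unfolding E2
      proof (rule order_trans[OF norm_triangle_ineq], rule add_mono)
        have "cmod (expectation V * (\<Sum>j\<in>UNIV. of_real ((cmod (l $ j))\<^sup>2) * (of_real ((pos \<epsilon> * cc j)\<^sup>2) * S (\<theta> $ j) ?a ?b / 2 - of_real (t - s))))
          \<le> 1 * (\<Sum>j\<in>UNIV. (cmod (l $ j))\<^sup>2 * cmod (of_real ((pos \<epsilon> * cc j)\<^sup>2) * S (\<theta> $ j) ?a ?b / 2 - of_real (t - s)))"
          unfolding norm_mult[of "expectation V"]
        proof (rule mult_mono)
          show "cmod (expectation V) \<le> 1" by (rule cmod_expectation_le[OF bV V(2)])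
          show "cmod (\<Sum>j\<in>UNIV. of_real ((cmod (l $ j))\<^sup>2) * (of_real ((pos \<epsilon> * cc j)\<^sup>2) * S (\<theta> $ j) ?a ?b / 2 - of_real (t - s)))
            \<le> (\<Sum>j\<in>UNIV. (cmod (l $ j))\<^sup>2 * cmod (of_real ((pos \<epsilon> * cc j)\<^sup>2) * S (\<theta> $ j) ?a ?b / 2 - of_real (t - s)))"
            by (rule order_trans[OF norm_sum]) (simp only: norm_mult norm_of_real abs_power2 order_refl)
        qed simp_all
        then show "cmod (expectation V * (\<Sum>j\<in>UNIV. of_real ((cmod (l $ j))\<^sup>2) * (of_real ((pos \<epsilon> * cc j)\<^sup>2) * S (\<theta> $ j) ?a ?b / 2 - of_real (t - s))))
          \<le> (\<Sum>j\<in>UNIV. (cmod (l $ j))\<^sup>2 * cmod (of_real ((pos \<epsilon> * cc j)\<^sup>2) * S (\<theta> $ j) ?a ?b / 2 - of_real (t - s)))"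
          by (simp only: mult_1_left)
        show "cmod (\<Sum>p\<in>UNIV. \<Sum>q\<in>UNIV. err p q) \<le>
          (\<Sum>p\<in>UNIV. \<Sum>q\<in>UNIV. (\<bar>cc (fst p)\<bar> * cmod (l $ fst p) * (\<bar>cc (fst q)\<bar> * cmod (l $ fst q)) / 4) * cross p q s t \<epsilon>)"
        proof (rule order_trans[OF norm_sum], rule sum_mono, rule order_trans[OF norm_sum], rule sum_mono)
          fix p q
          show "cmod (err p q) \<le> (\<bar>cc (fst p)\<bar> * cmod (l $ fst p) * (\<bar>cc (fst q)\<bar> * cmod (l $ fst q)) / 4) * cross p q s t \<epsilon>"
          proof (cases "q = conj_index p")
            case True
            then show ?thesis by (simp add: err_def cross_def)
          next
            case False
            have "cmod (A p q) \<le> cmod (w p * w q) * (J (fr p) (fr p + fr q) ?a ?b + J (fr q) (fr p + fr q) ?a ?b)"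
              unfolding A_def norm_mult[of "w p * w q"] g_def by (intro mult_left_mono cmod_expectation_G_G V ab) simp_all
            also have "\<dots> = (\<bar>cc (fst p)\<bar> * cmod (l $ fst p) * (\<bar>cc (fst q)\<bar> * cmod (l $ fst q)) / 4) * cross p q s t \<epsilon>"
            proof -
              have ww: "cmod (w p * w q) = \<bar>cc (fst p)\<bar> * cmod (l $ fst p) * (\<bar>cc (fst q)\<bar> * cmod (l $ fst q)) / 4 * (pos \<epsilon>)\<^sup>2"
                by (simp add: w_def norm_mult norm_divide cmod_wt abs_mult abs_of_pos power2_eq_square)
              have c: "cross p q s t \<epsilon> = (pos \<epsilon>)\<^sup>2 * (J (fr p) (fr p + fr q) ?a ?b + J (fr q) (fr p + fr q) ?a ?b)"
                using False by (simp only: cross_def if_False)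
              show ?thesis unfolding ww c by (simp only: mult.assoc)
            qed
            finally show ?thesis using False by (simp add: err_def)
          qed
        qed
      qed
    qed
    have b3: "cmod ?ER \<le> (1/4 + 3/4 * norm l ^ 4 * C) / 6 * ((t - s) * sqrt (t - s))"
      unfolding R_def
      by (rule taylor_remainder[OF Vt st(1,2) C(1) C(2)[OF st(1) less_imp_le[OF st(2)]] C(3)[OF st(1) less_imp_le[OF st(2)]] u_def])
         (use bounded_rv_mult[OF bV bR] in \<open>simp add: R_def\<close>)
    show "cmod (expectation (\<lambda>\<omega>. V \<omega> * iexp (l \<bullet> (Y \<epsilon> t \<omega> - Y \<epsilon> s \<omega>))) - expectation V * of_real (1 - (norm l)\<^sup>2 * (t - s) / 2))
      \<le> err_bound l s t \<epsilon> + (1/4 + 3/4 * norm l ^ 4 * C) / 6 * ((t - s) * sqrt (t - s))"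
      unfolding u_def[symmetric] eq err_bound_def
      by (rule order_trans[OF tri]) (intro add_mono divide_right_mono b1 b2 b3; simp)
  qed
qed

text \<open>Both sides are identified through the same \<open>gauss_exponent\<close>: as a limit for
  the rescaled integrals and exactly for the Brownian motion.\<close>

theorem Y_converges_weakly:
  fixes W :: "real \<Rightarrow> 'b \<Rightarrow> complex ^ 'm"
  assumes W: "multi_complex_brownian_motion N W"
  shows "converges_weakly (mtopology_of (cpath T))
     (\<lambda>\<epsilon>. distr M (borel_sigma (mtopology_of (cpath T))) (\<lambda>\<omega>. restrict (\<lambda>t. Y \<epsilon> t \<omega>) {0..T}))
     (distr N (borel_sigma (mtopology_of (cpath T))) (\<lambda>\<omega>. restrict (\<lambda>t. W t \<omega>) {0..T})) (at_right 0)"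
proof -
  obtain C where C: "0 \<le> C"
    "\<And>\<epsilon> s t. 0 \<le> s \<Longrightarrow> s \<le> t \<Longrightarrow> integrable M (\<lambda>\<omega>. norm (Y \<epsilon> t \<omega> - Y \<epsilon> s \<omega>) ^ 4)"
    "\<And>\<epsilon> s t. 0 \<le> s \<Longrightarrow> s \<le> t \<Longrightarrow> expectation (\<lambda>\<omega>. norm (Y \<epsilon> t \<omega> - Y \<epsilon> s \<omega>) ^ 4) \<le> C * (t - s)\<^sup>2"
    using Y_moment by blast
  have N: "prob_space N"
    using W by (simp add: multi_complex_brownian_motion_def complex_brownian_motion_def standard_brownian_motion_def)
  interpret F: test_family M test Y T "at_right 0"
    by (rule test_family.intro) (rule test_process_Y)
  show ?thesis
  proof (rule converges_weakly_path[OF T prob_space_axioms N _ Y_continuous Y_0 _ multi_complex_brownian_motion_continuous[OF W] C(1)])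
    show "Y \<epsilon> t \<in> borel_measurable M" if "t \<in> {0..T}" for \<epsilon> t using that by (intro Y_measurable) auto
    show "W t \<in> borel_measurable N" if "t \<in> {0..T}" for t
      using that by (intro multi_complex_brownian_motion_measurable[OF W]) auto
    fix t l K assume t: "incseq t" "t 0 = 0" "\<And>k. t k \<in> {0..T}"
    have "((\<lambda>\<epsilon>. \<integral>\<omega>. iexp (\<Sum>k\<le>K. l k \<bullet> Y \<epsilon> (t k) \<omega>) \<partial>M) \<longlongrightarrow> of_real (exp (- gauss_exponent t l K))) (at_right 0)"
    proof (rule F.fdd_char_limit[OF Y_0 _ t])
      fix s t l and V :: "real \<Rightarrow> 'a \<Rightarrow> complex" assume st: "0 \<le> s" "s < t" "t \<le> T" and V: "\<And>\<epsilon>. V \<epsilon> \<in> test \<epsilon> s"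
      obtain C where C: "\<And>\<epsilon> s t V. 0 \<le> s \<Longrightarrow> s < t \<Longrightarrow> t \<le> T \<Longrightarrow> V \<in> test \<epsilon> s \<Longrightarrow>
        cmod (expectation (\<lambda>\<omega>. V \<omega> * iexp (l \<bullet> (Y \<epsilon> t \<omega> - Y \<epsilon> s \<omega>))) - expectation V * of_real (1 - (norm l)\<^sup>2 * (t - s) / 2))
        \<le> err_bound l s t \<epsilon> + C * ((t - s) * sqrt (t - s))"
        using local_estimate[of l] by blast
      show "((\<lambda>\<epsilon>. expectation (\<lambda>\<omega>. V \<epsilon> \<omega> * iexp (l \<bullet> (Y \<epsilon> t \<omega> - Y \<epsilon> s \<omega>))) -
        expectation (V \<epsilon>) * of_real (exp (- ((norm l)\<^sup>2 * (t - s) / 2)))) \<longlongrightarrow> 0) (at_right 0)"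
      proof (rule F.char_increment_limit[OF st _ V])
        fix s t assume st: "0 \<le> s" "s < t" "t \<le> T"
        show "\<exists>\<rho>. (\<rho> \<longlongrightarrow> 0) (at_right 0) \<and> (\<forall>\<epsilon>. \<forall>V\<in>test \<epsilon> s.
          cmod (expectation (\<lambda>\<omega>. V \<omega> * iexp (l \<bullet> (Y \<epsilon> t \<omega> - Y \<epsilon> s \<omega>))) - expectation V * of_real (1 - (norm l)\<^sup>2 * (t - s) / 2))
          \<le> \<rho> \<epsilon> + C * ((t - s) * sqrt (t - s)))"
          using err_bound_limit[OF st] C[OF st] by blast
      qed
    qed
    then show "((\<lambda>\<epsilon>. \<integral>\<omega>. iexp (\<Sum>k\<le>K. l k \<bullet> Y \<epsilon> (t k) \<omega>) \<partial>M) \<longlongrightarrow> (\<integral>\<omega>. iexp (\<Sum>k\<le>K. l k \<bullet> W (t k) \<omega>) \<partial>N)) (at_right 0)"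
      unfolding multi_complex_brownian_motion_char[OF W t(1,2)] .
  qed (use C in auto)
qed

end

section \<open>Transfer to the original process and conditions\<close>

lemma converges_weakly_cong:
  assumes "converges_weakly S P Q F" "\<forall>\<^sub>F i in F. P i = P' i"
  shows "converges_weakly S P' Q F"
  unfolding converges_weakly_def
proof (intro conjI allI impI)
  have 1: "\<forall>\<^sub>F i in F. prob_space (P i) \<and> sets (P i) = sets (borel_sigma S)"
    using assms(1) by (simp add: converges_weakly_def)
  show "\<forall>\<^sub>F i in F. prob_space (P' i) \<and> sets (P' i) = sets (borel_sigma S)"
    using 1 assms(2) by eventually_elim simp
  show "prob_space Q" "sets Q = sets (borel_sigma S)" using assms(1) by (auto simp: converges_weakly_def)
  fix f :: "'a \<Rightarrow> real" assume "continuous_map S euclideanreal f" "bounded (f ` topspace S)"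
  then have l: "((\<lambda>i. \<integral>w. f w \<partial>P i) \<longlongrightarrow> (\<integral>w. f w \<partial>Q)) F" using assms(1) by (simp add: converges_weakly_def)
  have "\<forall>\<^sub>F i in F. (\<integral>w. f w \<partial>P i) = (\<integral>w. f w \<partial>P' i)" using assms(2) by eventually_elim simp
  from Lim_transform_eventually[OF l this] show "((\<lambda>i. \<integral>w. f w \<partial>P' i) \<longlongrightarrow> (\<integral>w. f w \<partial>Q)) F" .
qed

text \<open>Freezing the process at its value at time 0 on the negative half line yields joint
  measurability on the whole line and leaves the \<sigma>-algebras of the past unchanged.\<close>

lemma osc_process_max:
  assumes M: "prob_space M" and "jointly_measurable M X" and ind: "independent_increments M X"
  shows "osc_process M (\<lambda>s. X (max 0 s))"
proof -
  interpret prob_space M by fact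
  show ?thesis
  proof
    have "(\<lambda>p. (max 0 (fst p :: real), snd p)) \<in> borel \<Otimes>\<^sub>M M \<rightarrow>\<^sub>M restrict_space borel {0..} \<Otimes>\<^sub>M M"
      by (intro measurable_Pair measurable_restrict_space2) auto
    from measurable_compose[OF this assms(2)[unfolded jointly_measurable_def]]
    show "(\<lambda>p. X (max 0 (fst p)) (snd p)) \<in> borel_measurable (borel \<Otimes>\<^sub>M M)" by simp
    have "process_sigma M (\<lambda>s. X (max 0 s)) {0..s} = process_sigma M X {0..s}" for s
    proof -
      have "{X (max 0 u) -` A \<inter> space M |u A. u \<in> {0..s} \<and> A \<in> sets borel} =
          {X u -` A \<inter> space M |u A. u \<in> {0..s} \<and> A \<in> sets borel}"
        by (intro Collect_cong ex_cong1) auto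
      then show ?thesis by (simp add: process_sigma_def)
    qed
    then show "independent_increments M (\<lambda>s. X (max 0 s))"
      using ind unfolding independent_increments_def by (simp add: max_absorb2)
  qed
qed

theorem theorem4p1:
  fixes M :: "'a measure" and X :: "real \<Rightarrow> 'a \<Rightarrow> real" and T :: real
    and \<theta> :: "real ^ 'm" and c :: "real \<Rightarrow> real"
    and N :: "'b measure" and W :: "real \<Rightarrow> 'b \<Rightarrow> complex ^ 'm"
  assumes "0 < T"
    and "prob_space M"
    and "jointly_measurable M X"
    and "independent_increments M X"
    and "\<theta> \<in> admissible M X T"
    and "\<forall>j. cond_B M X T (\<theta> $ j) (c (\<theta> $ j))"
    and "multi_complex_brownian_motion N W"
  shows "converges_weakly (mtopology_of (path_space T))
           (\<lambda>\<epsilon>. path_law T M (x_eps X c \<theta> \<epsilon>)) (path_law T N W) (at_right 0)"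
proof -
  define X' where "X' s = X (max 0 s)" for s
  interpret X': osc_process M X'
    unfolding X'_def[abs_def] by (rule osc_process_max[OF assms(2-4)])
  have ph: "X'.ph \<alpha> y x = char_incr M X y x \<alpha>" if "0 \<le> x" "x \<le> y" for \<alpha> x y
    using that by (simp add: X'.ph_def char_incr_def X'_def max_absorb2)
  have J: "X'.J \<alpha> \<gamma> a b = (LINT y:{a..b}|lborel. LINT x:{a..y}|lborel. cmod (char_incr M X y x \<alpha>) * cmod (char_incr M X x a \<gamma>))"
    if "0 \<le> a" for \<alpha> \<gamma> a b
    unfolding X'.J_def using that
    by (intro set_lebesgue_integral_cong allI impI) (auto simp: ph)
  have J0: "X'.J \<alpha> 0 a b = (LINT y:{a..b}|lborel. LINT x:{a..y}|lborel. cmod (char_incr M X y x \<alpha>))"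
    if "0 \<le> a" for \<alpha> a b
    unfolding X'.J_def using that
    by (intro set_lebesgue_integral_cong allI impI) (auto simp: ph)
  have S: "X'.S \<alpha> a b = (LINT y:{a..b}|lborel. LINT x:{a..y}|lborel. char_incr M X y x \<alpha> + char_incr M X y x (- \<alpha>))"
    if "0 \<le> a" for \<alpha> a b
    unfolding X'.S_def using that
    by (intro set_lebesgue_integral_cong allI impI) (auto simp: ph)
  have A: "cond_A M X T (\<theta> $ j)" and C: "cond_C M X T (\<theta> $ j)" for j
    using assms(5) by (auto simp: admissible_def)
  have D: "cond_D M X T (\<theta> $ j) (\<theta> $ h)" if "h \<noteq> j" for j h
    using assms(5) that by (auto simp: admissible_def)
  have decay: "\<exists>K. X'.mean_decay (\<theta> $ j) K" for j
  proof -
    obtain K where K: "\<And>s t \<epsilon>. 0 \<le> s \<Longrightarrow> s < t \<Longrightarrow> t \<le> T \<Longrightarrow> 0 < \<epsilon> \<Longrightarrow>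
        \<epsilon>\<^sup>2 * (LINT y:{2 * s / \<epsilon>\<^sup>2..2 * t / \<epsilon>\<^sup>2}|lborel. LINT x:{2 * s / \<epsilon>\<^sup>2..y}|lborel. cmod (char_incr M X y x (\<theta> $ j))) \<le> K * (t - s)"
      using A[of j] unfolding cond_A_def by blast
    \<comment> \<open>The absolute value supplies the nonnegativity demanded by
      \<open>mean_decay\<close>; the factor 1/2 comes from the 2 in the rescaled times.\<close>
    have "X'.mean_decay (\<theta> $ j) (\<bar>K\<bar> / 2)"
      unfolding X'.mean_decay_def
    proof (intro conjI allI impI)
      fix a b :: real assume ab: "0 \<le> a" "a < b"
      txt \<open>Choosing \<open>2 * T / \<epsilon>\<^sup>2 = b\<close> removes the scaling from condition (A).\<close>
      define \<epsilon> where "\<epsilon> = sqrt (2 * T / b)"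
      have b: "0 < b" using ab by simp
      have \<epsilon>: "0 < \<epsilon>" "\<epsilon>\<^sup>2 = 2 * T / b" using assms(1) b by (simp_all add: \<epsilon>_def)
      have eq: "2 * (a * T / b) / \<epsilon>\<^sup>2 = a" "2 * T / \<epsilon>\<^sup>2 = b" using assms(1) b by (simp_all add: \<epsilon>)
      have "a * T / b < T" using ab b assms(1) by (simp add: field_simps)
      then have "\<epsilon>\<^sup>2 * X'.J (\<theta> $ j) 0 a b \<le> K * (T - a * T / b)"
        using K[of "a * T / b" T \<epsilon>] ab b assms(1) \<epsilon>(1) unfolding eq by (simp add: J0)
      \<comment> \<open>The left side carries 2 * T / b, the right side T * (b - a) / b; clearing b
        leaves half of \<open>K\<close>.\<close>
      then have "T * X'.J (\<theta> $ j) 0 a b \<le> T * (K / 2 * (b - a))"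
        unfolding \<epsilon>(2) using b by (simp add: field_simps)
      then have "X'.J (\<theta> $ j) 0 a b \<le> K / 2 * (b - a)" using assms(1) by simp
      also have "\<dots> \<le> \<bar>K\<bar> / 2 * (b - a)" using ab by (intro mult_right_mono) auto
      finally show "X'.J (\<theta> $ j) 0 a b \<le> \<bar>K\<bar> / 2 * (b - a)" .
    qed simp
    then show ?thesis by blast
  qed
  then have "\<forall>j. \<exists>K. X'.mean_decay (\<theta> $ j) K" ..
  from choice[OF this] obtain K where K: "\<And>j. X'.mean_decay (\<theta> $ j) (K j)" by blast
  have nn: "0 \<le> 2 * s / \<epsilon>\<^sup>2" if "0 \<le> s" for s \<epsilon> :: real using that by simp
  interpret X': osc_clt M X' \<theta> "\<lambda>j. c (\<theta> $ j)" K T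
  proof
    show "0 < T" "\<And>j. X'.mean_decay (\<theta> $ j) (K j)" by (fact assms(1), rule K)
    fix s t :: real assume st: "0 \<le> s" "s < t" "t \<le> T"
    show "((\<lambda>\<epsilon>. of_real (\<epsilon>\<^sup>2 * (c (\<theta> $ j))\<^sup>2) * X'.S (\<theta> $ j) (2 * s / \<epsilon>\<^sup>2) (2 * t / \<epsilon>\<^sup>2)) \<longlongrightarrow> of_real (2 * (t - s))) (at_right 0)" for j
      unfolding S[OF nn[OF st(1)]] using assms(6) st unfolding cond_B_def by blast
    show "((\<lambda>\<epsilon>. \<epsilon>\<^sup>2 * X'.J (\<theta> $ j) (2 * \<theta> $ j) (2 * s / \<epsilon>\<^sup>2) (2 * t / \<epsilon>\<^sup>2)) \<longlongrightarrow> 0) (at_right 0)" for j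
      unfolding J[OF nn[OF st(1)]] using C[of j] st unfolding cond_C_def by blast
    show "((\<lambda>\<epsilon>. \<epsilon>\<^sup>2 * X'.J (\<theta> $ j) (\<theta> $ j + \<sigma> * \<theta> $ h) (2 * s / \<epsilon>\<^sup>2) (2 * t / \<epsilon>\<^sup>2)) \<longlongrightarrow> 0) (at_right 0)"
      if "h \<noteq> j" "\<sigma> \<in> {-1, 1}" for j h \<sigma>
      unfolding J[OF nn[OF st(1)]] using D[OF that(1)] that(2) st unfolding cond_D_def by blast
  qed
  have Y: "x_eps X c \<theta> \<epsilon> t \<omega> = X'.Y \<epsilon> t \<omega>" if "0 < \<epsilon>" for \<epsilon> t \<omega>
  proof -
    have "(LINT s:{0..b}|lborel. iexp (\<alpha> * X s \<omega>)) = X'.G \<alpha> 0 b \<omega>" for \<alpha> b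
      unfolding X'.G_def by (intro set_lebesgue_integral_cong) (auto simp: X'.e_def X'_def max_absorb2)
    then show ?thesis using that by (simp add: x_eps_def X'.Y_def X'.tau_def X'.pos_def)
  qed
  have ps: "path_space T = cpath T" by (simp add: path_space_def cpath_def)
  have "\<forall>\<^sub>F \<epsilon> in at_right 0. distr M (borel_sigma (mtopology_of (cpath T))) (\<lambda>\<omega>. restrict (\<lambda>t. X'.Y \<epsilon> t \<omega>) {0..T}) =
      path_law T M (x_eps X c \<theta> \<epsilon>)"
    using eventually_at_right_less[of "0::real"] by eventually_elim (simp add: path_law_def ps Y)
  from converges_weakly_cong[OF X'.Y_converges_weakly[OF assms(7)] this]
  show ?thesis by (simp add: path_law_def ps)
qed

end
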